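(* Let $p$ be a prime and $\alpha,\beta$ integers different from $1$, and assume that either $p>3$, or $p=3$ and neither $\alpha$ nor $\beta$ is congruent to $7$ modulo $9$. Let $m=v_p(\alpha-1)$, $n=v_p(\beta-1)$, $\ell=v_p(\alpha-\beta)$, and suppose $m\ge n=\ell>0$. Then $|G_p|=p^{4n+m}$, the nilpotency class of $G_p$ is $3$, $o(a)=p^{m+n}$, $o(b)=p^{2n}$ and $o(c)=p^{n}$.
   Context: $G(\alpha,\beta)=\langle A,B\mid A^{[A,B]}=A^{\alpha},\ B^{[B,A]}=B^{\beta}\rangle$ with $[x,y]=x^{-1}y^{-1}xy$, $y^x=x^{-1}yx$, and $C=[A,B]$. The group $G(\alpha,\beta)$ is finite and nilpotent, hence the direct product of its Sylow subgroups; $G_p$ denotes its Sylow $p$-subgroup and $a,b,c$ denote the images of $A,B,C$ under the canonical projection $G(\alpha,\beta)\to G_p$. $v_p$ is the $p$-adic valuation and $o(x)$ the order of $x$. *)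

theory Defs
  imports "HOL-Algebra.Algebra" "HOL-Computational_Algebra.Primes"
begin

text \<open>Words in the free group on two generators. A letter is (g, i) where
  g = False means A, g = True means B, and i = True means the inverse letter.\<close>

type_synonym letter = "bool \<times> bool"
type_synonym word = "letter list"

definition flip_letter :: "letter \<Rightarrow> letter" where
  "flip_letter l = (fst l, \<not> snd l)"

definition winv :: "word \<Rightarrow> word" where
  "winv w = rev (map flip_letter w)"

definition wA :: word where "wA = [(False, False)]"
definition wB :: word where "wB = [(True, False)]"

definition wpow :: "word \<Rightarrow> int \<Rightarrow> word" where
  "wpow w k = (if 0 \<le> k then concat (replicate (nat k) w)
               else concat (replicate (nat (- k)) (winv w)))"

definition wcomm :: "word \<Rightarrow> word \<Rightarrow> word" where
  "wcomm x y = winv x @ winv y @ x @ y"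

definition wconj :: "word \<Rightarrow> word \<Rightarrow> word" where
  "wconj y x = winv x @ y @ x"

definition relators :: "int \<Rightarrow> int \<Rightarrow> word set" where
  "relators \<alpha> \<beta> =
     { wconj wA (wcomm wA wB) @ winv (wpow wA \<alpha>),
       wconj wB (wcomm wB wA) @ winv (wpow wB \<beta>) }"

inductive weq :: "int \<Rightarrow> int \<Rightarrow> word \<Rightarrow> word \<Rightarrow> bool" for \<alpha> \<beta> where
  refl: "weq \<alpha> \<beta> w w"
| sym: "weq \<alpha> \<beta> u v \<Longrightarrow> weq \<alpha> \<beta> v u"
| trans: "weq \<alpha> \<beta> u v \<Longrightarrow> weq \<alpha> \<beta> v w \<Longrightarrow> weq \<alpha> \<beta> u w"
| cancel: "weq \<alpha> \<beta> (u @ [l, flip_letter l] @ v) (u @ v)"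
| relator: "r \<in> relators \<alpha> \<beta> \<Longrightarrow> weq \<alpha> \<beta> (u @ r @ v) (u @ v)"

definition wclass :: "int \<Rightarrow> int \<Rightarrow> word \<Rightarrow> word set" where
  "wclass \<alpha> \<beta> w = {v. weq \<alpha> \<beta> v w}"

definition wmult :: "int \<Rightarrow> int \<Rightarrow> word set \<Rightarrow> word set \<Rightarrow> word set" where
  "wmult \<alpha> \<beta> U V = {w. \<exists>x\<in>U. \<exists>y\<in>V. weq \<alpha> \<beta> w (x @ y)}"

definition Gab :: "int \<Rightarrow> int \<Rightarrow> word set monoid" where
  "Gab \<alpha> \<beta> = \<lparr> carrier = range (wclass \<alpha> \<beta>),
      monoid.mult = wmult \<alpha> \<beta>, one = wclass \<alpha> \<beta> [] \<rparr>"

definition genA :: "int \<Rightarrow> int \<Rightarrow> word set" where "genA \<alpha> \<beta> = wclass \<alpha> \<beta> wA"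
definition genB :: "int \<Rightarrow> int \<Rightarrow> word set" where "genB \<alpha> \<beta> = wclass \<alpha> \<beta> wB"
definition genC :: "int \<Rightarrow> int \<Rightarrow> word set" where "genC \<alpha> \<beta> = wclass \<alpha> \<beta> (wcomm wA wB)"

text \<open>Sylow p-subgroup of a finite nilpotent group: the set of p-elements.\<close>
definition p_elements :: "('a, 'b) monoid_scheme \<Rightarrow> nat \<Rightarrow> 'a set" where
  "p_elements G p = {x \<in> carrier G. \<exists>k. group.ord G x = p ^ k}"

text \<open>Image of x under the canonical projection G \<rightarrow> G_p, i.e. the p-part of x:
  the unique p-element y such that x = y z with z a commuting p'-element.\<close>
definition p_part :: "('a, 'b) monoid_scheme \<Rightarrow> nat \<Rightarrow> 'a \<Rightarrow> 'a" where
  "p_part G p x = (THE y. y \<in> p_elements G p \<and>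
      (\<exists>z\<in>carrier G. coprime (group.ord G z) p \<and>
         y \<otimes>\<^bsub>G\<^esub> z = z \<otimes>\<^bsub>G\<^esub> y \<and> x = y \<otimes>\<^bsub>G\<^esub> z))"

text \<open>Lower central series: lcs 0 = gamma_1 = G, lcs (i+1) = [lcs i, G].\<close>
definition comm_subgroup :: "('a, 'b) monoid_scheme \<Rightarrow> 'a set \<Rightarrow> 'a set \<Rightarrow> 'a set" where
  "comm_subgroup G S T = generate G
     {monoid.mult G (monoid.mult G (monoid.mult G (m_inv G x) (m_inv G y)) x) y | x y. x \<in> S \<and> y \<in> T}"

fun lcs :: "('a, 'b) monoid_scheme \<Rightarrow> nat \<Rightarrow> 'a set" where
  "lcs G 0 = carrier G"
| "lcs G (Suc i) = comm_subgroup G (lcs G i) (carrier G)"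

definition nilpotency_class_eq :: "('a, 'b) monoid_scheme \<Rightarrow> nat \<Rightarrow> bool" where
  "nilpotency_class_eq G c \<longleftrightarrow> lcs G c = {\<one>\<^bsub>G\<^esub>} \<and> (\<forall>i<c. lcs G i \<noteq> {\<one>\<^bsub>G\<^esub>})"

end

theory Submission
  imports Defs "HOL-Number_Theory.Number_Theory"
begin

text \<open>
  Write the relations as \<open>ab = bac\<close>, \<open>ac = ca\<^sup>\<alpha>\<close>, \<open>cb = b\<^sup>\<beta>c\<close>. Evaluating \<open>ac\<^sup>kb\<close> in two ways
  expresses a power of \<open>b\<close> through powers of \<open>c\<close> and \<open>a\<close>; conjugating by \<open>c\<close> yields a power of \<open>b\<close>
  that equals a power of \<open>a\<close>, hence is central. So \<open>a\<close> and \<open>b\<close> have finite order, and varying \<open>k\<close>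
  shows that only primes dividing \<open>\<alpha> - 1\<close> (respectively \<open>\<beta> - 1\<close>) divide these orders. Consequently
  the powers of \<open>a, b, c\<close> to the idempotent exponents belonging to \<open>p\<close> and to its complement generate
  two commuting subgroups, each again satisfying the relations, whose product is the whole group. Every
  element of such a group has the form \<open>a\<^sup>ic\<^sup>kb\<^sup>j\<close>, so the first subgroup is the Sylow \<open>p\<close>-subgroup
  and the second has order prime to \<open>p\<close>.

  In the \<open>p\<close>-part the case \<open>k = 1\<close> reads \<open>b\<^sup>y = c\<^sup>\<delta>a\<^sup>x\<close> with \<open>v(y) = 2n\<close>, \<open>v(\<delta>) = n\<close>, \<open>v(x) \<ge> 2m\<close>;
  conjugating it by \<open>a\<close> and by \<open>b\<close> gives the upper bounds for the orders. The lower bounds come from two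
  quotients, each an extension of an abelian group by a cyclic one, which together detect every normal
  form \<open>a\<^sup>ic\<^sup>kb\<^sup>j\<close>. Finally \<open>a\<^bsup>\<alpha>-1\<^esup>\<close> and \<open>b\<^bsup>\<beta>-1\<^esup>\<close> are central and \<open>c\<close> is central modulo them.
\<close>

section \<open>Geometric sums\<close>

text \<open>The obstacle is that neither finiteness nor nilpotency of the group is an input, and
  that \<alpha> and \<beta> may be negative, whereas powers such as \<open>\<alpha>^k\<close> have
  to count letters. Taking k = 2 makes these powers natural numbers and yields a nonzero exponent
  killing b as soon as the absolute value of \<beta> is at least 2; once the orders are finite,
  \<alpha> and \<beta> may be replaced by natural residues. The correction exponent
  \<open>defect\<close> governs all upper estimates: its nonvanishing gives finite orders, its
  values modulo a prime q decide whether q can divide an order, and the valuation of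
  \<open>defect x x\<close> is the number 2n. For p = 3 that last valuation is larger than 2n when x
  is 7 modulo 9, which is the origin of the excluded residue. Neither of the two quotients behind
  the lower bounds suffices alone: one sees b only modulo \<open>p^n\<close>, the other sees a only
  modulo \<open>p^n\<close>, so the full orders of a and b are read off in different
  quotients.\<close>

definition geosum :: "int \<Rightarrow> nat \<Rightarrow> int" where
  "geosum x k = (\<Sum>t = 1..k. x ^ t)"

text \<open>\<open>geosum\<close> is the exponent of a created when a power of a passes b, and
  \<open>defect\<close> is the exponent of b created when a passes a power of b
  (\<open>apow_b\<close>, \<open>a_bpow\<close>). Equivalently, \<open>defect x k\<close> is the sum
  of \<open>x^k - x^t\<close> for t from 1 to k, so it vanishes for x = 1 and for k = 1.\<close>

definition defect :: "int \<Rightarrow> nat \<Rightarrow> int" where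
  "defect x k = int k * x ^ k - geosum x k"

lemma geosum_0 [simp]: "geosum x 0 = 0"
  by (simp add: geosum_def)

lemma geosum_Suc [simp]: "geosum x (Suc k) = geosum x k + x ^ Suc k"
  by (simp add: geosum_def)

lemma defect_0 [simp]: "defect x 0 = 0"
  by (simp add: defect_def)

lemma geosum_Suc': "geosum x (Suc k) = x * (1 + geosum x k)"
proof (induction k)
  case (Suc k)
  have "geosum x (Suc (Suc k)) = geosum x (Suc k) + x ^ Suc (Suc k)"
    by (rule geosum_Suc)
  also have "\<dots> = x * (1 + geosum x k) + x ^ Suc (Suc k)"
    by (simp only: Suc.IH)
  also have "\<dots> = x * (1 + (geosum x k + x ^ Suc k))"
    by (simp add: algebra_simps)
  finally show ?case
    by (simp only: geosum_Suc)
qed simp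

lemma defect_Suc: "defect x (Suc k) = (defect x k + x ^ k - 1) * x"
proof -
  have "geosum x k + x ^ Suc k = x * (1 + geosum x k)"
    using geosum_Suc' [of x k] by simp
  then show ?thesis
    by (simp add: defect_def algebra_simps)
qed

lemma geosum_closed_form: "(x - 1) * geosum x k = x ^ Suc k - x"
  by (induction k) (simp_all add: algebra_simps)

lemma geosum_add: "geosum x (i + j) = geosum x i + x ^ i * geosum x j"
  by (induction j) (simp_all add: algebra_simps power_add)

lemma geosum_mult: "geosum x (i * j) = geosum x i * (\<Sum>t<j. x ^ (i * t))"
proof (induction j)
  case (Suc j)
  have "geosum x (i * Suc j) = geosum x (i * j + i)"
    by (simp add: add.commute)
  also have "\<dots> = geosum x (i * j) + x ^ (i * j) * geosum x i"
    by (rule geosum_add)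
  finally show ?case
    using Suc by (simp add: algebra_simps)
qed simp

lemma geosum_cong:
  assumes "[x = y] (mod m)"
  shows "[geosum x k = geosum y k] (mod m)"
  unfolding geosum_def using assms by (intro cong_sum cong_pow)

lemma geosum_1 [simp]: "geosum 1 k = int k"
  by (simp add: geosum_def)

text \<open>Each step from \<open>u^k\<close> to \<open>u^(k + 1)\<close> multiplies the sum by u
  terms that are 1 modulo u. The base u may be composite: it is later also the part of \<alpha> - 1
  prime to p.\<close>

lemma dvd_geosum_power:
  assumes "int u dvd x - 1"
  shows "int u ^ k dvd geosum x (u ^ k * j)"
proof -
  have "int u ^ k dvd geosum x (u ^ k)"
  proof (induction k)
    case (Suc k)
    have "[(\<Sum>t<u. x ^ (u ^ k * t)) = (\<Sum>t<u. 1 ^ (u ^ k * t))] (mod int u)"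
      using assms by (intro cong_sum cong_pow) (simp add: cong_iff_dvd_diff)
    then have "int u dvd (\<Sum>t<u. x ^ (u ^ k * t))"
      by (simp add: cong_dvd_iff)
    with Suc have "int u ^ k * int u dvd geosum x (u ^ k) * (\<Sum>t<u. x ^ (u ^ k * t))"
      by (rule mult_dvd_mono)
    then have "int u ^ k * int u dvd geosum x (u ^ k * u)"
      by (simp only: geosum_mult)
    then show ?case
      by (simp add: mult.commute)
  qed simp
  then show ?thesis
    by (simp add: geosum_mult)
qed

lemma coprime_of_dvd_diff_one:
  fixes x u :: int
  assumes "u dvd x - 1"
  shows "coprime x u"
proof (rule coprimeI)
  fix e assume "e dvd x" "e dvd u"
  then have "e dvd x - (x - 1)"
    using assms by (meson dvd_diff dvd_trans)
  then show "is_unit e"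
    by simp
qed

lemma dvd_power_power_minus_one:
  assumes "int u dvd x - 1" "u ^ k dvd j"
  shows "int u ^ k dvd x ^ j - 1"
proof -
  obtain i where j: "j = u ^ k * i"
    using assms(2) by blast
  have "int u ^ k dvd (x - 1) * geosum x j"
    unfolding j using dvd_geosum_power [OF assms(1)] by simp
  then have "int u ^ k dvd x * (x ^ j - 1)"
    by (simp only: geosum_closed_form) (simp add: algebra_simps)
  moreover have "coprime (int u ^ k) x"
    using coprime_of_dvd_diff_one [OF assms(1)] by (simp add: coprime_commute)
  ultimately show ?thesis
    by (simp add: coprime_dvd_mult_right_iff)
qed

lemma dvd_geosum:
  assumes "int u dvd x - 1" "u ^ k dvd j"
  shows "int u ^ k dvd geosum x j"
proof -
  obtain i where "j = u ^ k * i"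
    using assms(2) by blast
  then show ?thesis
    using dvd_geosum_power [OF assms(1)] by simp
qed

lemma int_power_dvd_int: "u ^ k dvd j \<Longrightarrow> int u ^ k dvd int j"
  using int_dvd_int_iff [of "u ^ k" j] by simp

text \<open>In the next three lemmas \<open>r\<close> and \<open>s\<close> are the idempotents of a splitting of \<open>\<int>/N\<close>
  into its \<open>U\<close>-part and its \<open>V\<close>-part.\<close>

lemma splitting_defect:
  assumes "int U dvd x - 1" "int V dvd x - 1" "coprime U V"
    and "int N dvd int U ^ k * int V ^ k"
    and "[int r = 1] (mod int U ^ k)" "V ^ k dvd r" "r > 0"
  shows "int N dvd defect x r"
proof -
  have V: "int V ^ k dvd defect x r"
    unfolding defect_def
    using dvd_geosum [OF assms(2,6)] int_power_dvd_int [OF assms(6)] by simp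
  \<comment> \<open>Modulo \<open>U^k\<close> the exponent r is congruent to 1, so the defect at r
    behaves like \<open>defect x 1 = 0\<close>.\<close>
  have U: "int U ^ k dvd defect x r"
  proof -
    have "[int (r - 1) = 0] (mod int U ^ k)"
      using assms(5,7) by (simp add: of_nat_diff cong_iff_dvd_diff)
    then have dvd: "U ^ k dvd r - 1"
      using int_dvd_int_iff [of "U ^ k" "r - 1"] by (simp add: cong_0_iff)
    have "geosum x r = x + x * geosum x (r - 1)"
      using geosum_add [of x 1 "r - 1"] assms(7) by (simp add: geosum_def)
    moreover have "int r * x ^ r = int r * (x * (x ^ (r - 1) - 1)) + x * (int r - 1) + x"
      using assms(7) by (cases r) (simp_all add: algebra_simps)
    ultimately have "defect x r = int r * (x * (x ^ (r - 1) - 1)) + x * (int r - 1) - x * geosum x (r - 1)"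
      by (simp add: defect_def)
    moreover have "int U ^ k dvd x ^ (r - 1) - 1" "int U ^ k dvd geosum x (r - 1)"
      using dvd_power_power_minus_one [OF assms(1) dvd] dvd_geosum [OF assms(1) dvd] .
    moreover have "int U ^ k dvd int r - 1"
      using assms(5) by (simp add: cong_iff_dvd_diff)
    ultimately show ?thesis
      by (simp add: dvd_add dvd_diff dvd_mult)
  qed
  have "int U ^ k * int V ^ k dvd defect x r"
    using U V assms(3) by (intro divides_mult) simp_all
  then show ?thesis
    using assms(4) dvd_trans by blast
qed

lemma splitting_power:
  assumes "int U dvd x - 1"
    and "int N dvd int U ^ k * int V ^ k"
    and "V ^ k dvd r" "U ^ k dvd s"
  shows "int N dvd int r * (x ^ s - 1)"
proof -
  have "int V ^ k dvd int r"
    using assms(3) by (rule int_power_dvd_int)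
  then have "int V ^ k * int U ^ k dvd int r * (x ^ s - 1)"
    using dvd_power_power_minus_one [OF assms(1,4)] by (rule mult_dvd_mono)
  then show ?thesis
    using dvd_trans [OF assms(2)] by (simp only: mult.commute)
qed

lemma splitting_defect_power:
  assumes "int U dvd x - 1" "int V dvd x - 1" "coprime U V"
    and "int N dvd int U ^ k * int V ^ k"
    and "V ^ k dvd r" "U ^ k dvd s"
  shows "int N dvd defect (x ^ r) s"
proof -
  have "x - 1 dvd x ^ r - 1"
    using power_diff_1_eq [of x r] by simp
  then have "int U dvd x ^ r - 1"
    using assms(1) dvd_trans by blast
  then have "int U ^ k dvd geosum (x ^ r) s"
    using assms(6) by (rule dvd_geosum)
  moreover have "int U ^ k dvd int s"
    using assms(6) by (rule int_power_dvd_int)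
  ultimately have U: "int U ^ k dvd defect (x ^ r) s"
    unfolding defect_def by simp
  \<comment> \<open>Modulo \<open>V^k\<close> the base \<open>x^r\<close> is 1, and the defect for
    base 1 vanishes.\<close>
  have 1: "[x ^ r = 1] (mod int V ^ k)"
    using dvd_power_power_minus_one [OF assms(2,5)] by (simp add: cong_iff_dvd_diff)
  have "[int s * (x ^ r) ^ s - geosum (x ^ r) s = int s * 1 ^ s - geosum 1 s] (mod int V ^ k)"
    by (intro cong_diff cong_mult cong_refl cong_pow geosum_cong 1)
  then have V: "int V ^ k dvd defect (x ^ r) s"
    by (simp add: defect_def cong_0_iff)
  have "int U ^ k * int V ^ k dvd defect (x ^ r) s"
    using U V assms(3) by (intro divides_mult) simp_all
  then show ?thesis
    using assms(4) dvd_trans by blast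
qed

section \<open>Expansions at 1 + u and divisibility by powers of a prime\<close>

lemma power_expansion:
  fixes u :: int
  shows "\<exists>q. (1 + u) ^ k = 1 + int k * u + int (k choose 2) * u ^ 2 + q * u ^ 3"
proof (induction k)
  case 0
  show ?case by (intro exI [of _ 0]) (simp add: binomial_eq_0)
next
  case (Suc k)
  then obtain q where q: "(1 + u) ^ k = 1 + int k * u + int (k choose 2) * u ^ 2 + q * u ^ 3"
    by blast
  have "(1 + u) ^ Suc k = (1 + u) * (1 + int k * u + int (k choose 2) * u ^ 2 + q * u ^ 3)"
    by (simp add: q)
  also have "\<dots> = 1 + int (Suc k) * u + int (Suc k choose 2) * u ^ 2 + (int (k choose 2) + q + q * u) * u ^ 3"
    by (simp add: numeral_2_eq_2 numeral_3_eq_3 algebra_simps)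
  finally show ?case
    by blast
qed

text \<open>The recursion \<open>defect_Suc\<close> turns the expansion of \<open>(1 + u)^k\<close>
  into Pascal's rule for the coefficients. Terms beyond the second order are collected in q, since u
  will be divisible by p.\<close>

lemma defect_expansion:
  fixes u :: int
  shows "\<exists>q. defect (1 + u) k = (1 + u) * (int (k choose 2) * u + 2 * int (k choose 3) * u ^ 2 + q * u ^ 3)"
proof (induction k)
  case 0
  show ?case by (intro exI [of _ 0]) (simp add: binomial_eq_0)
next
  case (Suc k)
  then obtain q where q: "defect (1 + u) k = (1 + u) * (int (k choose 2) * u + 2 * int (k choose 3) * u ^ 2 + q * u ^ 3)"
    by blast
  obtain q' where q': "(1 + u) ^ k = 1 + int k * u + int (k choose 2) * u ^ 2 + q' * u ^ 3"
    using power_expansion by blast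
  have "defect (1 + u) (Suc k) = (1 + u) * (defect (1 + u) k + (1 + u) ^ k - 1)"
    by (simp add: defect_Suc)
  also have "defect (1 + u) k + (1 + u) ^ k - 1 = int (Suc k choose 2) * u + 2 * int (Suc k choose 3) * u ^ 2
      + (2 * int (k choose 3) + q + q * u + q') * u ^ 3"
    unfolding q q' by (simp add: numeral_2_eq_2 numeral_3_eq_3 algebra_simps)
  finally show ?case
    by blast
qed

text \<open>Splits the defect at a product exponent along the factors, which permits induction on
  the exponent of p: for j = p and x congruent to 1 modulo p the remaining sum contributes a further
  factor p.\<close>

lemma defect_mult:
  "defect x (i * j) = int i * defect (x ^ i) j + defect x i * (\<Sum>t<j. x ^ (i * t))"
proof -
  have "geosum (x ^ i) j = x ^ i * (\<Sum>t<j. x ^ (i * t))"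
    by (induction j) (simp_all add: algebra_simps power_mult [symmetric] power_add)
  then show ?thesis
    by (simp add: defect_def geosum_mult algebra_simps power_mult)
qed

lemma dvd_defect: "x - 1 dvd defect x k"
  using defect_expansion [of "x - 1" k] by (auto simp: power2_eq_square power3_eq_cube)

lemma prime_power_dvd_power_minus_one:
  assumes p: "Factorial_Ring.prime p" "p > 2" and "n > 0" "int p ^ n dvd x - 1" "p ^ e dvd k"
  shows "int p ^ (e + n) dvd x ^ k - 1"
proof -
  have "int p ^ (e + n) dvd x ^ (p ^ e) - 1"
  proof (induction e)
    case (Suc e)
    have "x ^ p ^ Suc e - 1 = (x ^ p ^ e - 1) * (\<Sum>t<p. (x ^ p ^ e) ^ t)"
      using power_diff_1_eq [of "x ^ p ^ e" p] by (simp only: power_mult [symmetric] power_Suc mult.commute)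
    moreover have "int p dvd (\<Sum>t<p. (x ^ p ^ e) ^ t)"
    proof -
      have "int p dvd x ^ p ^ e - 1"
        using Suc \<open>n > 0\<close> by (meson add_gr_0 dvd_power dvd_trans)
      then have "[(\<Sum>t<p. (x ^ p ^ e) ^ t) = (\<Sum>t<p. 1 ^ t)] (mod int p)"
        by (intro cong_sum cong_pow) (simp add: cong_iff_dvd_diff)
      then show ?thesis
        by (simp add: cong_dvd_iff)
    qed
    ultimately have "int p ^ (e + n) * int p dvd x ^ p ^ Suc e - 1"
      using mult_dvd_mono [OF Suc] by presburger
    then show ?case
      by (simp add: mult.commute)
  qed (use assms in simp)
  moreover have "x ^ (p ^ e) - 1 dvd x ^ k - 1"
    using assms(5) power_diff_1_eq [of "x ^ p ^ e"] by (auto simp: power_mult)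
  ultimately show ?thesis
    using dvd_trans by blast
qed

text \<open>Induction on e by \<open>defect_mult\<close>: the step to \<open>p^(e + 1)\<close> adds
  \<open>p^e * defect (x^(p^e)) p\<close>, and that defect is divisible by \<open>p^(n + 1)\<close>
  because p is odd and therefore divides \<open>p choose 2\<close>.\<close>

lemma prime_power_dvd_defect:
  assumes p: "Factorial_Ring.prime p" "p > 2" and n: "n > 0" "int p ^ n dvd x - 1" and "p ^ e dvd k"
  shows "int p ^ (e + n) dvd defect x k"
proof -
  have *: "int p ^ (e + n) dvd defect x (p ^ e)"
  proof (induction e)
    case 0
    show ?case by (simp add: defect_def)
  next
    case (Suc e)
    define u where "u = x ^ p ^ e - 1"
    have u: "int p ^ n dvd u"
      unfolding u_def using prime_power_dvd_power_minus_one [OF p n, of 0 "p ^ e"] by simp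
    have "int p ^ Suc n dvd defect (x ^ p ^ e) p"
    proof -
      obtain q where q: "defect (1 + u) p = (1 + u) * (int (p choose 2) * u + 2 * int (p choose 3) * u ^ 2 + q * u ^ 3)"
        using defect_expansion by blast
      have "p dvd p choose 2"
        using p by (intro dvd_choose_prime) auto
      then have "int p ^ Suc n dvd int (p choose 2) * u"
        using u by (simp add: mult_dvd_mono)
      moreover have u2: "int p ^ Suc n dvd u ^ 2"
      proof -
        have "int p ^ Suc n dvd int p ^ (n + n)"
          using n(1) by (intro le_imp_power_dvd) simp
        then show ?thesis
          using dvd_trans mult_dvd_mono [OF u u] unfolding power_add power2_eq_square by blast
      qed
      moreover have "int p ^ Suc n dvd u ^ 3"
        using u2 by (simp add: power3_eq_cube power2_eq_square mult.assoc)
      ultimately have "int p ^ Suc n dvd defect (1 + u) p"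
        unfolding q by (intro dvd_mult [of _ _ "1 + u"] dvd_add) (simp_all add: dvd_mult)
      then show ?thesis
        by (simp add: u_def)
    qed
    then have 1: "int p ^ (Suc e + n) dvd int (p ^ e) * defect (x ^ p ^ e) p"
      using mult_dvd_mono [of "int p ^ e" "int p ^ e"] by (simp add: power_add mult_ac)
    have "int p dvd u"
      using u n(1) by (meson dvd_power dvd_trans)
    then have "[(\<Sum>t<p. x ^ (p ^ e * t)) = (\<Sum>t<p. 1 ^ t)] (mod int p)"
      by (simp only: power_mult, intro cong_sum cong_pow) (simp add: cong_iff_dvd_diff u_def)
    then have "int p dvd (\<Sum>t<p. x ^ (p ^ e * t))"
      by (simp add: cong_dvd_iff)
    then have "int p ^ (e + n) * int p dvd defect x (p ^ e) * (\<Sum>t<p. x ^ (p ^ e * t))"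
      by (rule mult_dvd_mono [OF Suc])
    then have "int p ^ (Suc e + n) dvd defect x (p ^ e) * (\<Sum>t<p. x ^ (p ^ e * t))"
      by (simp only: add_Suc power_Suc2)
    with 1 have "int p ^ (Suc e + n) dvd defect x (p ^ e * p)"
      unfolding defect_mult by (rule dvd_add)
    then show ?case
      by (simp add: mult.commute)
  qed
  obtain j where j: "k = p ^ e * j"
    using assms(5) by blast
  have "int p ^ n dvd x ^ p ^ e - 1"
    using prime_power_dvd_power_minus_one [OF p n, of 0 "p ^ e"] by simp
  then have "int p ^ n dvd defect (x ^ p ^ e) j"
    using dvd_defect dvd_trans by blast
  then have "int p ^ (e + n) dvd int (p ^ e) * defect (x ^ p ^ e) j"
    by (simp add: power_add)
  then show ?thesis
    unfolding j defect_mult using * by simp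
qed

text \<open>Raising 1 + u to the power p increases the valuation of u by exactly one because p is
  odd. Valuations are carried as explicit cofactors prime to p, since these cofactors are later
  inverted as exponents.\<close>

lemma lifting_the_exponent:
  assumes p: "Factorial_Ring.prime p" "p > 2" and "m > 0"
    and "x - 1 = int p ^ m * t" "\<not> int p dvd t" "k = p ^ e * s" "\<not> p dvd s"
  shows "\<exists>w. x ^ k - 1 = int p ^ (m + e) * w \<and> \<not> int p dvd w"
proof -
  have "\<exists>w. x ^ (p ^ e) - 1 = int p ^ (m + e) * w \<and> \<not> int p dvd w"
  proof (induction e)
    case 0
    then show ?case using assms by auto
  next
    case (Suc e)
    then obtain w where w: "x ^ (p ^ e) - 1 = int p ^ (m + e) * w" "\<not> int p dvd w"
      by blast
    define M where "M = m + e - 1"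
    have M: "m + e = Suc M"
      using \<open>m > 0\<close> by (simp add: M_def)
    define u where "u = int p ^ Suc M * w"
    obtain q where q: "(1 + u) ^ p = 1 + int p * u + int (p choose 2) * u ^ 2 + q * u ^ 3"
      using power_expansion by blast
    have "p dvd p choose 2"
      using p by (intro dvd_choose_prime) auto
    then obtain h where h: "p choose 2 = p * h"
      by blast
    \<comment> \<open>z collects the terms of order two and higher in u after division by
      \<open>p^(m + e + 2)\<close>.\<close>
    define z where "z = int h * int p ^ M * w ^ 2 + q * (int p ^ M) ^ 2 * w ^ 3"
    have "1 + u = x ^ p ^ e"
      using w(1) M by (simp add: u_def)
    then have "x ^ p ^ Suc e = (1 + u) ^ p"
      by (simp add: power_mult [symmetric] mult.commute)
    then have "x ^ p ^ Suc e - 1 = int p ^ (m + Suc e) * (w + int p * z)"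
      unfolding q h using M
      by (simp add: u_def z_def algebra_simps power2_eq_square power3_eq_cube)
    moreover have "\<not> int p dvd w + int p * z"
      using w(2) by (simp add: dvd_add_left_iff)
    ultimately show ?case
      by blast
  qed
  then obtain w where w: "x ^ (p ^ e) - 1 = int p ^ (m + e) * w" "\<not> int p dvd w"
    by blast
  have "x ^ k - 1 = (x ^ p ^ e - 1) * (\<Sum>i<s. (x ^ p ^ e) ^ i)"
    using power_diff_1_eq [of "x ^ p ^ e" s] by (simp add: assms(6) power_mult)
  then have "x ^ k - 1 = int p ^ (m + e) * (w * (\<Sum>i<s. (x ^ p ^ e) ^ i))"
    by (simp add: w(1))
  moreover have "\<not> int p dvd (\<Sum>i<s. (x ^ p ^ e) ^ i)"
  proof -
    have "int p dvd x ^ p ^ e - 1"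
      unfolding w(1) using \<open>m > 0\<close> by simp
    then have "[(\<Sum>i<s. (x ^ p ^ e) ^ i) = (\<Sum>i<s. 1 ^ i)] (mod int p)"
      by (intro cong_sum cong_pow) (simp add: cong_iff_dvd_diff)
    then show ?thesis
      using assms(7) by (simp add: cong_dvd_iff)
  qed
  moreover have "Factorial_Ring.prime (int p)"
    using p by simp
  ultimately show ?thesis
    using w(2) prime_dvd_multD by blast
qed

text \<open>For k = x = 1 + u the binomial coefficients are themselves multiples of u up to
  denominators, which produces the square of x - 1; the factor 6 clears the denominators of
  \<open>x choose 2\<close> and \<open>x choose 3\<close>.\<close>

lemma six_defect_self:
  "\<exists>q. 6 * defect (int x) x = int x * (int x - 1)\<^sup>2 * (3 + (int x - 1) + 2 * (int x - 1) ^ 3 + 6 * q * (int x - 1))"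
proof -
  define u where "u = int x - 1"
  obtain q where q: "defect (1 + u) x = (1 + u) * (int (x choose 2) * u + 2 * int (x choose 3) * u ^ 2 + q * u ^ 3)"
    using defect_expansion by blast
  have c2: "2 * int (x choose 2) = int x * (int x - 1)"
    by (induction x) (simp_all add: numeral_2_eq_2 algebra_simps)
  have c3: "6 * int (x choose 3) = int x * (int x - 1) * (int x - 2)"
  proof (induction x)
    case (Suc x)
    have "2 * int (x choose 2) = int x * (int x - 1)"
      by (induction x) (simp_all add: numeral_2_eq_2 algebra_simps)
    moreover have "Suc x choose 3 = (x choose 2) + (x choose 3)"
      by (simp add: numeral_2_eq_2 numeral_3_eq_3)
    ultimately show ?case
      using Suc by (simp add: algebra_simps)
  qed simp
  have "6 * defect (int x) x = (1 + u) * (3 * (2 * int (x choose 2)) * u + 2 * (6 * int (x choose 3)) * u ^ 2 + 6 * q * u ^ 3)"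
    using q by (simp add: u_def algebra_simps)
  also have "\<dots> = (1 + u) * (u\<^sup>2 * (3 + u + 2 * u ^ 3 + 6 * q * u))"
    unfolding c2 c3 by (simp add: u_def algebra_simps power2_eq_square power3_eq_cube)
  finally show ?thesis
    unfolding u_def by (auto simp: mult.assoc)
qed


lemma prime_coprime_small:
  assumes "Factorial_Ring.prime p" "p > 3"
  shows "coprime (int p) 6"
proof -
  have "coprime p 2" "coprime p 3"
    using assms primes_coprime [of p 2] primes_coprime [of p 3] by auto
  then have "coprime p (2 * 3)"
    by (simp only: coprime_mult_right_iff)
  then have "coprime (int p) (int 6)"
    by (simp only: coprime_int_iff) simp
  then show ?thesis
    by simp
qed

text \<open>For p > 3 the factor 6 can be cancelled. For p = 3 the last bracket of
  \<open>six_defect_self\<close> is divisible by 3 as well, and only the factor 2 remains to be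
  cancelled.\<close>

lemma prime_power_dvd_defect_self:
  assumes p: "Factorial_Ring.prime p" "p > 2" and m: "m > 0" "int p ^ m dvd int x - 1"
  shows "int p ^ (2 * m) dvd defect (int x) x"
proof -
  define u where "u = int x - 1"
  obtain q where q: "6 * defect (int x) x = int x * u\<^sup>2 * (3 + u + 2 * u ^ 3 + 6 * q * u)"
    using six_defect_self unfolding u_def by blast
  have u2: "int p ^ (2 * m) dvd u\<^sup>2"
    using dvd_power_same [OF m(2), of 2] by (simp add: u_def power_mult [symmetric] mult.commute)
  show ?thesis
  proof (cases "p = 3")
    case True
    have "int p dvd u"
      using m unfolding u_def by (meson dvd_power dvd_trans)
    then obtain v where v: "u = 3 * v"
      using True by auto
    define B where "B = 1 + v + 18 * v ^ 3 + 6 * q * v"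
    have "3 + u + 2 * u ^ 3 + 6 * q * u = 3 * B"
      by (simp add: v B_def power3_eq_cube algebra_simps)
    with q have "2 * defect (int x) x = u\<^sup>2 * (int x * B)"
      by simp
    then have "int p ^ (2 * m) dvd 2 * defect (int x) x"
      using u2 by simp
    moreover have "coprime (int p ^ (2 * m)) 2"
      unfolding True by (rule coprime_power_left_iff [THEN iffD2]) simp
    ultimately show ?thesis
      by (simp only: coprime_dvd_mult_right_iff)
  next
    case False
    then have "coprime (int p ^ (2 * m)) 6"
      using prime_coprime_small p by simp
    moreover have "int p ^ (2 * m) dvd 6 * defect (int x) x"
      unfolding q using u2 by (intro dvd_mult2 dvd_mult)
    ultimately show ?thesis
      by (simp only: coprime_dvd_mult_right_iff)
  qed
qed

text \<open>The last bracket of \<open>six_defect_self\<close> decides. For p > 3 it is 3 modulo p,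
  hence a unit. For p = 3 and u = 3v, a third of it is 1 + v modulo 3, which vanishes exactly when x
  is 7 modulo 9.\<close>

lemma defect_self_valuation:
  assumes p: "Factorial_Ring.prime p" "p > 3 \<or> p = 3 \<and> int x mod 9 \<noteq> 7"
    and n: "n > 0" "int x - 1 = int p ^ n * t" "\<not> int p dvd t"
  shows "\<exists>w. defect (int x) x = int p ^ (2 * n) * w \<and> \<not> int p dvd w"
proof -
  define u where "u = int x - 1"
  obtain q where q: "6 * defect (int x) x = int x * u\<^sup>2 * (3 + u + 2 * u ^ 3 + 6 * q * u)"
    using six_defect_self unfolding u_def by blast
  have prime: "Factorial_Ring.prime (int p)"
    using p by simp
  have pu: "int p dvd u"
    unfolding u_def using n by simp
  have px: "\<not> int p dvd int x"
  proof
    assume "int p dvd int x"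
    then have "int p dvd int x - u"
      using pu by (rule dvd_diff)
    then have "int p dvd 1"
      by (simp only: u_def) simp
    then show False
      using prime not_prime_unit by blast
  qed
  have "int p ^ (2 * n) dvd defect (int x) x"
    using p n by (intro prime_power_dvd_defect_self) auto
  then obtain w where w: "defect (int x) x = int p ^ (2 * n) * w"
    by blast
  have nxt: "\<not> int p dvd int x * t\<^sup>2"
    using px n(3) prime_dvd_multD [OF prime] prime_dvd_power [OF prime] by blast
  have u2: "u\<^sup>2 = int p ^ (2 * n) * t\<^sup>2"
    unfolding u_def n(2) by (simp add: power_mult_distrib power_mult [symmetric] mult.commute)
  have "int p ^ (2 * n) \<noteq> 0"
    using prime by auto
  have "\<not> int p dvd w"
  proof
    assume "int p dvd w"
    have "int p ^ (2 * n) * (6 * w) = int p ^ (2 * n) * (int x * t\<^sup>2 * (3 + u + 2 * u ^ 3 + 6 * q * u))"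
      using q unfolding w u2 by (simp add: mult_ac)
    then have 6: "6 * w = int x * t\<^sup>2 * (3 + u + 2 * u ^ 3 + 6 * q * u)"
      using \<open>int p ^ (2 * n) \<noteq> 0\<close> by (simp only: mult_cancel_left) blast
    show False
    proof (cases "p = 3")
      case True
      obtain v where v: "u = 3 * v"
        using True pu by auto
      define B where "B = 1 + v + 18 * v ^ 3 + 6 * q * v"
      have "3 + u + 2 * u ^ 3 + 6 * q * u = 3 * B"
        by (simp add: v B_def power3_eq_cube algebra_simps)
      with 6 have "2 * w = int x * t\<^sup>2 * B"
        by simp
      then have "int p dvd int x * t\<^sup>2 * B"
        using dvd_mult [OF \<open>int p dvd w\<close>, of 2] by simp
      then have "int p dvd B"
        using nxt prime_dvd_multD [OF prime] by blast
      moreover have "B = (1 + v) + 3 * (6 * v ^ 3 + 2 * q * v)"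
        by (simp add: B_def)
      ultimately have "3 dvd 1 + v"
        using True by (simp add: dvd_add_left_iff)
      then have "int x mod 9 = 7"
        using v unfolding u_def by presburger
      then show False
        using p True by simp
    next
      case False
      then have "p > 3" using p by simp
      have "int p dvd int x * t\<^sup>2 * (3 + u + 2 * u ^ 3 + 6 * q * u)"
        using 6 dvd_mult [OF \<open>int p dvd w\<close>, of 6] by simp
      then have "int p dvd 3 + u + 2 * u ^ 3 + 6 * q * u"
        using nxt prime_dvd_multD [OF prime] by blast
      moreover have "3 + u + 2 * u ^ 3 + 6 * q * u = 3 + u * (1 + 2 * u\<^sup>2 + 6 * q)"
        by (simp add: algebra_simps power2_eq_square power3_eq_cube)
      moreover have "int p dvd u * (1 + 2 * u\<^sup>2 + 6 * q)"
        using pu by (rule dvd_mult2)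
      ultimately have "int p dvd 3"
        by (simp only: dvd_add_left_iff)
      then have "int p \<le> 3"
        by (rule zdvd_imp_le) simp
      then show False
        using \<open>p > 3\<close> by simp
    qed
  qed
  with w show ?thesis
    by blast
qed

section \<open>Nonvanishing of the defect, over the integers and modulo a prime\<close>

lemma defect_closed_form: "(x - 1) * defect x k = int k * x ^ k * (x - 1) - (x ^ Suc k - x)"
  using geosum_closed_form [of x k] by (simp add: defect_def algebra_simps)

lemma abs_geosum_le: "\<bar>geosum x k\<bar> \<le> geosum \<bar>x\<bar> k"
  by (induction k) (auto simp: abs_mult power_abs intro: order_trans [OF abs_triangle_ineq])

lemma defect_pos:
  assumes "x \<ge> 2" "k \<ge> 2"
  shows "defect x k > 0"
  using assms(2)
proof (induction k rule: dec_induct)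
  case base
  have "defect x 2 = x * (x - 1)"
    by (simp add: defect_def numeral_2_eq_2 algebra_simps)
  then show ?case
    using assms by simp
next
  case (step k)
  have "x ^ k \<ge> 1"
    using assms by simp
  then have "defect x k + x ^ k - 1 > 0"
    using step by linarith
  then show ?case
    using assms by (simp add: defect_Suc)
qed

text \<open>A zero would force the sum of the \<open>x^t\<close> to have absolute value
  \<open>k * \<bar>x\<bar>^k\<close>, which by \<open>defect_pos\<close> exceeds even the sum of the
  \<open>\<bar>x\<bar>^t\<close>.\<close>

lemma defect_nonzero:
  assumes "\<bar>x\<bar> \<ge> 2" "k \<ge> 2"
  shows "defect x k \<noteq> 0"
proof
  assume "defect x k = 0"
  then have "geosum x k = int k * x ^ k"
    by (simp add: defect_def)
  then have "int k * \<bar>x\<bar> ^ k = \<bar>geosum x k\<bar>"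
    by (simp add: abs_mult power_abs)
  also have "\<dots> \<le> geosum \<bar>x\<bar> k"
    by (rule abs_geosum_le)
  finally show False
    using defect_pos [OF assms] by (simp add: defect_def)
qed

text \<open>Suppose all these defects vanish modulo q, and let d be the order of B modulo q.
  Multiplied by B - 1 this says \<open>K * B^K * (B - 1) = B * (B^K - 1)\<close> modulo q for every
  power K of B. The choice \<open>K = B^d\<close> shows that d divides \<open>B^d - 1\<close>, so B
  is prime to d and \<open>K = B^(totient d)\<close> is 1 modulo d. For this K the congruence gives
  K = 1 modulo q, so d divides \<open>totient d\<close>, which is positive and smaller than
  d.\<close>

lemma prime_not_dvd_defect:
  fixes q B :: nat
  assumes "Factorial_Ring.prime q" "\<not> q dvd B" "\<not> [B = 1] (mod q)"
  shows "\<exists>k. \<not> int q dvd defect (int B) (B ^ k)"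
proof (rule ccontr)
  assume "\<nexists>k. \<not> int q dvd defect (int B) (B ^ k)"
  then have dvd: "int q dvd defect (int B) (B ^ k)" for k
    by blast
  define d where "d = Pocklington.ord q B"
  have cop: "coprime q B"
    using assms prime_imp_coprime by blast
  have d: "[B ^ k = 1] (mod q) \<longleftrightarrow> d dvd k" for k
    unfolding d_def by (rule ord_divides)
  have "d > 0"
    unfolding d_def using cop by (simp add: coprime_commute)
  have "d \<noteq> 1"
    using d [of 1] assms by auto
  have key: "[int K * int B ^ K * (int B - 1) = int B * (int B ^ K - 1)] (mod int q)" if "K = B ^ k" for K k
  proof -
    have "int q dvd (int B - 1) * defect (int B) K"
      using dvd [of k] that by simp
    then show ?thesis
      unfolding defect_closed_form by (simp add: cong_iff_dvd_diff algebra_simps)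
  qed
  have copint: "coprime (int B) (int q)"
    using cop by (simp add: coprime_commute)
  have "B > 0"
    using assms(2) by (cases B) auto
  have "coprime B d"
  proof -
    define K where "K = B ^ d"
    have "K > 0" using \<open>B > 0\<close> by (simp add: K_def)
    have K1: "[int K = 1] (mod int q)"
      using d [of d] unfolding K_def by (metis cong_int_iff dvd_refl of_nat_1)
    have "[1 * int B ^ K * (int B - 1) = int B * (int B ^ K - 1)] (mod int q)"
      using key [OF K_def] K1 by (meson cong_scalar_right cong_sym cong_trans)
    then have "[int B ^ K = int B] (mod int q)"
      by (simp add: cong_iff_dvd_diff algebra_simps dvd_diff_commute)
    then have "[int B * int B ^ (K - 1) = int B * 1] (mod int q)"
      using \<open>K > 0\<close> by (simp flip: power_Suc)
    then have "[int (B ^ (K - 1)) = int 1] (mod int q)"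
      using cong_mult_lcancel [OF copint, of "int B ^ (K - 1)" 1] by simp
    then have "d dvd K - 1"
      using d by (simp only: cong_int_iff)
    show ?thesis
    proof (rule coprimeI)
      fix e assume "e dvd B" "e dvd d"
      then have "e dvd K" "e dvd K - 1"
        using \<open>d > 0\<close> \<open>d dvd K - 1\<close> by (auto simp: K_def dvd_power intro: dvd_trans)
      then show "is_unit e"
        using \<open>K > 0\<close> by (metis dvd_diffD1 One_nat_def Suc_leI)
    qed
  qed
  define K where "K = B ^ totient d"
  have "K > 0" using \<open>B > 0\<close> by (simp add: K_def)
  have "[K = 1] (mod d)"
    unfolding K_def using \<open>coprime B d\<close> by (rule euler_theorem)
  then have "d dvd K - 1"
    using \<open>K > 0\<close> by (metis cong_altdef_nat Suc_leI One_nat_def cong_sym cong_to_1_nat)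
  then have "[int (B ^ (K - 1)) = int 1] (mod int q)"
    using d by (simp only: cong_int_iff)
  then have "[int B * int B ^ (K - 1) = int B * 1] (mod int q)"
    by (intro cong_scalar_left) simp
  then have KB: "[int B ^ K = int B] (mod int q)"
    using \<open>K > 0\<close> by (simp flip: power_Suc)
  have "[int K * int B * (int B - 1) = int B * (int B - 1)] (mod int q)"
  proof -
    have "[int K * int B * (int B - 1) = int K * int B ^ K * (int B - 1)] (mod int q)"
      using KB by (intro cong_mult cong_refl) (rule cong_sym)
    also have "[int K * int B ^ K * (int B - 1) = int B * (int B ^ K - 1)] (mod int q)"
      by (rule key [OF K_def])
    also have "[int B * (int B ^ K - 1) = int B * (int B - 1)] (mod int q)"
      using KB by (intro cong_mult cong_diff cong_refl)
    finally show ?thesis .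
  qed
  then have "int q dvd int B * (int B - 1) * (int K - 1)"
    by (simp add: cong_iff_dvd_diff algebra_simps)
  moreover have "\<not> int q dvd int B - 1"
    using assms(3) by (metis cong_iff_dvd_diff cong_int_iff of_nat_1)
  moreover have "\<not> int q dvd int B"
    using assms(2) by simp
  moreover have "Factorial_Ring.prime (int q)"
    using assms(1) by simp
  ultimately have "int q dvd int K - 1"
    by (metis prime_dvd_mult_iff)
  then have "[K = 1] (mod q)"
    by (metis cong_iff_dvd_diff cong_int_iff of_nat_1)
  then have "d dvd totient d"
    unfolding K_def by (simp only: d)
  moreover have "totient d < d" "totient d > 0"
    using \<open>d > 0\<close> \<open>d \<noteq> 1\<close> by (simp_all add: totient_less)
  ultimately show False
    by (auto dest: dvd_imp_le)
qed


section \<open>Consequences of the relations\<close>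

text \<open>The relations avoid inverses of c, and neither generation nor finiteness is assumed, so
  that all consequences apply equally to exchanged generators, to powers of the generators, to
  images in quotients and to carriers cut down to a subgroup.\<close>

locale macdonald = group G for G (structure) +
  fixes a b c :: 'a and \<alpha> \<beta> :: int
  assumes a_closed [simp]: "a \<in> carrier G"
    and b_closed [simp]: "b \<in> carrier G"
    and c_closed [simp]: "c \<in> carrier G"
    and ab: "a \<otimes> b = b \<otimes> a \<otimes> c"
    and ac: "a \<otimes> c = c \<otimes> a [^] \<alpha>"
    and cb: "c \<otimes> b = b [^] \<beta> \<otimes> c"

context group
begin

lemma int_pow_add_left:
  "\<lbrakk>x \<in> carrier G; y \<in> carrier G\<rbrakk> \<Longrightarrow> x [^] (i::int) \<otimes> (x [^] (j::int) \<otimes> y) = x [^] (i + j) \<otimes> y"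
  by (simp add: int_pow_mult m_assoc)

lemma intertwine_int_pow:
  assumes "x \<in> carrier G" "y \<in> carrier G" "z \<in> carrier G"
    and "x \<otimes> z = z \<otimes> y"
  shows "x [^] (i::int) \<otimes> z = z \<otimes> y [^] i"
proof -
  have nat: "x [^] (k::nat) \<otimes> z = z \<otimes> y [^] k" for k
  proof (induction k)
    case (Suc k)
    have "x [^] Suc k \<otimes> z = x [^] k \<otimes> (x \<otimes> z)"
      using assms(1-3) by (simp add: m_assoc)
    also have "\<dots> = (x [^] k \<otimes> z) \<otimes> y"
      using assms by (simp add: m_assoc)
    finally show ?case
      using Suc assms(1-3) by (simp add: m_assoc)
  qed (use assms in simp)
  show ?thesis
  proof (cases i rule: int_cases2)
    case (nonneg k)
    then show ?thesis using nat by (simp add: int_pow_int)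
  next
    case (nonpos k)
    have "inv (x [^] k) \<otimes> (x [^] k \<otimes> z) \<otimes> inv (y [^] k) = inv (x [^] k) \<otimes> (z \<otimes> y [^] k) \<otimes> inv (y [^] k)"
      by (simp only: nat)
    moreover have "inv (x [^] k) \<otimes> (x [^] k \<otimes> z) = z"
      using assms(1-3) by (simp add: m_assoc [symmetric])
    moreover have "inv (x [^] k) \<otimes> (z \<otimes> y [^] k) \<otimes> inv (y [^] k) = inv (x [^] k) \<otimes> z"
      using assms(1-3) by (simp add: m_assoc)
    ultimately have "z \<otimes> inv (y [^] k) = inv (x [^] k) \<otimes> z"
      by simp
    then show ?thesis
      using nonpos assms(1-3) by (simp add: int_pow_neg_int)
  qed
qed

lemma commute_int_pow:
  assumes "x \<in> carrier G" "y \<in> carrier G" "x \<otimes> y = y \<otimes> x"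
  shows "x [^] (i::int) \<otimes> y = y \<otimes> x [^] i"
  using intertwine_int_pow [of x x y i] assms by simp

lemma commute_int_pow2:
  assumes "x \<in> carrier G" "y \<in> carrier G" "x \<otimes> y = y \<otimes> x"
  shows "x [^] (i::int) \<otimes> y [^] (j::int) = y [^] j \<otimes> x [^] i"
  using assms by (metis commute_int_pow int_pow_closed)

end

context macdonald
begin

text \<open>The exponent of c is a natural number because passing \<open>c^k\<close> multiplies
  exponents of a by \<open>\<alpha>^k\<close>; a negative k would require division by
  \<alpha>.\<close>

lemma apow_cpow: "a [^] (i::int) \<otimes> c [^] int k = c [^] int k \<otimes> a [^] (i * \<alpha> ^ k)"
proof (induction k arbitrary: i)
  case (Suc k)
  have "a [^] i \<otimes> c [^] int (Suc k) = (a [^] i \<otimes> c) \<otimes> c [^] int k"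
    using int_pow_mult [of c 1 "int k"] by (simp add: m_assoc)
  also have "a [^] i \<otimes> c = c \<otimes> a [^] (\<alpha> * i)"
    using intertwine_int_pow [OF a_closed _ c_closed ac] by (simp add: int_pow_pow)
  also have "c \<otimes> a [^] (\<alpha> * i) \<otimes> c [^] int k = c \<otimes> c [^] int k \<otimes> a [^] (\<alpha> * i * \<alpha> ^ k)"
    by (simp add: Suc.IH m_assoc)
  also have "c \<otimes> c [^] int k = c [^] int (Suc k)"
    using int_pow_mult [of c 1 "int k"] by simp
  finally show ?case
    by (simp add: mult_ac)
qed simp

lemma cpow_bpow: "c [^] int k \<otimes> b [^] (j::int) = b [^] (j * \<beta> ^ k) \<otimes> c [^] int k"
proof (induction k arbitrary: j)
  case (Suc k)
  have Suc_k: "c [^] int (Suc k) = c [^] int k \<otimes> c"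
    using int_pow_mult [of c "int k" 1] by (simp add: add.commute)
  have "c \<otimes> b [^] j = b [^] (\<beta> * j) \<otimes> c"
    using intertwine_int_pow [OF _ b_closed c_closed cb [symmetric], of j] by (simp add: int_pow_pow)
  then have "c [^] int (Suc k) \<otimes> b [^] j = c [^] int k \<otimes> b [^] (\<beta> * j) \<otimes> c"
    by (simp add: Suc_k m_assoc del: of_nat_Suc)
  also have "\<dots> = b [^] (\<beta> * j * \<beta> ^ k) \<otimes> c [^] int (Suc k)"
    by (simp add: Suc.IH m_assoc Suc_k del: of_nat_Suc)
  finally show ?case
    by (simp add: mult_ac)
qed simp

lemma apow_cpow_left:
  "x \<in> carrier G \<Longrightarrow> a [^] (i::int) \<otimes> (c [^] int k \<otimes> x) = c [^] int k \<otimes> (a [^] (i * \<alpha> ^ k) \<otimes> x)"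
  using apow_cpow [of i k] by (simp add: m_assoc [symmetric])

lemma cpow_bpow_left:
  "x \<in> carrier G \<Longrightarrow> c [^] int k \<otimes> (b [^] (j::int) \<otimes> x) = b [^] (j * \<beta> ^ k) \<otimes> (c [^] int k \<otimes> x)"
  using cpow_bpow [of k j] by (simp add: m_assoc [symmetric])

text \<open>The symmetry of the presentation: exchanging a and b inverts their commutator. Every
  result on b thereby yields one on a.\<close>

lemma swapped: "macdonald G b a (inv c) \<beta> \<alpha>"
proof
  show "b \<otimes> a = a \<otimes> b \<otimes> inv c"
    using ab by (simp add: m_assoc)
  show "b \<otimes> inv c = inv c \<otimes> b [^] \<beta>"
    using cb by (metis b_closed c_closed int_pow_closed inv_closed inv_solve_left inv_solve_right m_assoc m_closed)
  show "inv c \<otimes> a = a [^] \<alpha> \<otimes> inv c"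
    using ac by (metis a_closed c_closed int_pow_closed inv_closed inv_solve_left inv_solve_right m_assoc m_closed)
qed auto

lemma apow_b: "a [^] int i \<otimes> b = b \<otimes> c [^] int i \<otimes> a [^] geosum \<alpha> i"
proof (induction i)
  case (Suc i)
  have c_Suc: "c \<otimes> c [^] int i = c [^] int (Suc i)"
    using int_pow_mult [of c 1 "int i"] by simp
  have "a [^] int (Suc i) \<otimes> b = a \<otimes> (a [^] int i \<otimes> b)"
    using int_pow_mult [of a 1 "int i"] by (simp add: m_assoc)
  also have "\<dots> = (a \<otimes> b) \<otimes> c [^] int i \<otimes> a [^] geosum \<alpha> i"
    by (simp add: Suc.IH m_assoc)
  also have "\<dots> = b \<otimes> (a \<otimes> (c \<otimes> c [^] int i)) \<otimes> a [^] geosum \<alpha> i"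
    by (simp add: ab m_assoc)
  also have "\<dots> = b \<otimes> (a [^] (1::int) \<otimes> c [^] int (Suc i)) \<otimes> a [^] geosum \<alpha> i"
    by (simp only: c_Suc int_pow_1 a_closed)
  also have "\<dots> = b \<otimes> c [^] int (Suc i) \<otimes> (a [^] (\<alpha> ^ Suc i) \<otimes> a [^] geosum \<alpha> i)"
    by (simp only: apow_cpow) (simp add: m_assoc)
  finally show ?case
    by (simp add: int_pow_mult [symmetric] add.commute)
qed simp

lemma a_bpow: "a \<otimes> b [^] int k = b [^] int k \<otimes> a \<otimes> b [^] defect \<beta> k \<otimes> c [^] int k"
proof (induction k)
  case (Suc k)
  \<comment> \<open>g is what remains of the exponent \<open>defect \<beta> k + \<beta>^k\<close>
    after one factor b is split off to meet a. Passing the new c multiplies it by \<beta>, which is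
    the recursion \<open>defect_Suc\<close>.\<close>
  define g where "g = defect \<beta> k + \<beta> ^ k - 1"
  have b_Suc: "b [^] int k \<otimes> b = b [^] int (Suc k)"
    using int_pow_mult [of b "int k" 1] by (simp add: add.commute)
  have c_Suc: "c \<otimes> c [^] int k = c [^] int (Suc k)"
    using int_pow_mult [of c 1 "int k"] by simp
  have "a \<otimes> b [^] int (Suc k) = (a \<otimes> b [^] int k) \<otimes> b"
    by (simp add: m_assoc b_Suc [symmetric] del: of_nat_Suc)
  also have "\<dots> = b [^] int k \<otimes> a \<otimes> b [^] defect \<beta> k \<otimes> (c [^] int k \<otimes> b [^] (1::int))"
    by (simp add: Suc.IH m_assoc)
  also have "\<dots> = b [^] int k \<otimes> a \<otimes> (b [^] defect \<beta> k \<otimes> b [^] (\<beta> ^ k)) \<otimes> c [^] int k"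
    by (simp only: cpow_bpow) (simp add: m_assoc)
  also have "b [^] defect \<beta> k \<otimes> b [^] (\<beta> ^ k) = b \<otimes> b [^] g"
    using int_pow_mult [of b 1 g] int_pow_mult [of b "defect \<beta> k" "\<beta> ^ k"]
    by (simp add: g_def)
  also have "b [^] int k \<otimes> a \<otimes> (b \<otimes> b [^] g) \<otimes> c [^] int k
      = b [^] int k \<otimes> (a \<otimes> b) \<otimes> b [^] g \<otimes> c [^] int k"
    by (simp add: m_assoc)
  also have "\<dots> = (b [^] int k \<otimes> b) \<otimes> a \<otimes> (c [^] int 1 \<otimes> b [^] g) \<otimes> c [^] int k"
    by (simp add: ab m_assoc)
  also have "\<dots> = b [^] int (Suc k) \<otimes> a \<otimes> b [^] (g * \<beta>) \<otimes> (c \<otimes> c [^] int k)"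
    by (simp only: cpow_bpow b_Suc) (simp add: m_assoc)
  finally show ?case
    by (simp add: c_Suc defect_Suc g_def)
qed simp

text \<open>Compare the two ways of moving \<open>b\<close> to the left in \<open>a c\<^sup>k b\<close>.\<close>

lemma power_relation:
  assumes "\<alpha> ^ k = int L" "\<beta> ^ k = int K"
  shows "b [^] defect \<beta> K \<otimes> c [^] int (K + k) = c [^] int (k + L) \<otimes> a [^] (- defect \<alpha> L)"
proof -
  have "a \<otimes> (c [^] int k \<otimes> b) = (a [^] (1::int) \<otimes> c [^] int k) \<otimes> b"
    by (simp add: m_assoc)
  also have "\<dots> = c [^] int k \<otimes> (a [^] int L \<otimes> b)"
    by (simp only: apow_cpow assms) (simp add: m_assoc)
  also have "\<dots> = (c [^] int k \<otimes> b [^] (1::int)) \<otimes> (c [^] int L \<otimes> a [^] geosum \<alpha> L)"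
    by (simp only: apow_b) (simp add: m_assoc)
  also have "\<dots> = b [^] int K \<otimes> (c [^] int k \<otimes> (c [^] int L \<otimes> a [^] geosum \<alpha> L))"
    by (simp only: cpow_bpow assms) (simp add: m_assoc)
  also have "\<dots> = b [^] int K \<otimes> (c [^] int (k + L) \<otimes> a [^] geosum \<alpha> L)"
    by (simp add: int_pow_add_left)
  finally have 1: "a \<otimes> (c [^] int k \<otimes> b) = b [^] int K \<otimes> (c [^] int (k + L) \<otimes> a [^] geosum \<alpha> L)" .
  have "a \<otimes> (c [^] int k \<otimes> b) = a \<otimes> (c [^] int k \<otimes> b [^] (1::int))"
    by simp
  also have "\<dots> = (a \<otimes> b [^] int K) \<otimes> c [^] int k"
    by (simp only: cpow_bpow assms) (simp add: m_assoc)
  also have "\<dots> = b [^] int K \<otimes> (a \<otimes> (b [^] defect \<beta> K \<otimes> c [^] int (K + k)))"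
    by (simp only: a_bpow) (simp add: m_assoc int_pow_mult [symmetric])
  finally have "a \<otimes> (b [^] defect \<beta> K \<otimes> c [^] int (K + k)) = c [^] int (k + L) \<otimes> a [^] geosum \<alpha> L"
    using 1 by simp
  then have "b [^] defect \<beta> K \<otimes> c [^] int (K + k) = inv a \<otimes> (c [^] int (k + L) \<otimes> a [^] geosum \<alpha> L)"
    by (metis a_closed b_closed c_closed int_pow_closed inv_solve_left m_closed)
  also have "\<dots> = a [^] (- 1 :: int) \<otimes> (c [^] int (k + L) \<otimes> a [^] geosum \<alpha> L)"
    by (simp add: int_pow_neg)
  also have "\<dots> = c [^] int (k + L) \<otimes> (a [^] (- 1 * \<alpha> ^ (k + L)) \<otimes> a [^] geosum \<alpha> L)"
    by (rule apow_cpow_left) simp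
  \<comment> \<open>Since \<open>\<alpha>^k = L\<close>, the power \<open>\<alpha>^(k + L)\<close>
    is \<open>L * \<alpha>^L\<close>, so the two exponents add up to minus the defect.\<close>
  also have "a [^] (- 1 * \<alpha> ^ (k + L)) \<otimes> a [^] geosum \<alpha> L = a [^] (- defect \<alpha> L)"
    using assms(1) by (simp add: int_pow_mult [symmetric] defect_def power_add)
  finally show ?thesis .
qed

text \<open>Multiplying the relation by c on the left multiplies the exponent of b by \<beta>;
  multiplying it by c on the right multiplies that of a by \<alpha>. Comparing the two leaves a
  power of b and a power of a intertwined by \<open>c^T\<close>, which is removed by raising to the
  power \<open>\<beta>^T\<close> and moving b through \<open>c^T\<close>.\<close>

lemma bpow_eq_apow:
  assumes "\<alpha> ^ k = int L" "\<beta> ^ k = int K"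
  shows "b [^] (defect \<beta> K * (\<beta> - 1)) = a [^] (defect \<alpha> L * (\<alpha> - 1) * \<beta> ^ (k + L + 1))"
proof -
  define T where "T = k + L + 1"
  define y where "y = defect \<beta> K"
  define d where "d = - defect \<alpha> L"
  have rel: "b [^] y \<otimes> c [^] int (K + k) = c [^] int (k + L) \<otimes> a [^] d"
    unfolding y_def d_def by (rule power_relation [OF assms])
  have T: "c \<otimes> c [^] int (k + L) = c [^] int T" "c [^] int (k + L) \<otimes> c = c [^] int T"
    and U: "c \<otimes> c [^] int (K + k) = c [^] int (K + k + 1)" "c [^] int (K + k) \<otimes> c = c [^] int (K + k + 1)"
    using int_pow_mult [of c 1 "int (k + L)"] int_pow_mult [of c "int (k + L)" 1]
      int_pow_mult [of c 1 "int (K + k)"] int_pow_mult [of c "int (K + k)" 1]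
    by (simp_all add: T_def add_ac)
  have "c [^] int 1 \<otimes> (b [^] y \<otimes> c [^] int (K + k)) = c [^] int T \<otimes> a [^] d"
    unfolding rel using T by (simp add: m_assoc [symmetric])
  then have 1: "b [^] (y * \<beta>) \<otimes> c [^] int (K + k + 1) = c [^] int T \<otimes> a [^] d"
    using cpow_bpow_left [of "c [^] int (K + k)" 1 y] U by simp
  have "b [^] y \<otimes> c [^] int (K + k) \<otimes> c = c [^] int (k + L) \<otimes> (a [^] d \<otimes> c [^] int 1)"
    unfolding rel by (simp add: m_assoc)
  then have 2: "b [^] y \<otimes> c [^] int (K + k + 1) = c [^] int T \<otimes> a [^] (d * \<alpha>)"
    using T U by (simp add: apow_cpow) (simp add: m_assoc apow_cpow [of _ 1, simplified] m_assoc [symmetric])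
  have "b [^] (y * (\<beta> - 1)) \<otimes> (b [^] y \<otimes> c [^] int (K + k + 1)) = b [^] (y * \<beta>) \<otimes> c [^] int (K + k + 1)"
    by (simp add: int_pow_add_left algebra_simps)
  then have "b [^] (y * (\<beta> - 1)) \<otimes> c [^] int T \<otimes> a [^] (d * \<alpha>) = c [^] int T \<otimes> a [^] d"
    unfolding 1 2 by (simp add: m_assoc)
  then have "b [^] (y * (\<beta> - 1)) \<otimes> c [^] int T = c [^] int T \<otimes> a [^] d \<otimes> inv (a [^] (d * \<alpha>))"
    by (simp add: inv_solve_right)
  also have "\<dots> = c [^] int T \<otimes> a [^] (d * (1 - \<alpha>))"
    by (simp add: m_assoc int_pow_diff [symmetric] algebra_simps)
  finally have 3: "b [^] (y * (\<beta> - 1)) \<otimes> c [^] int T = c [^] int T \<otimes> a [^] (d * (1 - \<alpha>))" .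
  have "(b [^] (y * (\<beta> - 1))) [^] (\<beta> ^ T) \<otimes> c [^] int T = c [^] int T \<otimes> (a [^] (d * (1 - \<alpha>))) [^] (\<beta> ^ T)"
    by (rule intertwine_int_pow [OF _ _ _ 3]) simp_all
  then have "b [^] (y * (\<beta> - 1) * \<beta> ^ T) \<otimes> c [^] int T = c [^] int T \<otimes> a [^] (d * (1 - \<alpha>) * \<beta> ^ T)"
    by (simp add: int_pow_pow)
  then have "c [^] int T \<otimes> b [^] (y * (\<beta> - 1)) = c [^] int T \<otimes> a [^] (d * (1 - \<alpha>) * \<beta> ^ T)"
    by (simp only: cpow_bpow)
  then have "b [^] (y * (\<beta> - 1)) = a [^] (d * (1 - \<alpha>) * \<beta> ^ T)"
    by simp
  moreover have "d * (1 - \<alpha>) = defect \<alpha> L * (\<alpha> - 1)"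
    by (simp add: d_def algebra_simps)
  ultimately show ?thesis
    by (simp add: y_def T_def)
qed

section \<open>Central powers of \<open>b\<close> and finiteness of its order\<close>

lemma commutes_c:
  assumes z: "z \<in> carrier G" "z \<otimes> a = a \<otimes> z" "z \<otimes> b = b \<otimes> z"
  shows "z \<otimes> c = c \<otimes> z"
proof -
  have "b \<otimes> a \<otimes> (z \<otimes> c) = z \<otimes> (b \<otimes> a \<otimes> c)"
    using z by (metis a_closed b_closed c_closed m_assoc m_closed)
  also have "\<dots> = a \<otimes> b \<otimes> z"
    using z by (metis a_closed ab b_closed m_assoc)
  also have "\<dots> = b \<otimes> a \<otimes> (c \<otimes> z)"
    using z by (simp add: ab m_assoc)
  finally show ?thesis
    using z by (simp add: m_assoc)
qed

lemma bpow_central_pow: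
  assumes "b [^] (y::int) \<otimes> c = c \<otimes> b [^] y"
  shows "b [^] (y * (\<beta> - 1)) = \<one>"
proof -
  have "b [^] (y * \<beta>) \<otimes> c = c [^] int 1 \<otimes> b [^] y"
    using cpow_bpow [of 1 y] by simp
  then have "b [^] (y * \<beta>) \<otimes> c = b [^] y \<otimes> c"
    using assms by simp
  then have "b [^] (y * \<beta>) = b [^] y"
    by simp
  moreover have "b [^] (y * \<beta> - y) = b [^] (y * \<beta>) \<otimes> inv (b [^] y)"
    by (simp add: int_pow_diff)
  ultimately show ?thesis
    by (simp add: algebra_simps)
qed

lemma bpow_eq_apow_commutes:
  assumes "b [^] (y::int) = a [^] (x::int)"
  shows "b [^] y \<otimes> a = a \<otimes> b [^] y" "b [^] y \<otimes> b = b \<otimes> b [^] y" "b [^] y \<otimes> c = c \<otimes> b [^] y"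
proof -
  show "b [^] y \<otimes> a = a \<otimes> b [^] y"
    unfolding assms by (rule commute_int_pow) simp_all
  moreover show "b [^] y \<otimes> b = b \<otimes> b [^] y"
    by (rule commute_int_pow) simp_all
  ultimately show "b [^] y \<otimes> c = c \<otimes> b [^] y"
    by (intro commutes_c) simp_all
qed

lemma bpow_trivial:
  assumes "\<alpha> ^ k = int L" "\<beta> ^ k = int K"
  shows "b [^] (defect \<beta> K * (\<beta> - 1) * (\<beta> - 1)) = \<one>"
  using bpow_eq_apow_commutes(3) [OF bpow_eq_apow [OF assms]] by (rule bpow_central_pow)

lemma bpow_trivial_generic:
  assumes "\<beta> \<noteq> 1" "\<beta> \<noteq> - 1"
  shows "\<exists>j::int. j \<noteq> 0 \<and> b [^] j = \<one>"
proof (cases "\<beta> = 0")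
  case True
  then have "b [^] (1::int) = \<one>"
    using cb by simp
  then show ?thesis
    by (intro exI [of _ 1]) simp
next
  case False
  \<comment> \<open>The even exponent k = 2 makes \<open>\<alpha>^k\<close> and
    \<open>\<beta>^k\<close> natural numbers whatever the signs, and \<open>\<beta>^2\<close> is
    large enough for \<open>defect_nonzero\<close>.\<close>
  with assms have "\<bar>\<beta>\<bar> \<ge> 2" by linarith
  then have "\<beta>\<^sup>2 \<ge> 2\<^sup>2"
    using abs_le_square_iff [of 2 \<beta>] by simp
  then have "defect \<beta> (nat (\<beta>\<^sup>2)) \<noteq> 0"
    using \<open>\<bar>\<beta>\<bar> \<ge> 2\<close> by (intro defect_nonzero) auto
  moreover have "b [^] (defect \<beta> (nat (\<beta>\<^sup>2)) * (\<beta> - 1) * (\<beta> - 1)) = \<one>"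
    by (rule bpow_trivial [of 2 "nat (\<alpha>\<^sup>2)"]) simp_all
  ultimately show ?thesis
    using assms(1) by (intro exI [of _ "defect \<beta> (nat (\<beta>\<^sup>2)) * (\<beta> - 1) * (\<beta> - 1)"]) auto
qed

lemma cpow_trivial:
  assumes "N > 0" "a [^] int N = \<one>"
  shows "c [^] (int N * int N) = \<one>"
proof -
  have "b \<otimes> (c [^] int N \<otimes> a [^] geosum \<alpha> N) = b \<otimes> \<one>"
    using apow_b [of N] assms by (simp add: m_assoc)
  then have "c [^] int N \<otimes> a [^] geosum \<alpha> N = \<one>"
    by simp
  then have "c [^] int N = inv (a [^] geosum \<alpha> N)"
    by (intro inv_equality [symmetric]) simp_all
  then have "c [^] (int N * int N) = (a [^] (- geosum \<alpha> N)) [^] int N"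
    by (simp add: int_pow_pow [symmetric] int_pow_neg)
  also have "\<dots> = (a [^] int N) [^] (- geosum \<alpha> N)"
    by (simp add: int_pow_pow mult.commute)
  finally show ?thesis
    using assms by simp
qed

text \<open>For \<beta> = -1 the defect argument gives nothing. In that case a conjugates
  \<open>b^2\<close> to \<open>c^(-2)\<close>, so it suffices that c has finite order, which follows
  from the finite order of a if \<alpha> is not -1. If \<alpha> = -1 as well, then
  \<open>a^2 = c^2\<close> is both inverted and centralised by c, so the fourth powers of a and c
  are trivial.\<close>

lemma b_finite_order:
  assumes "\<alpha> \<noteq> 1" "\<beta> \<noteq> 1"
  shows "\<exists>j::int. j \<noteq> 0 \<and> b [^] j = \<one>"
proof (cases "\<beta> = - 1")
  case False
  then show ?thesis
    using assms bpow_trivial_generic by blast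
next
  case beta: True
  interpret sw: macdonald G b a "inv c" \<beta> \<alpha>
    by (rule swapped)
  have b2: "b [^] (2::int) \<otimes> a = a \<otimes> inv c [^] (2::int)"
    using sw.apow_b [of 2] by (simp add: beta numeral_2_eq_2 geosum_def)
  show ?thesis
  proof (cases "\<alpha> = - 1")
    case False
    then obtain j :: int where j: "j \<noteq> 0" "a [^] j = \<one>"
      using sw.bpow_trivial_generic assms by blast
    define N where "N = nat \<bar>j\<bar>"
    have N: "N > 0" "a [^] int N = \<one>"
      using j by (auto simp: N_def abs_if int_pow_neg)
    have "(b [^] (2::int)) [^] (int N * int N) \<otimes> a = a \<otimes> (inv c [^] (2::int)) [^] (int N * int N)"
      by (rule intertwine_int_pow [OF _ _ _ b2]) simp_all
    also have "(inv c [^] (2::int)) [^] (int N * int N) = inv (c [^] (int N * int N)) [^] (2::int)"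
      by (simp add: int_pow_pow int_pow_inv mult.commute)
    also have "\<dots> = \<one>"
      using cpow_trivial [OF N] by simp
    finally have "b [^] (2 * (int N * int N)) \<otimes> a = a"
      by (simp add: int_pow_pow)
    then have "b [^] (2 * (int N * int N)) = \<one>"
      by simp
    then show ?thesis
      using N(1) by (intro exI [of _ "2 * (int N * int N)"]) simp
  next
    case alpha: True
    have "a [^] (2::int) \<otimes> b = b \<otimes> c [^] (2::int)"
      using apow_b [of 2] by (simp add: alpha numeral_2_eq_2 geosum_def)
    also have "\<dots> = c [^] (2::int) \<otimes> b"
      using cpow_bpow [of 2 1] by (simp add: beta)
    finally have a2: "a [^] (2::int) = c [^] (2::int)"
      by simp
    have "a [^] (2::int) \<otimes> c = c \<otimes> a [^] (- 2 :: int)"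
      using apow_cpow [of 2 1] by (simp add: alpha)
    moreover have "a [^] (2::int) \<otimes> c = c \<otimes> a [^] (2::int)"
      unfolding a2 by (rule commute_int_pow) simp_all
    ultimately have "a [^] (2::int) = a [^] (- 2 :: int)"
      by simp
    then have a4: "a [^] (4::int) = \<one>"
      using int_pow_diff [of a 2 "- 2"] by simp
    have c4: "c [^] (4::int) = \<one>"
      using int_pow_pow [of c 2 2] int_pow_pow [of a 2 2] a4 a2 by simp
    have "(b [^] (2::int)) [^] (2::int) \<otimes> a = a \<otimes> (inv c [^] (2::int)) [^] (2::int)"
      by (rule intertwine_int_pow [OF _ _ _ b2]) simp_all
    then have "b [^] (4::int) \<otimes> a = a"
      using c4 by (simp add: int_pow_pow int_pow_inv)
    then have "b [^] (4::int) = \<one>"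
      by simp
    then show ?thesis
      by (intro exI [of _ 4]) simp
  qed
qed

text \<open>Only the residues of the parameters modulo the orders of a and b matter. This allows
  them to be replaced by natural numbers, as \<open>power_relation\<close> demands of their
  powers.\<close>

lemma change_parameters:
  assumes "int (ord a) dvd \<alpha>' - \<alpha>" "int (ord b) dvd \<beta>' - \<beta>"
  shows "macdonald G a b c \<alpha>' \<beta>'"
proof
  show "a \<otimes> c = c \<otimes> a [^] \<alpha>'"
    using ac assms(1) int_pow_eq [of a \<alpha> \<alpha>'] by simp
  show "c \<otimes> b = b [^] \<beta>' \<otimes> c"
    using cb assms(2) int_pow_eq [of b \<beta> \<beta>'] by simp
qed (simp_all add: ab)

section \<open>The order of \<open>b\<close> and its prime divisors\<close>

lemma ord_b_pos:
  assumes "\<alpha> \<noteq> 1" "\<beta> \<noteq> 1"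
  shows "ord b > 0"
proof -
  obtain j :: int where "j \<noteq> 0" "b [^] j = \<one>"
    using b_finite_order assms by blast
  then have "int (ord b) dvd j"
    by (simp add: int_pow_eq_id)
  with \<open>j \<noteq> 0\<close> show ?thesis
    by (cases "ord b = 0") auto
qed

text \<open>Conjugation by c is injective and takes \<open>b^j\<close> to
  \<open>b^(j * \<beta>)\<close>, so multiplication by \<beta> must be injective on exponents modulo
  the order.\<close>

lemma coprime_ord_b:
  assumes "ord b > 0"
  shows "coprime \<beta> (int (ord b))"
proof (rule ccontr)
  assume "\<not> coprime \<beta> (int (ord b))"
  then obtain e where e: "e dvd \<beta>" "e dvd int (ord b)" "\<not> is_unit e"
    by (rule not_coprimeE)
  then obtain j where j: "int (ord b) = e * j"
    by blast
  have "int (ord b) dvd j * \<beta>"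
    using e(1) j by auto
  then have "b [^] (j * \<beta>) = \<one>"
    by (simp add: int_pow_eq_id)
  then have "c \<otimes> b [^] j = c \<otimes> \<one>"
    using cpow_bpow [of 1 j] by simp
  then have "b [^] j = \<one>"
    by simp
  then have "e * j dvd j"
    by (simp add: int_pow_eq_id flip: j)
  moreover have "j \<noteq> 0"
    using j assms by auto
  ultimately show False
    using e(3) by auto
qed

text \<open>After passing to natural parameters A and B, the order of b divides
  \<open>defect B (B^k) * (B - 1)^2\<close> for every k. A prime divisor q of the order that does
  not divide B - 1 would divide all these defects, which \<open>prime_not_dvd_defect\<close>
  excludes.\<close>

lemma prime_dvd_ord_b:
  assumes "\<alpha> \<noteq> 1" "\<beta> \<noteq> 1" and q: "Factorial_Ring.prime q" "q dvd ord b"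
  shows "int q dvd \<beta> - 1"
proof (rule ccontr)
  assume nd: "\<not> int q dvd \<beta> - 1"
  interpret sw: macdonald G b a "inv c" \<beta> \<alpha>
    by (rule swapped)
  have pos: "ord a > 0" "ord b > 0"
    using ord_b_pos sw.ord_b_pos assms by blast+
  define A where "A = nat (\<alpha> mod int (ord a))"
  define B where "B = nat (\<beta> mod int (ord b))"
  have A: "int (ord a) dvd int A - \<alpha>" and B: "int (ord b) dvd int B - \<beta>"
    using pos by (simp_all add: A_def B_def mod_eq_dvd_iff [symmetric])
  interpret M: macdonald G a b c "int A" "int B"
    by (rule change_parameters [OF A B])
  have "\<not> q dvd B"
  proof
    assume "q dvd B"
    then have "int q dvd int B" "int q dvd int (ord b)"
      using q(2) by simp_all
    then have "is_unit (int q)"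
      using M.coprime_ord_b [OF pos(2)] coprime_common_divisor by blast
    then show False
      using q(1) by simp
  qed
  moreover have nd': "\<not> int q dvd int B - 1"
  proof
    assume "int q dvd int B - 1"
    moreover have "int q dvd int B - \<beta>"
      using B q(2) by (meson dvd_trans int_dvd_int_iff)
    ultimately have "int q dvd (int B - 1) - (int B - \<beta>)"
      by (rule dvd_diff)
    then show False
      using nd by simp
  qed
  moreover from nd' have "\<not> [B = 1] (mod q)"
    using cong_int_iff [of B 1 q] by (simp add: cong_iff_dvd_diff)
  ultimately obtain k where k: "\<not> int q dvd defect (int B) (B ^ k)"
    using prime_not_dvd_defect [OF q(1), of B] by blast
  have pq: "Factorial_Ring.prime (int q)"
    using q(1) by simp
  have "b [^] (defect (int B) (B ^ k) * (int B - 1) * (int B - 1)) = \<one>"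
    by (rule M.bpow_trivial [of k "A ^ k"]) simp_all
  then have "int (ord b) dvd defect (int B) (B ^ k) * (int B - 1) * (int B - 1)"
    by (simp only: int_pow_eq_id b_closed)
  moreover have "int q dvd int (ord b)"
    using q(2) by simp
  ultimately have "int q dvd defect (int B) (B ^ k) * (int B - 1) * (int B - 1)"
    by (rule dvd_trans [rotated])
  then show False
    using k nd' pq by (meson prime_dvd_multD)
qed

end

section \<open>Upper bounds in the p-part\<close>

context group
begin

lemma commute_mult:
  assumes "x \<in> carrier G" "y \<in> carrier G" "z \<in> carrier G"
    and "x \<otimes> z = z \<otimes> x" "y \<otimes> z = z \<otimes> y"
  shows "(x \<otimes> y) \<otimes> z = z \<otimes> (x \<otimes> y)"
proof -
  have "(x \<otimes> y) \<otimes> z = x \<otimes> (z \<otimes> y)"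
    using assms by (simp add: m_assoc)
  also have "\<dots> = (z \<otimes> x) \<otimes> y"
    using assms by (simp add: m_assoc [symmetric])
  finally show ?thesis
    using assms by (simp add: m_assoc)
qed

lemma commute_inv:
  assumes "x \<in> carrier G" "z \<in> carrier G" "x \<otimes> z = z \<otimes> x"
  shows "x \<otimes> inv z = inv z \<otimes> x"
  using commute_int_pow [of z x "- 1"] assms by (simp add: int_pow_neg)

lemma int_pow_eq_one_of_dvd:
  assumes "x \<in> carrier G" "x [^] (i::int) = \<one>" "i dvd j"
  shows "x [^] j = \<one>"
proof -
  obtain t where "j = i * t"
    using assms(3) by blast
  then have "x [^] j = (x [^] i) [^] t"
    using assms(1) by (simp add: int_pow_pow)
  then show ?thesis
    using assms(2) by simp
qed

text \<open>For an element of p-power order, exponents prime to p can be inverted, with a t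
  independent of i. This is how the cofactors prime to p in all valuations are discarded.\<close>

lemma unit_multiple_invertible:
  assumes "x \<in> carrier G" "x [^] (int p ^ S) = \<one>" "Factorial_Ring.prime p" "\<not> int p dvd w"
  shows "\<exists>t. \<forall>i. x [^] (i * w * t) = x [^] (i::int)"
proof -
  have "coprime w (int p)"
    using prime_imp_coprime [of "int p" w] assms(3,4) by (simp add: coprime_commute)
  then have "coprime w (int p ^ S)"
    by simp
  then obtain t where t: "[w * t = 1] (mod int p ^ S)"
    using cong_solve_coprime_int by blast
  have "x [^] (i * w * t) = x [^] i" for i
  proof -
    have "int p ^ S dvd i * (w * t - 1)"
      using t by (intro dvd_mult) (simp add: cong_iff_dvd_diff)
    then have "int p ^ S dvd i * w * t - i"
      by (simp add: algebra_simps)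
    then have "x [^] (i * w * t - i) = \<one>"
      by (rule int_pow_eq_one_of_dvd [OF assms(1,2)])
    moreover have "x [^] (i * w * t) = x [^] (i * w * t - i) \<otimes> x [^] i"
      using assms(1) by (simp add: int_pow_mult [symmetric])
    ultimately show ?thesis
      using assms(1) by simp
  qed
  then show ?thesis
    by blast
qed

lemma int_pow_eq_one_of_unit_multiple:
  assumes "x \<in> carrier G" "x [^] (int p ^ S) = \<one>" "Factorial_Ring.prime p" "\<not> int p dvd w"
    and "x [^] (i * w) = \<one>"
  shows "x [^] (i::int) = \<one>"
proof -
  obtain t where "\<forall>i. x [^] (i * w * t) = x [^] i"
    using unit_multiple_invertible [OF assms(1-4)] by blast
  moreover have "x [^] (i * w * t) = \<one>"
    using assms(1,5) by (simp add: int_pow_pow [symmetric])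
  ultimately show ?thesis
    by metis
qed

end

context macdonald
begin

text \<open>With natural parameters the relation for k = 1 is available. Changing exponents by
  multiples of \<open>p^S\<close> is free for a, b and c, and n < S ensures that it leaves a
  valuation equal to n intact.\<close>

lemma p_part_bounds_nat:
  fixes p A B :: nat
  assumes AB: "\<alpha> = int A" "\<beta> = int B"
    and p: "Factorial_Ring.prime p" "p > 3 \<or> p = 3 \<and> int B mod 9 \<noteq> 7"
    and v: "int A - 1 = int p ^ m * t\<^sub>1" "\<not> int p dvd t\<^sub>1"
      "int B - 1 = int p ^ n * t\<^sub>2" "\<not> int p dvd t\<^sub>2"
      "int A - int B = int p ^ n * t\<^sub>3" "\<not> int p dvd t\<^sub>3"
      "n \<le> m" "0 < n" "n < S"
    and orders: "a [^] (int p ^ S) = \<one>" "b [^] (int p ^ S) = \<one>" "c [^] (int p ^ S) = \<one>"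
  shows "a [^] (int p ^ (m + n)) = \<one>" "b [^] (int p ^ (2 * n)) = \<one>" "c [^] (int p ^ n) = \<one>"
proof -
  interpret sw: macdonald G b a "inv c" \<beta> \<alpha>
    by (rule swapped)
  have p2: "p > 2" and p0: "p > 0" and m: "m > 0"
    using p v by auto
  have prime: "Factorial_Ring.prime (int p)"
    using p by simp
  note unit_a = int_pow_eq_one_of_unit_multiple [OF a_closed orders(1) p(1)]
  note unit_b = int_pow_eq_one_of_unit_multiple [OF b_closed orders(2) p(1)]
  note unit_c = int_pow_eq_one_of_unit_multiple [OF c_closed orders(3) p(1)]
  have "B \<noteq> 1"
    using v(3,4) p0 by auto
  have "B \<noteq> 0"
  proof
    assume "B = 0"
    moreover have "int p dvd int B - 1"
      unfolding v(3) using v(8) by simp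
    ultimately have "int p dvd 1"
      by simp
    then show False
      using prime not_prime_unit by blast
  qed
  with \<open>B \<noteq> 1\<close> have B2: "B \<ge> 2" by simp
  define Y where "Y = nat (defect (int B) B)"
  have Y: "int Y = defect (int B) B"
    using defect_pos [of "int B" B] B2 by (simp add: Y_def)
  obtain w where w: "int Y = int p ^ (2 * n) * w" "\<not> int p dvd w"
    unfolding Y using defect_self_valuation [OF p v(8,3,4)] by blast
  define D where "D = defect (int A) A"
  have D: "int p ^ (2 * m) dvd D"
    unfolding D_def using prime_power_dvd_defect_self [OF p(1) p2 m, of A] v(1) by simp
  \<comment> \<open>\<tau> is a natural representative of -(B + 1) modulo \<open>p^S\<close>.
    Multiplying by \<open>c^\<tau>\<close> removes c from the side of b and leaves
    \<open>c^\<delta>\<close> on the other side, with \<delta> congruent to A - B.\<close>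
  define \<tau> where "\<tau> = (p ^ S - 1) * (B + 1)"
  define \<delta> where "\<delta> = 1 + A + \<tau>"
  have "int (p ^ S - 1) = int p ^ S - 1"
    using p0 by (simp add: of_nat_diff)
  then have "int \<tau> = (int p ^ S - 1) * int (B + 1)"
    by (simp only: \<tau>_def of_nat_mult)
  then have \<tau>: "int (B + 1) + int \<tau> = int p ^ S * int (B + 1)"
    by (simp add: algebra_simps)
  have "int \<delta> = int p ^ n * (t\<^sub>3 + int p ^ (S - n) * int (B + 1))"
  proof -
    have "int \<delta> = (int A - int B) + int p ^ S * int (B + 1)"
      using \<tau> by (simp add: \<delta>_def)
    also have "int p ^ S = int p ^ n * int p ^ (S - n)"
      using v(9) by (simp add: power_add [symmetric])
    finally show ?thesis
      by (simp add: v(5) algebra_simps)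
  qed
  moreover have "\<not> int p dvd t\<^sub>3 + int p ^ (S - n) * int (B + 1)"
    using v(6,9) by (simp add: dvd_add_left_iff)
  ultimately obtain d where d: "int \<delta> = int p ^ n * d" "\<not> int p dvd d"
    by blast
  obtain d' where d': "\<delta> = p ^ n * d'" "\<not> p dvd d'"
  proof -
    have "int p ^ n dvd int \<delta>" using d by simp
    then have "p ^ n dvd \<delta>"
      using int_dvd_int_iff [of "p ^ n" \<delta>] by simp
    then obtain d' where "\<delta> = p ^ n * d'" by blast
    then have "int p ^ n * d = int p ^ n * int d'"
      using d(1) by (simp only: of_nat_mult of_nat_power)
    then have "d = int d'"
      using p0 by auto
    then show ?thesis
      using that [of d'] \<open>\<delta> = p ^ n * d'\<close> d(2) by simp
  qed
  obtain w\<^sub>a where wa: "int A ^ \<delta> - 1 = int p ^ (m + n) * w\<^sub>a" "\<not> int p dvd w\<^sub>a"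
    using lifting_the_exponent [OF p(1) p2 m v(1,2) d'] by blast
  obtain w\<^sub>b where wb: "int B ^ \<delta> - 1 = int p ^ (n + n) * w\<^sub>b" "\<not> int p dvd w\<^sub>b"
    using lifting_the_exponent [OF p(1) p2 v(8,3,4) d'] by blast

  \<comment> \<open>Passing \<open>c^\<tau>\<close> multiplies the exponent -D by
    \<open>A^\<tau>\<close>, which keeps the divisibility by \<open>p^(2m)\<close>.\<close>
  define x where "x = - D * int A ^ \<tau>"
  have x: "int p ^ (2 * m) dvd x"
    unfolding x_def using D by simp
  have rel: "b [^] int Y = c [^] int \<delta> \<otimes> a [^] x"
  proof -
    have c1: "c [^] (int (B + 1) + int \<tau>) = \<one>"
      unfolding \<tau> by (rule int_pow_eq_one_of_dvd [OF c_closed orders(3)]) simp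
    have "b [^] int Y = b [^] int Y \<otimes> c [^] (int (B + 1) + int \<tau>)"
      unfolding c1 by simp
    also have "\<dots> = (b [^] int Y \<otimes> c [^] int (B + 1)) \<otimes> c [^] int \<tau>"
      by (simp only: int_pow_mult c_closed) (simp add: m_assoc)
    also have "\<dots> = (c [^] int (1 + A) \<otimes> a [^] (- D)) \<otimes> c [^] int \<tau>"
      using power_relation [of 1 A B] by (simp only: AB power_one_right Y D_def)
    also have "\<dots> = c [^] int (1 + A) \<otimes> (a [^] (- D) \<otimes> c [^] int \<tau>)"
      by (simp add: m_assoc)
    also have "\<dots> = (c [^] int (1 + A) \<otimes> c [^] int \<tau>) \<otimes> a [^] x"
      by (simp only: apow_cpow AB x_def) (simp add: m_assoc)
    also have "c [^] int (1 + A) \<otimes> c [^] int \<tau> = c [^] int \<delta>"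
      by (simp add: int_pow_mult [symmetric] \<delta>_def add.assoc)
    finally show ?thesis .
  qed

  \<comment> \<open>This is \<open>bpow_eq_apow\<close> with the unit factor of the exponent of b
    inverted: \<open>Y * (B - 1)\<close> has valuation 2n + n, and the exponent of a is divisible by
    \<open>p^(2m + m)\<close>.\<close>
  obtain x\<^sub>1 where x1: "b [^] (int p ^ (3 * n)) = a [^] (int p ^ (3 * m) * x\<^sub>1)"
  proof -
    have "int Y * (int B - 1) = int p ^ (3 * n) * (w * t\<^sub>2)"
      by (simp add: w v(3) power_add [symmetric])
    moreover have "\<not> int p dvd w * t\<^sub>2"
      using w(2) v(4) prime prime_dvd_multD by blast
    ultimately obtain t where t: "\<forall>i. b [^] (i * (w * t\<^sub>2) * t) = b [^] i"
      using unit_multiple_invertible [OF b_closed orders(2) p(1)] by blast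
    have "b [^] (int p ^ (3 * n)) = (b [^] (int Y * (int B - 1))) [^] t"
      using t by (simp add: int_pow_pow \<open>int Y * (int B - 1) = int p ^ (3 * n) * (w * t\<^sub>2)\<close>)
    also have "b [^] (int Y * (int B - 1)) = a [^] (D * (int A - 1) * int B ^ (1 + A + 1))"
      using bpow_eq_apow [of 1 A B] by (simp only: AB power_one_right Y D_def)
    also have "(a [^] (D * (int A - 1) * int B ^ (1 + A + 1))) [^] t = a [^] (D * (int A - 1) * int B ^ (1 + A + 1) * t)"
      by (simp add: int_pow_pow)
    finally have "b [^] (int p ^ (3 * n)) = a [^] (D * (int A - 1) * int B ^ (1 + A + 1) * t)" .
    moreover have "int p ^ (3 * m) dvd D * (int A - 1) * int B ^ (1 + A + 1) * t"
    proof -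
      have "int p ^ (2 * m) * int p ^ m dvd D * (int A - 1)"
        using D v(1) by (intro mult_dvd_mono) simp_all
      then show ?thesis
        by (simp add: power_add [symmetric] dvd_mult2)
    qed
    ultimately show ?thesis
      using that by (auto elim!: dvdE)
  qed

  have b3n_commutes_c: "b [^] (int p ^ (3 * n) * j) \<otimes> c = c \<otimes> b [^] (int p ^ (3 * n) * j)" for j
  proof -
    have "b [^] (int p ^ (3 * n) * j) = a [^] (int p ^ (3 * m) * x\<^sub>1 * j)"
      using x1 by (simp only: int_pow_pow [symmetric] a_closed b_closed)
    then show ?thesis
      by (rule bpow_eq_apow_commutes)
  qed

  text \<open>Conjugate the relation \<open>rel\<close> by \<open>a\<close>.\<close>
  have conj_a: "b [^] (- defect (int B) Y) = c [^] int Y \<otimes> a [^] (1 - int A ^ \<delta>)"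
  proof -
    have "a \<otimes> (inv c [^] int Y \<otimes> b [^] geosum (int B) Y) = b [^] int Y \<otimes> a"
      using sw.apow_b [of Y] by (simp add: AB m_assoc)
    also have "\<dots> = c [^] int \<delta> \<otimes> (a [^] x \<otimes> a [^] (1::int))"
      by (simp add: rel m_assoc)
    also have "\<dots> = c [^] int \<delta> \<otimes> (a [^] (1 * int A ^ \<delta>) \<otimes> a [^] (x + (1 - int A ^ \<delta>)))"
      by (simp only: int_pow_mult [symmetric] a_closed) simp
    also have "\<dots> = a [^] (1::int) \<otimes> (c [^] int \<delta> \<otimes> a [^] (x + (1 - int A ^ \<delta>)))"
      using apow_cpow_left [of "a [^] (x + (1 - int A ^ \<delta>))" 1 \<delta>] by (simp add: AB)
    also have "\<dots> = a \<otimes> (b [^] int Y \<otimes> a [^] (1 - int A ^ \<delta>))"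
      by (simp add: rel int_pow_mult m_assoc)
    finally have "inv c [^] int Y \<otimes> b [^] geosum (int B) Y = b [^] int Y \<otimes> a [^] (1 - int A ^ \<delta>)"
      by simp
    then have "c [^] int Y \<otimes> (inv c [^] int Y \<otimes> b [^] geosum (int B) Y)
        = c [^] int Y \<otimes> (b [^] int Y \<otimes> a [^] (1 - int A ^ \<delta>))"
      by simp
    moreover have "c [^] int Y \<otimes> (inv c [^] int Y \<otimes> b [^] geosum (int B) Y) = b [^] geosum (int B) Y"
      by (simp add: int_pow_inv m_assoc [symmetric])
    ultimately have "b [^] geosum (int B) Y = b [^] (int Y * int B ^ Y) \<otimes> (c [^] int Y \<otimes> a [^] (1 - int A ^ \<delta>))"
      by (simp add: cpow_bpow_left AB)
    moreover have "b [^] geosum (int B) Y = b [^] (int Y * int B ^ Y) \<otimes> b [^] (- defect (int B) Y)"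
      by (simp add: int_pow_mult [symmetric] defect_def)
    ultimately show ?thesis
      by simp
  qed
  have pY: "p ^ (2 * n) dvd Y"
    using w(1) int_dvd_int_iff [of "p ^ (2 * n)" Y] by simp
  have pB: "int p ^ n dvd int B - 1"
    using v(3) by simp
  have n3: "2 * n + n = 3 * n"
    by simp
  have "int p ^ (3 * n) dvd - defect (int B) Y"
    using prime_power_dvd_defect [OF p(1) p2 v(8) pB pY] unfolding n3 by simp
  then obtain j where j: "- defect (int B) Y = int p ^ (3 * n) * j"
    by (rule dvdE)
  \<comment> \<open>By \<open>conj_a\<close>, the power \<open>a^(1 - A^\<delta>)\<close> is a
    product of powers of c and of \<open>b^(p^(3n))\<close>, so it commutes with c and is killed by
    A - 1; the valuations m + n and m add up.\<close>
  have a1: "a [^] (int p ^ (2 * m + n)) = \<one>"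
  proof -
    have "a [^] (1 - int A ^ \<delta>) = inv (c [^] int Y) \<otimes> b [^] (int p ^ (3 * n) * j)"
      using conj_a unfolding j by (simp add: inv_solve_left)
    moreover have "inv (c [^] int Y) \<otimes> c = c \<otimes> inv (c [^] int Y)"
      using commute_int_pow [of c c "- int Y"] by (simp add: int_pow_neg)
    ultimately have "a [^] (1 - int A ^ \<delta>) \<otimes> c = c \<otimes> a [^] (1 - int A ^ \<delta>)"
      using b3n_commutes_c [of j] commute_mult [of "inv (c [^] int Y)" "b [^] (int p ^ (3 * n) * j)" c] by simp
    then have "a [^] (1 - int A ^ \<delta>) \<otimes> inv c = inv c \<otimes> a [^] (1 - int A ^ \<delta>)"
      by (intro commute_inv) simp_all
    then have "a [^] ((1 - int A ^ \<delta>) * (int A - 1)) = \<one>"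
      using sw.bpow_central_pow by (simp only: AB)
    also have "(1 - int A ^ \<delta>) * (int A - 1) = int p ^ (2 * m + n) * - (w\<^sub>a * t\<^sub>1)"
    proof -
      have "(1 - int A ^ \<delta>) * (int A - 1) = - ((int A ^ \<delta> - 1) * (int A - 1))"
        by (simp add: algebra_simps)
      then show ?thesis
        by (simp add: wa v(1) power_add [symmetric] mult_2 add_ac)
    qed
    finally have eq: "a [^] (int p ^ (2 * m + n) * - (w\<^sub>a * t\<^sub>1)) = \<one>" .
    have "\<not> int p dvd w\<^sub>a * t\<^sub>1"
      using wa(2) v(2) prime_dvd_multD [OF prime] by blast
    then have "\<not> int p dvd - (w\<^sub>a * t\<^sub>1)"
      by (simp only: dvd_minus_iff) simp
    then show ?thesis
      using eq by (rule unit_a)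
  qed
  have b1: "b [^] (int p ^ (3 * n)) = \<one>"
  proof -
    have "int p ^ (2 * m + n) dvd int p ^ (3 * m) * x\<^sub>1"
      using v(7) by (intro dvd_mult2 le_imp_power_dvd) simp
    then show ?thesis
      unfolding x1 by (rule int_pow_eq_one_of_dvd [OF a_closed a1])
  qed
  have cY: "c [^] int Y = a [^] (int A ^ \<delta> - 1)"
  proof -
    have "b [^] (int p ^ (3 * n) * j) = \<one>"
      by (rule int_pow_eq_one_of_dvd [OF b_closed b1]) simp
    then have "c [^] int Y \<otimes> a [^] (1 - int A ^ \<delta>) = \<one>"
      using conj_a j by simp
    then have "c [^] int Y = inv (a [^] (1 - int A ^ \<delta>))"
      by (intro inv_equality [symmetric]) simp_all
    then show ?thesis
      by (simp add: int_pow_neg [symmetric])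
  qed
  \<comment> \<open>Conjugation by \<open>c^Y\<close> raises b to the power \<open>B^Y\<close>,
    which is 1 modulo \<open>p^(3n)\<close>, so \<open>c^Y\<close> commutes with b. By
    \<open>cY\<close> it is \<open>a^(p^(m + n))\<close> up to an invertible exponent.\<close>
  have amn: "a [^] (int p ^ (m + n) * i) \<otimes> b = b \<otimes> a [^] (int p ^ (m + n) * i)" for i
  proof -
    have "int p ^ (3 * n) dvd int B ^ Y - 1"
      using prime_power_dvd_power_minus_one [OF p(1) p2 v(8) pB pY] unfolding n3 .
    then have "b [^] (int B ^ Y - 1) = \<one>"
      by (rule int_pow_eq_one_of_dvd [OF b_closed b1])
    then have "b [^] (int B ^ Y) = b"
      using int_pow_mult [of b "int B ^ Y - 1" 1] by simp
    then have "c [^] int Y \<otimes> b = b \<otimes> c [^] int Y"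
      using cpow_bpow [of Y 1] by (simp add: AB)
    then have "(a [^] (int p ^ (m + n) * w\<^sub>a)) \<otimes> b = b \<otimes> a [^] (int p ^ (m + n) * w\<^sub>a)"
      by (simp only: cY wa)
    moreover obtain t where "\<forall>i. a [^] (i * w\<^sub>a * t) = a [^] i"
      using unit_multiple_invertible [OF a_closed orders(1) p(1) wa(2)] by blast
    ultimately have "a [^] (int p ^ (m + n)) \<otimes> b = b \<otimes> a [^] (int p ^ (m + n))"
      using commute_int_pow [of "a [^] (int p ^ (m + n) * w\<^sub>a)" b t] by (simp add: int_pow_pow)
    then show ?thesis
      using commute_int_pow [of "a [^] (int p ^ (m + n))" b i] by (simp add: int_pow_pow)
  qed
  obtain x' where x': "x = int p ^ (m + n) * x'"
  proof -
    have "int p ^ (m + n) dvd int p ^ (2 * m)"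
      using v(7) by (intro le_imp_power_dvd) simp
    then show ?thesis
      using x that by (meson dvdE dvd_trans)
  qed
  \<comment> \<open>The relation \<open>rel\<close> is compared with its conjugate by b:
    \<open>a^x\<close> commutes with b since \<open>p^(m + n)\<close> divides x, hence so does
    \<open>c^\<delta>\<close>. So b is killed by \<open>B^\<delta> - 1\<close>, whose valuation is
    2n.\<close>
  show b2n: "b [^] (int p ^ (2 * n)) = \<one>"
  proof -
    have "b [^] int Y \<otimes> b = b \<otimes> b [^] int Y"
      by (rule commute_int_pow) simp_all
    then have "(c [^] int \<delta> \<otimes> b) \<otimes> a [^] x = (b \<otimes> c [^] int \<delta>) \<otimes> a [^] x"
      unfolding rel x' using amn [of x'] by (simp add: m_assoc)
    then have "c [^] int \<delta> \<otimes> b = b \<otimes> c [^] int \<delta>"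
      by simp
    then have "b [^] (int B ^ \<delta>) \<otimes> c [^] int \<delta> = b \<otimes> c [^] int \<delta>"
      using cpow_bpow [of \<delta> 1] by (simp add: AB)
    then have "b [^] (int B ^ \<delta>) = b"
      by simp
    then have "b [^] (int B ^ \<delta> - 1) = \<one>"
      by (simp add: int_pow_diff)
    then show ?thesis
      using wb unit_b [of w\<^sub>b "int p ^ (n + n)"] by (simp add: mult_2)
  qed
  have c\<delta>: "c [^] int \<delta> = a [^] (- x)"
  proof -
    have "b [^] int Y = \<one>"
      by (rule int_pow_eq_one_of_dvd [OF b_closed b2n]) (simp add: w)
    then have "c [^] int \<delta> = inv (a [^] x)"
      using rel by (intro inv_equality [symmetric]) simp_all
    then show ?thesis
      by (simp add: int_pow_neg)
  qed
  \<comment> \<open>One half of the valuation 2n of Y turns c into a power of \<open>a^x\<close>;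
    the other half raises the divisor \<open>p^(2m)\<close> of x to \<open>p^(2m + n)\<close>, which
    kills a.\<close>
  have cY1: "c [^] int Y = \<one>"
  proof -
    obtain t where t: "\<forall>i. c [^] (i * d * t) = c [^] i"
      using unit_multiple_invertible [OF c_closed orders(3) p(1) d(2)] by blast
    have "c [^] (int p ^ n) = (c [^] int \<delta>) [^] t"
      using t by (simp add: d int_pow_pow)
    then have "c [^] (int p ^ n) = a [^] (- x * t)"
      by (simp add: c\<delta> int_pow_pow)
    moreover have "int Y = int p ^ n * (int p ^ n * w)"
      by (simp add: w mult_2 power_add)
    then have "c [^] int Y = (c [^] (int p ^ n)) [^] (int p ^ n * w)"
      by (simp only: int_pow_pow c_closed)
    ultimately have "c [^] int Y = a [^] (- x * t * (int p ^ n * w))"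
      by (simp only: int_pow_pow a_closed)
    moreover have "int p ^ (2 * m + n) dvd - x * t * (int p ^ n * w)"
    proof -
      have "int p ^ (2 * m) * int p ^ n dvd (x * t) * (int p ^ n * w)"
        using x by (intro mult_dvd_mono) simp_all
      then show ?thesis
        by (simp add: power_add)
    qed
    ultimately show ?thesis
      using int_pow_eq_one_of_dvd [OF a_closed a1] by simp
  qed
  show amn1: "a [^] (int p ^ (m + n)) = \<one>"
    using cY1 unfolding cY wa(1) by (rule unit_a [OF wa(2)])
  have "a [^] (- x) = \<one>"
    by (rule int_pow_eq_one_of_dvd [OF a_closed amn1]) (simp add: x')
  then have "c [^] int \<delta> = \<one>"
    using c\<delta> by simp
  then show "c [^] (int p ^ n) = \<one>"
    unfolding d(1) by (rule unit_c [OF d(2)])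
qed

lemma p_part_bounds:
  fixes p :: nat
  assumes p: "Factorial_Ring.prime p" "p > 3 \<or> p = 3 \<and> \<beta> mod 9 \<noteq> 7"
    and v: "\<alpha> - 1 = int p ^ m * t\<^sub>1" "\<not> int p dvd t\<^sub>1"
      "\<beta> - 1 = int p ^ n * t\<^sub>2" "\<not> int p dvd t\<^sub>2"
      "\<alpha> - \<beta> = int p ^ n * t\<^sub>3" "\<not> int p dvd t\<^sub>3"
      "n \<le> m" "0 < n"
    and orders: "a [^] (int p ^ S) = \<one>" "b [^] (int p ^ S) = \<one>" "c [^] (int p ^ S) = \<one>"
  shows "a [^] (int p ^ (m + n)) = \<one>" "b [^] (int p ^ (2 * n)) = \<one>" "c [^] (int p ^ n) = \<one>"
proof -
  \<comment> \<open>Q is at least S and exceeds m and n, so that reduction modulo P affects neither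
    the relations nor the valuations. The summand 2 makes P divisible by 9 for p = 3 and so
    preserves the residue modulo 9.\<close>
  define Q where "Q = S + m + n + 2"
  define P where "P = int p ^ Q"
  define A where "A = nat (\<alpha> mod P)"
  define B where "B = nat (\<beta> mod P)"
  have "P > 0"
    using p by (auto simp: P_def)
  then have A: "int A = \<alpha> - P * (\<alpha> div P)" and B: "int B = \<beta> - P * (\<beta> div P)"
    by (simp_all add: A_def B_def minus_mult_div_eq_mod)
  have P: "P = int p ^ i * int p ^ (Q - i)" if "i \<le> Q" for i
    using that by (simp add: P_def power_add [symmetric])
  have perturb: "int p ^ i * t + P * z = int p ^ i * (t + int p ^ (Q - i) * z)"
    "\<not> int p dvd t \<Longrightarrow> \<not> int p dvd t + int p ^ (Q - i) * z" if "i < Q" for i t z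
    using that P [of i] by (simp_all add: algebra_simps dvd_add_left_iff)
  have "int (ord a) dvd int p ^ S" "int (ord b) dvd int p ^ S"
    using orders by (simp_all add: int_pow_eq_id)
  moreover have "int p ^ S dvd P"
    unfolding P_def Q_def by (intro le_imp_power_dvd) simp
  ultimately have "int (ord a) dvd P" "int (ord b) dvd P"
    using dvd_trans by blast+
  then have "int (ord a) dvd int A - \<alpha>" "int (ord b) dvd int B - \<beta>"
    by (simp_all add: A B)
  then interpret M: macdonald G a b c "int A" "int B"
    by (rule change_parameters)
  have "int A - 1 = int p ^ m * t\<^sub>1 + P * (- (\<alpha> div P))"
    and "int B - 1 = int p ^ n * t\<^sub>2 + P * (- (\<beta> div P))"
    and "int A - int B = int p ^ n * t\<^sub>3 + P * (\<beta> div P - \<alpha> div P)"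
    using v(1,3,5) by (simp_all add: A B algebra_simps)
  moreover have "m < Q" "n < Q"
    by (simp_all add: Q_def)
  ultimately have v': "int A - 1 = int p ^ m * (t\<^sub>1 + int p ^ (Q - m) * (- (\<alpha> div P)))"
      "int B - 1 = int p ^ n * (t\<^sub>2 + int p ^ (Q - n) * (- (\<beta> div P)))"
      "int A - int B = int p ^ n * (t\<^sub>3 + int p ^ (Q - n) * (\<beta> div P - \<alpha> div P))"
    by (simp_all only: perturb)
  note SQ = \<open>int p ^ S dvd P\<close> [unfolded P_def]
  note orders' = int_pow_eq_one_of_dvd [OF a_closed orders(1) SQ]
    int_pow_eq_one_of_dvd [OF b_closed orders(2) SQ] int_pow_eq_one_of_dvd [OF c_closed orders(3) SQ]
  have p': "p > 3 \<or> p = 3 \<and> int B mod 9 \<noteq> 7"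
  proof -
    have "int B mod 9 = \<beta> mod 9" if "p = 3"
    proof -
      have "P = 9 * 3 ^ (S + m + n)"
        by (simp add: P_def Q_def that)
      then have "9 dvd int B - \<beta>"
        by (simp add: B)
      then show ?thesis
        by (simp add: mod_eq_dvd_iff)
    qed
    then show ?thesis
      using p(2) by auto
  qed
  note bounds = M.p_part_bounds_nat [OF HOL.refl HOL.refl p(1) p' v'(1) perturb(2) [OF \<open>m < Q\<close> v(2)]
      v'(2) perturb(2) [OF \<open>n < Q\<close> v(4)] v'(3) perturb(2) [OF \<open>n < Q\<close> v(6)] v(7,8) \<open>n < Q\<close> orders']
  show "a [^] (int p ^ (m + n)) = \<one>" "b [^] (int p ^ (2 * n)) = \<one>" "c [^] (int p ^ n) = \<one>"
    by (rule bounds)+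
qed

end

section \<open>Splitting and normal forms\<close>

lemma dvd_power_of_prime_dvd:
  fixes N z :: nat
  assumes "N > 0" "\<And>q. Factorial_Ring.prime q \<Longrightarrow> q dvd N \<Longrightarrow> q dvd z"
  shows "\<exists>k. N dvd z ^ k"
  using assms
proof (induction N rule: less_induct)
  case (less N)
  show ?case
  proof (cases "N = 1")
    case True
    then show ?thesis by simp
  next
    case False
    then obtain q where q: "Factorial_Ring.prime q" "q dvd N"
      using prime_factor_nat by blast
    then obtain N' where N': "N = q * N'"
      by blast
    have "N' > 0" "N' < N"
      using less.prems(1) N' q(1) prime_gt_1_nat by auto
    moreover have "q' dvd z" if "Factorial_Ring.prime q'" "q' dvd N'" for q'
      using less.prems(2) that N' by simp
    ultimately obtain k where "N' dvd z ^ k"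
      using less.IH by blast
    then have "q * N' dvd z * z ^ k"
      using less.prems(2) q by (intro mult_dvd_mono)
    then show ?thesis
      unfolding N' by (metis power_Suc)
  qed
qed

section \<open>Restriction of the relations to powers of the generators\<close>

context macdonald
begin

text \<open>By \<open>apow_b\<close>, the power \<open>a^r\<close> becomes
  \<open>a^(geosum \<alpha> r)\<close> when it passes b. The divisibility turns this exponent into
  \<open>r * \<alpha>^r\<close>, which is also what \<open>a^r\<close> becomes when it passes
  \<open>c^r\<close>. As b is left unchanged, the parameters become r-th powers.\<close>

lemma restrict_power_a:
  assumes "int (ord a) dvd defect \<alpha> r"
  shows "macdonald G (a [^] int r) b (c [^] int r) (\<alpha> ^ r) (\<beta> ^ r)"
proof
  have "a [^] geosum \<alpha> r = a [^] (int r * \<alpha> ^ r)"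
    using assms int_pow_eq [of a "geosum \<alpha> r" "int r * \<alpha> ^ r"] by (simp add: defect_def)
  then show "a [^] int r \<otimes> b = b \<otimes> a [^] int r \<otimes> c [^] int r"
    using apow_b [of r] apow_cpow [of "int r" r] by (simp add: m_assoc)
  show "a [^] int r \<otimes> c [^] int r = c [^] int r \<otimes> (a [^] int r) [^] (\<alpha> ^ r)"
    by (simp add: apow_cpow int_pow_pow)
  show "c [^] int r \<otimes> b = b [^] (\<beta> ^ r) \<otimes> c [^] int r"
    using cpow_bpow [of r 1] by simp
qed simp_all

lemma apow_cpow_commute:
  assumes "int (ord a) dvd int r * (\<alpha> ^ s - 1)"
  shows "a [^] int r \<otimes> c [^] int s = c [^] int s \<otimes> a [^] int r"
proof -
  have "a [^] (int r * \<alpha> ^ s) = a [^] int r"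
    using assms int_pow_eq [of a "int r" "int r * \<alpha> ^ s"] by (simp add: right_diff_distrib)
  then show ?thesis
    using apow_cpow [of "int r" s] by simp
qed

lemma bpow_cpow_commute:
  assumes "int (ord b) dvd int r * (\<beta> ^ s - 1)"
  shows "b [^] int r \<otimes> c [^] int s = c [^] int s \<otimes> b [^] int r"
proof -
  have "b [^] (int r * \<beta> ^ s) = b [^] int r"
    using assms int_pow_eq [of b "int r" "int r * \<beta> ^ s"] by (simp add: right_diff_distrib)
  then show ?thesis
    using cpow_bpow [of s "int r"] by simp
qed

lemma apow_bpow_commute:
  assumes "int (ord a) dvd defect \<alpha> r" "int (ord b) dvd defect (\<beta> ^ r) s" "int (ord c) dvd int r * int s"
  shows "a [^] int r \<otimes> b [^] int s = b [^] int s \<otimes> a [^] int r"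
proof -
  interpret M: macdonald G "a [^] int r" b "c [^] int r" "\<alpha> ^ r" "\<beta> ^ r"
    by (rule restrict_power_a [OF assms(1)])
  have "b [^] defect (\<beta> ^ r) s = \<one>" "(c [^] int r) [^] int s = \<one>"
    using assms by (simp_all add: int_pow_eq_id int_pow_pow)
  then show ?thesis
    using M.a_bpow [of s] by simp
qed

text \<open>Each relation is multiplied by the s-part of b or of c, which completes one generator,
  so that a relation for the full generator applies; the s-part is then moved to the end and
  cancelled. This restores the parameters \<alpha> and \<beta> in place of the powers in
  \<open>restrict_power_a\<close>.\<close>

lemma restrict_power:
  assumes r: "int (ord a) dvd defect \<alpha> r"
    and as: "a [^] int r \<otimes> c [^] int s = c [^] int s \<otimes> a [^] int r"
    and bs: "b [^] int r \<otimes> c [^] int s = c [^] int s \<otimes> b [^] int r"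
    and sb: "a [^] int r \<otimes> b [^] int s = b [^] int s \<otimes> a [^] int r"
    and sc: "b [^] int s \<otimes> c [^] int r = c [^] int r \<otimes> b [^] int s"
    and split: "b = b [^] int r \<otimes> b [^] int s" "c = c [^] int r \<otimes> c [^] int s"
  shows "macdonald G (a [^] int r) (b [^] int r) (c [^] int r) \<alpha> \<beta>"
proof
  interpret M: macdonald G "a [^] int r" b "c [^] int r" "\<alpha> ^ r" "\<beta> ^ r"
    by (rule restrict_power_a [OF r])
  let ?a = "a [^] int r" and ?b = "b [^] int r" and ?c = "c [^] int r"
  have "(?a \<otimes> ?b) \<otimes> b [^] int s = ?a \<otimes> b"
    using split(1) by (simp add: m_assoc)
  also have "\<dots> = (?b \<otimes> b [^] int s) \<otimes> ?a \<otimes> ?c"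
    using split(1) M.ab by simp
  also have "\<dots> = ?b \<otimes> ((b [^] int s \<otimes> ?a) \<otimes> ?c)"
    by (simp add: m_assoc)
  also have "\<dots> = ?b \<otimes> (?a \<otimes> (b [^] int s \<otimes> ?c))"
    by (simp add: sb [symmetric] m_assoc)
  also have "\<dots> = (?b \<otimes> ?a \<otimes> ?c) \<otimes> b [^] int s"
    by (simp add: sc m_assoc)
  finally show "?a \<otimes> ?b = ?b \<otimes> ?a \<otimes> ?c"
    by simp
  have sa: "c [^] int s \<otimes> ?a [^] \<alpha> = ?a [^] \<alpha> \<otimes> c [^] int s"
    by (rule commute_int_pow [symmetric]) (simp_all add: as)
  have "(?a \<otimes> ?c) \<otimes> c [^] int s = ?a \<otimes> c"
    using split(2) by (simp add: m_assoc)
  also have "\<dots> = c \<otimes> ?a [^] \<alpha>"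
    using apow_cpow [of "int r" 1] by (simp add: int_pow_pow)
  also have "\<dots> = (?c \<otimes> c [^] int s) \<otimes> ?a [^] \<alpha>"
    using split(2) by simp
  also have "\<dots> = (?c \<otimes> ?a [^] \<alpha>) \<otimes> c [^] int s"
    by (simp add: m_assoc sa)
  finally show "?a \<otimes> ?c = ?c \<otimes> ?a [^] \<alpha>"
    by simp
  have "(?c \<otimes> ?b) \<otimes> c [^] int s = (?c \<otimes> c [^] int s) \<otimes> ?b"
    by (simp add: m_assoc bs)
  also have "\<dots> = c \<otimes> ?b"
    using split(2) by simp
  also have "\<dots> = ?b [^] \<beta> \<otimes> c"
    using cpow_bpow [of 1 "int r"] by (simp add: int_pow_pow)
  also have "\<dots> = (?b [^] \<beta> \<otimes> ?c) \<otimes> c [^] int s"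
    using split(2) by (simp add: m_assoc)
  finally show "?c \<otimes> ?b = ?b [^] \<beta> \<otimes> ?c"
    by simp
qed simp_all

section \<open>Normal forms and their closure under multiplication\<close>

definition normal_forms :: "'a set" where
  "normal_forms = {a [^] i \<otimes> c [^] k \<otimes> b [^] j | (i::int) (k::int) (j::int). True}"

lemma normal_formsI: "a [^] (i::int) \<otimes> c [^] (k::int) \<otimes> b [^] (j::int) \<in> normal_forms"
  unfolding normal_forms_def by blast

lemma normal_forms_subset: "normal_forms \<subseteq> carrier G"
  unfolding normal_forms_def by auto

end

locale finite_macdonald = macdonald +
  assumes ord_a: "ord a > 0" and ord_b: "ord b > 0" and ord_c: "ord c > 0"
begin

lemma nonneg_exponent:
  assumes "x \<in> carrier G" "ord x > 0"
  shows "\<exists>j. x [^] (i::int) = x [^] int j"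
proof -
  have "int (ord x) dvd i - i mod int (ord x)"
    by simp
  then have "x [^] i = x [^] (i mod int (ord x))"
    using int_pow_eq [OF assms(1)] by (metis dvd_diff_commute)
  moreover have "i mod int (ord x) = int (nat (i mod int (ord x)))"
    using assms(2) by simp
  ultimately show ?thesis
    by metis
qed

lemma coprime_ord_a: "coprime \<alpha> (int (ord a))"
proof -
  interpret sw: macdonald G b a "inv c" \<beta> \<alpha>
    by (rule swapped)
  show ?thesis
    by (rule sw.coprime_ord_b [OF ord_a])
qed

text \<open>Moving a to the left past c needs an inverse of \<open>\<alpha>^l\<close>, which exists
  modulo the order of a; the exponent k is first replaced by a natural number.\<close>

lemma cpow_apow: "\<exists>i'. c [^] (k::int) \<otimes> a [^] (i::int) = a [^] (i'::int) \<otimes> c [^] k"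
proof -
  obtain l where l: "c [^] k = c [^] int l"
    using nonneg_exponent [OF c_closed ord_c] by blast
  have "coprime (\<alpha> ^ l) (int (ord a))"
    using coprime_ord_a by simp
  then obtain t where t: "[\<alpha> ^ l * t = 1] (mod int (ord a))"
    using cong_solve_coprime_int by blast
  have "[i * (\<alpha> ^ l * t) = i * 1] (mod int (ord a))"
    using t by (rule cong_scalar_left)
  then have "int (ord a) dvd i * (\<alpha> ^ l * t) - i"
    by (simp add: cong_iff_dvd_diff)
  then have "a [^] i = a [^] (i * t * \<alpha> ^ l)"
    by (simp add: int_pow_eq mult_ac)
  then have "c [^] int l \<otimes> a [^] i = a [^] (i * t) \<otimes> c [^] int l"
    by (simp add: apow_cpow)
  then show ?thesis
    unfolding l by blast
qed

lemma bpow_cpow: "\<exists>j'. b [^] (j::int) \<otimes> c [^] (k::int) = c [^] k \<otimes> b [^] (j'::int)"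
proof -
  obtain l where l: "c [^] k = c [^] int l"
    using nonneg_exponent [OF c_closed ord_c] by blast
  have "coprime (\<beta> ^ l) (int (ord b))"
    using coprime_ord_b [OF ord_b] by simp
  then obtain t where t: "[\<beta> ^ l * t = 1] (mod int (ord b))"
    using cong_solve_coprime_int by blast
  have "[j * (\<beta> ^ l * t) = j * 1] (mod int (ord b))"
    using t by (rule cong_scalar_left)
  then have "int (ord b) dvd j * (\<beta> ^ l * t) - j"
    by (simp add: cong_iff_dvd_diff)
  then have "b [^] j = b [^] (j * t * \<beta> ^ l)"
    by (simp add: int_pow_eq mult_ac)
  then have "b [^] j \<otimes> c [^] int l = c [^] int l \<otimes> b [^] (j * t)"
    by (simp add: cpow_bpow)
  then show ?thesis
    unfolding l by blast
qed

lemma normal_forms_mult_b: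
  assumes "x \<in> normal_forms"
  shows "x \<otimes> b [^] (l::int) \<in> normal_forms"
proof -
  obtain i k j :: int where x: "x = a [^] i \<otimes> c [^] k \<otimes> b [^] j"
    using assms unfolding normal_forms_def by blast
  have "x \<otimes> b [^] l = a [^] i \<otimes> c [^] k \<otimes> b [^] (j + l)"
    by (simp add: x m_assoc int_pow_mult)
  then show ?thesis
    using normal_formsI by simp
qed

lemma normal_forms_mult_c:
  assumes "x \<in> normal_forms"
  shows "x \<otimes> c [^] (l::int) \<in> normal_forms"
proof -
  obtain i k j :: int where x: "x = a [^] i \<otimes> c [^] k \<otimes> b [^] j"
    using assms unfolding normal_forms_def by blast
  obtain j' where j': "b [^] j \<otimes> c [^] l = c [^] l \<otimes> b [^] (j'::int)"
    using bpow_cpow by blast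
  have "x \<otimes> c [^] l = a [^] i \<otimes> c [^] (k + l) \<otimes> b [^] j'"
    by (simp add: x m_assoc j' int_pow_mult)
  then show ?thesis
    using normal_formsI by simp
qed

lemma normal_forms_mult_a1:
  assumes "x \<in> normal_forms"
  shows "x \<otimes> a \<in> normal_forms"
proof -
  interpret sw: macdonald G b a "inv c" \<beta> \<alpha>
    by (rule swapped)
  obtain i k j :: int where x: "x = a [^] i \<otimes> c [^] k \<otimes> b [^] j"
    using assms unfolding normal_forms_def by blast
  obtain l where l: "b [^] j = b [^] int l"
    using nonneg_exponent [OF b_closed ord_b] by blast
  obtain i' where i': "c [^] k \<otimes> a [^] (1::int) = a [^] (i'::int) \<otimes> c [^] k"
    using cpow_apow by blast
  have "x \<otimes> a = a [^] i \<otimes> c [^] k \<otimes> (b [^] int l \<otimes> a)"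
    by (simp add: x l m_assoc)
  also have "b [^] int l \<otimes> a = a \<otimes> inv c [^] int l \<otimes> b [^] geosum \<beta> l"
    by (rule sw.apow_b)
  also have "a [^] i \<otimes> c [^] k \<otimes> (a \<otimes> inv c [^] int l \<otimes> b [^] geosum \<beta> l)
      = a [^] i \<otimes> (c [^] k \<otimes> a [^] (1::int)) \<otimes> (inv c [^] int l \<otimes> b [^] geosum \<beta> l)"
    by (simp add: m_assoc)
  also have "\<dots> = (a [^] i \<otimes> a [^] i') \<otimes> (c [^] k \<otimes> inv c [^] int l) \<otimes> b [^] geosum \<beta> l"
    unfolding i' by (simp add: m_assoc)
  also have "\<dots> = a [^] (i + i') \<otimes> c [^] (k - int l) \<otimes> b [^] geosum \<beta> l"
    by (simp add: int_pow_mult int_pow_diff int_pow_inv)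
  finally show ?thesis
    using normal_formsI by simp
qed

lemma normal_forms_mult_a:
  assumes "x \<in> normal_forms"
  shows "x \<otimes> a [^] (l::int) \<in> normal_forms"
proof -
  have "x \<otimes> a [^] (t::nat) \<in> normal_forms" for t
  proof (induction t)
    case 0
    then show ?case
      using assms normal_forms_subset by auto
  next
    case (Suc t)
    have "x \<otimes> a [^] Suc t = (x \<otimes> a [^] t) \<otimes> a"
      using assms normal_forms_subset by (auto simp: m_assoc)
    then show ?case
      using normal_forms_mult_a1 [OF Suc] by simp
  qed
  moreover obtain t where "a [^] l = a [^] int t"
    using nonneg_exponent [OF a_closed ord_a] by blast
  ultimately show ?thesis
    by (simp add: int_pow_int)
qed

lemma normal_forms_one: "\<one> \<in> normal_forms"
  using normal_formsI [of 0 0 0] by simp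

lemma normal_forms_mult:
  assumes "x \<in> normal_forms" "y \<in> normal_forms"
  shows "x \<otimes> y \<in> normal_forms"
proof -
  obtain i k j :: int where y: "y = a [^] i \<otimes> c [^] k \<otimes> b [^] j"
    using assms unfolding normal_forms_def by blast
  have "x \<in> carrier G"
    using assms normal_forms_subset by blast
  then have "x \<otimes> y = x \<otimes> a [^] i \<otimes> c [^] k \<otimes> b [^] j"
    by (simp add: y m_assoc)
  then show ?thesis
    using assms by (simp add: normal_forms_mult_a normal_forms_mult_b normal_forms_mult_c)
qed

lemma normal_forms_subgroup: "subgroup normal_forms G"
proof (rule subgroupI)
  show "normal_forms \<subseteq> carrier G"
    by (rule normal_forms_subset)
  show "normal_forms \<noteq> {}"
    using normal_forms_one by blast
  show "inv x \<in> normal_forms" if nf: "x \<in> normal_forms" for x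
  proof -
    obtain i k j :: int where x: "x = a [^] i \<otimes> c [^] k \<otimes> b [^] j"
      using nf unfolding normal_forms_def by blast
    have "inv x = \<one> \<otimes> b [^] (- j) \<otimes> c [^] (- k) \<otimes> a [^] (- i)"
      by (simp add: x inv_mult_group int_pow_neg m_assoc)
    then show ?thesis
      by (simp only: normal_forms_mult_a normal_forms_mult_b normal_forms_mult_c normal_forms_one)
  qed
qed (rule normal_forms_mult)

end

section \<open>Orders of products of subgroups and uniqueness of p-parts\<close>

context group
begin

text \<open>The product set need not be a subgroup, so Lagrange's theorem does not apply to it.
  Choosing for each of its elements a left factor in H gives a bijection between pairs from the
  product set and the intersection, and pairs from H and K.\<close>

lemma card_set_mult_dvd:
  assumes H: "subgroup H G" and K: "subgroup K G" and fin: "finite H" "finite K"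
  shows "card (H <#> K) dvd card H * card K"
proof -
  have sub: "H \<subseteq> carrier G" "K \<subseteq> carrier G"
    using H K subgroup.subset by auto
  define rep where "rep g = (SOME h. h \<in> H \<and> inv h \<otimes> g \<in> K)" for g
  have rep: "rep g \<in> H \<and> inv (rep g) \<otimes> g \<in> K" if g: "g \<in> H <#> K" for g
  proof -
    obtain h k where hk: "h \<in> H" "k \<in> K" "g = h \<otimes> k"
      using g unfolding set_mult_def by blast
    then have "inv h \<otimes> g = k"
      using sub by (auto simp: m_assoc [symmetric] subset_iff)
    then have "h \<in> H \<and> inv h \<otimes> g \<in> K"
      using hk by simp
    then show ?thesis
      unfolding rep_def by (rule someI)
  qed
  define f where "f = (\<lambda>(g, t). (rep g \<otimes> t, inv t \<otimes> (inv (rep g) \<otimes> g)))"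
  have "bij_betw f ((H <#> K) \<times> (H \<inter> K)) (H \<times> K)"
  proof (rule bij_betwI [where g = "\<lambda>(h, k). (h \<otimes> k, inv (rep (h \<otimes> k)) \<otimes> h)"])
    show "f \<in> (H <#> K) \<times> (H \<inter> K) \<rightarrow> H \<times> K"
      using rep H K by (auto simp: f_def subgroup.m_closed subgroup.m_inv_closed)
    show "(\<lambda>(h, k). (h \<otimes> k, inv (rep (h \<otimes> k)) \<otimes> h)) \<in> H \<times> K \<rightarrow> (H <#> K) \<times> (H \<inter> K)"
    proof (clarsimp, intro conjI)
      fix h k assume hk: "h \<in> H" "k \<in> K"
      then have hkG: "h \<in> carrier G" "k \<in> carrier G"
        using sub by auto
      show hkK: "h \<otimes> k \<in> H <#> K"
        using hk unfolding set_mult_def by blast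
      have r: "rep (h \<otimes> k) \<in> H" "inv (rep (h \<otimes> k)) \<otimes> (h \<otimes> k) \<in> K" "rep (h \<otimes> k) \<in> carrier G"
        using rep [OF hkK] sub by auto
      show "inv (rep (h \<otimes> k)) \<otimes> h \<in> H"
        using r(1) hk(1) H by (simp add: subgroup.m_closed subgroup.m_inv_closed)
      have "inv (rep (h \<otimes> k)) \<otimes> h = (inv (rep (h \<otimes> k)) \<otimes> (h \<otimes> k)) \<otimes> inv k"
        using hkG r(3) by (simp add: m_assoc)
      also have "\<dots> \<in> K"
        using r(2) hk(2) K by (simp add: subgroup.m_closed subgroup.m_inv_closed)
      finally show "inv (rep (h \<otimes> k)) \<otimes> h \<in> K" .
    qed
    show "(case f x of (h, k) \<Rightarrow> (h \<otimes> k, inv (rep (h \<otimes> k)) \<otimes> h)) = x"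
      if x: "x \<in> (H <#> K) \<times> (H \<inter> K)" for x
    proof -
      obtain g t where gt: "x = (g, t)" "g \<in> H <#> K" "t \<in> H" "t \<in> K"
        using x by blast
      have G: "rep g \<in> carrier G" "t \<in> carrier G" "g \<in> carrier G"
        using gt rep [OF gt(2)] sub set_mult_closed [OF sub] by auto
      have "rep g \<otimes> t \<otimes> (inv t \<otimes> (inv (rep g) \<otimes> g)) = rep g \<otimes> (t \<otimes> inv t) \<otimes> (inv (rep g) \<otimes> g)"
        using G by (simp only: m_assoc m_closed inv_closed)
      also have "\<dots> = g"
        using G by (simp add: m_assoc [symmetric])
      finally show ?thesis
        using G by (simp add: gt f_def m_assoc [symmetric])
    qed
    show "f (case y of (h, k) \<Rightarrow> (h \<otimes> k, inv (rep (h \<otimes> k)) \<otimes> h)) = y"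
      if y: "y \<in> H \<times> K" for y
    proof -
      obtain h k where hk: "y = (h, k)" "h \<in> H" "k \<in> K"
        using y by blast
      then have hkK: "h \<otimes> k \<in> H <#> K"
        unfolding set_mult_def by blast
      have G: "rep (h \<otimes> k) \<in> carrier G" "h \<in> carrier G" "k \<in> carrier G"
        using hk rep [OF hkK] sub by auto
      let ?r = "rep (h \<otimes> k)"
      have "?r \<otimes> (inv ?r \<otimes> h) = h"
        using G by (simp add: m_assoc [symmetric])
      moreover have "inv (inv ?r \<otimes> h) \<otimes> (inv ?r \<otimes> (h \<otimes> k)) = inv h \<otimes> (?r \<otimes> inv ?r) \<otimes> (h \<otimes> k)"
        using G by (simp only: inv_mult_group inv_inv m_assoc m_closed inv_closed)
      then have "inv (inv ?r \<otimes> h) \<otimes> (inv ?r \<otimes> (h \<otimes> k)) = k"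
        using G by (simp add: m_assoc [symmetric])
      ultimately show ?thesis
        by (simp add: hk f_def)
    qed
  qed
  then have "card ((H <#> K) \<times> (H \<inter> K)) = card (H \<times> K)"
    by (rule bij_betw_same_card)
  then show ?thesis
    by (metis card_cartesian_product dvd_triv_left)
qed

lemma pow_card_subgroup:
  assumes "subgroup H G" "x \<in> H"
  shows "x [^] card H = \<one>"
proof -
  interpret S: group "G\<lparr>carrier := H\<rparr>"
    using assms(1) by (rule subgroup.subgroup_is_group [OF _ is_group])
  have "x [^]\<^bsub>G\<lparr>carrier := H\<rparr>\<^esub> order (G\<lparr>carrier := H\<rparr>) = \<one>"
    using S.pow_order_eq_1 assms(2) by simp
  then show ?thesis
    by (simp add: order_def nat_pow_consistent [symmetric])
qed

lemma ord_prime_power: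
  assumes "x \<in> carrier G" "x [^] (p ^ K) = \<one>" "Factorial_Ring.prime p"
  shows "\<exists>i. ord x = p ^ i"
proof -
  have "ord x dvd p ^ K"
    using assms pow_eq_id by blast
  then show ?thesis
    using divides_primepow_nat assms(3) by blast
qed

lemma eq_one_of_coprime_pows:
  assumes "x \<in> carrier G" "x [^] (i::nat) = \<one>" "x [^] (j::nat) = \<one>" "coprime i j"
  shows "x = \<one>"
proof -
  have "ord x dvd i" "ord x dvd j"
    using assms pow_eq_id by blast+
  then have "ord x = 1"
    using assms(4) coprime_common_divisor_nat by blast
  then show ?thesis
    using assms(1) ord_eq_1 by blast
qed

text \<open>A single exponent t extracts the p-part: it is 1 modulo a p-power that kills y and a
  competing \<open>y'\<close>, and 0 modulo a number that kills both complements. So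
  \<open>x^t\<close> equals either candidate.\<close>

lemma p_part_eqI:
  assumes G: "y \<in> carrier G" "z \<in> carrier G" and "x = y \<otimes> z" "y \<otimes> z = z \<otimes> y"
    and "y [^] (p ^ K) = \<one>" "z [^] R = \<one>" "coprime p R" "Factorial_Ring.prime p"
  shows "p_part G p x = y"
  unfolding p_part_def
proof (rule the_equality)
  have "ord z dvd R"
    using G assms(6) pow_eq_id by blast
  then have cop: "coprime (ord z) p"
    using assms(7) by (metis coprime_commute coprime_divisors dvd_refl)
  have "y \<in> p_elements G p"
    using ord_prime_power [OF G(1) assms(5,8)] G unfolding p_elements_def by simp
  with cop show "y \<in> p_elements G p \<and>
      (\<exists>z\<in>carrier G. coprime (ord z) p \<and> y \<otimes> z = z \<otimes> y \<and> x = y \<otimes> z)"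
    using assms by blast
next
  fix y' assume "y' \<in> p_elements G p \<and>
      (\<exists>z\<in>carrier G. coprime (ord z) p \<and> y' \<otimes> z = z \<otimes> y' \<and> x = y' \<otimes> z)"
  then obtain z' i where y': "y' \<in> carrier G" "ord y' = p ^ i" "z' \<in> carrier G" "coprime (ord z') p"
      "y' \<otimes> z' = z' \<otimes> y'" "x = y' \<otimes> z'"
    unfolding p_elements_def by blast
  have "coprime (p ^ (K + i)) (R * ord z')"
    using assms(7) y'(4) by (simp add: coprime_commute)
  then obtain t where t: "[t = 1] (mod p ^ (K + i))" "[t = 0] (mod R * ord z')"
    using binary_chinese_remainder_nat by blast
  have power_t: "u [^] t = u" if "u \<in> carrier G" "ord u dvd p ^ (K + i)" for u
  proof -
    have "[t = 1] (mod ord u)"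
      using t(1) that(2) cong_dvd_modulus_nat by blast
    then have "int (ord u) dvd int t - int 1"
      by (metis cong_iff_dvd_diff cong_int_iff)
    then have "int (ord u) dvd int 1 - int t"
      by (simp only: dvd_diff_commute)
    then show ?thesis
      using int_pow_eq [OF that(1), of "int t" "int 1"] that(1) by (simp add: int_pow_int)
  qed
  have "ord y dvd p ^ K"
    using G assms(5) pow_eq_id by blast
  then have "y [^] t = y"
    using G(1) by (intro power_t) (auto simp: power_add)
  moreover have "z [^] t = \<one>"
  proof -
    have "ord z dvd R" using G assms(6) pow_eq_id by blast
    moreover have "R dvd t" using t(2) by (auto simp: cong_0_iff)
    ultimately show ?thesis
      using G(2) pow_eq_id dvd_trans by blast
  qed
  ultimately have "x [^] t = y"
    using pow_mult_distrib [OF assms(4) G, of t] assms(3) G by simp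
  have "y' [^] t = y'"
    using y' by (intro power_t) (auto simp: power_add)
  moreover have "z' [^] t = \<one>"
    using y'(3) t(2) by (auto simp: cong_0_iff pow_eq_id)
  ultimately have "x [^] t = y'"
    using pow_mult_distrib [OF y'(5) y'(1,3), of t] y' by simp
  with \<open>x [^] t = y\<close> show "y' = y"
    by simp
qed

end

context finite_macdonald
begin

text \<open>An intermediate subgroup that lets \<open>card_set_mult_dvd\<close> be applied twice,
  since both factors there have to be subgroups.\<close>

definition ac_subgroup :: "'a set" where
  "ac_subgroup = {a [^] i \<otimes> c [^] k | (i::int) (k::int). True}"

lemma ac_subgroup: "subgroup ac_subgroup G"
proof (rule subgroupI)
  show "ac_subgroup \<subseteq> carrier G"
    unfolding ac_subgroup_def by auto
  show "ac_subgroup \<noteq> {}"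
    unfolding ac_subgroup_def by blast
  show "inv x \<in> ac_subgroup" if x: "x \<in> ac_subgroup" for x
  proof -
    obtain i k :: int where x: "x = a [^] i \<otimes> c [^] k"
      using x unfolding ac_subgroup_def by blast
    obtain i' :: int where "c [^] (- k) \<otimes> a [^] (- i) = a [^] i' \<otimes> c [^] (- k)"
      using cpow_apow by blast
    then have "inv x = a [^] i' \<otimes> c [^] (- k)"
      by (simp add: x inv_mult_group int_pow_neg)
    then show ?thesis
      unfolding ac_subgroup_def by blast
  qed
  show "x \<otimes> y \<in> ac_subgroup" if xy: "x \<in> ac_subgroup" "y \<in> ac_subgroup" for x y
  proof -
    obtain i k :: int where x: "x = a [^] i \<otimes> c [^] k"
      using xy unfolding ac_subgroup_def by blast
    obtain i' k' :: int where y: "y = a [^] i' \<otimes> c [^] k'"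
      using xy unfolding ac_subgroup_def by blast
    obtain l :: int where l: "c [^] k \<otimes> a [^] i' = a [^] l \<otimes> c [^] k"
      using cpow_apow by blast
    have "x \<otimes> y = a [^] i \<otimes> (c [^] k \<otimes> a [^] i') \<otimes> c [^] k'"
      by (simp add: x y m_assoc)
    also have "\<dots> = a [^] (i + l) \<otimes> c [^] (k + k')"
      unfolding l by (simp add: int_pow_mult m_assoc)
    finally show ?thesis
      unfolding ac_subgroup_def by blast
  qed
qed

lemma card_cyclic:
  assumes "x \<in> carrier G" "ord x > 0"
  shows "subgroup {x [^] (i::int) | i. i \<in> UNIV} G" "card {x [^] (i::int) | i. i \<in> UNIV} = ord x"
    "finite {x [^] (i::int) | i. i \<in> UNIV}"
proof -
  show "subgroup {x [^] (i::int) | i. i \<in> UNIV} G"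
    using generate_is_subgroup [of "{x}"] generate_pow [OF assms(1)] assms(1) by simp
  show card: "card {x [^] (i::int) | i. i \<in> UNIV} = ord x"
    using generate_pow_card [OF assms(1)] generate_pow [OF assms(1)] by simp
  show "finite {x [^] (i::int) | i. i \<in> UNIV}"
    using card assms(2) by (intro card_ge_0_finite) simp
qed

text \<open>The cyclic factors may overlap, so only divisibility is asserted. It is enough to see
  that orders in the p-part are powers of p and orders in its complement are prime to p.\<close>

lemma card_normal_forms: "finite normal_forms" "card normal_forms dvd ord a * ord c * ord b"
proof -
  have ac: "ac_subgroup = {a [^] (i::int) | i. i \<in> UNIV} <#> {c [^] (i::int) | i. i \<in> UNIV}"
    unfolding ac_subgroup_def set_mult_def by blast
  have nf: "normal_forms = ac_subgroup <#> {b [^] (i::int) | i. i \<in> UNIV}"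
    unfolding normal_forms_def ac_subgroup_def set_mult_def by blast
  note A = card_cyclic [OF a_closed ord_a] and B = card_cyclic [OF b_closed ord_b]
    and C = card_cyclic [OF c_closed ord_c]
  have "finite ac_subgroup"
    unfolding ac set_mult_def using A(3) C(3) by simp
  then show "finite normal_forms"
    unfolding nf set_mult_def using B(3) by simp
  have "card ac_subgroup dvd ord a * ord c"
    unfolding ac using card_set_mult_dvd [OF A(1) C(1) A(3) C(3)] A(2) C(2) by simp
  moreover have "card normal_forms dvd card ac_subgroup * ord b"
    unfolding nf using card_set_mult_dvd [OF ac_subgroup B(1) \<open>finite ac_subgroup\<close> B(3)] B(2) by simp
  ultimately show "card normal_forms dvd ord a * ord c * ord b"
    by (meson dvd_refl dvd_trans mult_dvd_mono)
qed

section \<open>Splitting off the p-part\<close>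

lemma power_split:
  assumes "x \<in> carrier G" "int (ord x) dvd int r + int s - 1"
  shows "x = x [^] int r \<otimes> x [^] int s"
proof -
  have "x [^] (int r + int s) = x [^] (1::int)"
    using assms int_pow_eq [of x 1 "int r + int s"] by simp
  then show ?thesis
    using assms(1) by (simp add: int_pow_mult)
qed

text \<open>Formulated for both halves of the splitting: once U is p and V the cofactor, once these
  roles are exchanged. The cofactors for a and b are kept apart because \<alpha> - 1 and \<beta> - 1
  may have different prime divisors.\<close>

lemma split_part:
  assumes \<alpha>: "int U\<^sub>a dvd \<alpha> - 1" "int V\<^sub>a dvd \<alpha> - 1" "coprime U\<^sub>a V\<^sub>a"
      "int (ord a) dvd int U\<^sub>a ^ k * int V\<^sub>a ^ k"
    and \<beta>: "int U\<^sub>b dvd \<beta> - 1" "int V\<^sub>b dvd \<beta> - 1" "coprime U\<^sub>b V\<^sub>b"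
      "int (ord b) dvd int U\<^sub>b ^ k * int V\<^sub>b ^ k"
    and r: "[int r = 1] (mod int U\<^sub>a ^ k)" "V\<^sub>a ^ k dvd r" "V\<^sub>b ^ k dvd r" "r > 0"
    and s: "U\<^sub>a ^ k dvd s" "U\<^sub>b ^ k dvd s"
    and rs: "int (ord c) dvd int r * int s"
    and split: "b = b [^] int r \<otimes> b [^] int s" "c = c [^] int r \<otimes> c [^] int s"
  shows "macdonald G (a [^] int r) (b [^] int r) (c [^] int r) \<alpha> \<beta>"
    and "a [^] int r \<otimes> b [^] int s = b [^] int s \<otimes> a [^] int r"
    and "a [^] int r \<otimes> c [^] int s = c [^] int s \<otimes> a [^] int r"
    and "b [^] int r \<otimes> c [^] int s = c [^] int s \<otimes> b [^] int r"
proof -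
  have d: "int (ord a) dvd defect \<alpha> r"
    by (rule splitting_defect [OF \<alpha> r(1,2,4)])
  show ac: "a [^] int r \<otimes> c [^] int s = c [^] int s \<otimes> a [^] int r"
    by (rule apow_cpow_commute [OF splitting_power [OF \<alpha>(1,4) r(2) s(1)]])
  show bc: "b [^] int r \<otimes> c [^] int s = c [^] int s \<otimes> b [^] int r"
    by (rule bpow_cpow_commute [OF splitting_power [OF \<beta>(1,4) r(3) s(2)]])
  have "int (ord b) dvd int V\<^sub>b ^ k * int U\<^sub>b ^ k"
    using \<beta>(4) by (simp add: mult.commute)
  from bpow_cpow_commute [OF splitting_power [OF \<beta>(2) this s(2) r(3)]]
  have cb: "b [^] int s \<otimes> c [^] int r = c [^] int r \<otimes> b [^] int s" .
  show ab: "a [^] int r \<otimes> b [^] int s = b [^] int s \<otimes> a [^] int r"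
    by (rule apow_bpow_commute [OF d splitting_defect_power [OF \<beta> r(3) s(2)] rs])
  show "macdonald G (a [^] int r) (b [^] int r) (c [^] int r) \<alpha> \<beta>"
    by (rule restrict_power [OF d ac bc ab cb split])
qed

lemma p_splitting:
  assumes ne: "\<alpha> \<noteq> 1" "\<beta> \<noteq> 1" and p: "Factorial_Ring.prime p" "int p dvd \<alpha> - 1" "int p dvd \<beta> - 1"
  obtains r s k R :: nat where "coprime p R"
    and "macdonald G (a [^] int r) (b [^] int r) (c [^] int r) \<alpha> \<beta>"
    and "macdonald G (a [^] int s) (b [^] int s) (c [^] int s) \<alpha> \<beta>"
    and "R > 0" "\<not> p dvd r"
    and "\<forall>x\<in>{a, b, c}. x = x [^] int r \<otimes> x [^] int s"
    and "\<forall>x\<in>{a, b, c}. (x [^] int r) [^] (p ^ k) = \<one>"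
    and "\<forall>x\<in>{a, b, c}. (x [^] int s) [^] R = \<one>"
    and "\<forall>x\<in>{a, b, c}. \<forall>y\<in>{a, b, c}. x [^] int r \<otimes> y [^] int s = y [^] int s \<otimes> x [^] int r"
proof -
  interpret sw: macdonald G b a "inv c" \<beta> \<alpha>
    by (rule swapped)
  \<comment> \<open>V is the absolute value of the part of x - 1 prime to p. Every prime divisor of
    N divides \<open>p * V\<close>, so N divides a power of it.\<close>
  have part: "\<exists>V k. int V dvd x - 1 \<and> coprime p V \<and> V > 0 \<and> N dvd (p * V) ^ k"
    if x: "x \<noteq> 1" "int p dvd x - 1" and N: "N > 0" "\<And>q. Factorial_Ring.prime q \<Longrightarrow> q dvd N \<Longrightarrow> int q dvd x - 1"
    for x :: int and N :: nat
  proof -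
    have "x - 1 \<noteq> 0" "\<not> is_unit (int p)"
      using x p(1) by auto
    then obtain t where t: "x - 1 = int p ^ multiplicity (int p) (x - 1) * t" "\<not> int p dvd t"
      by (rule multiplicity_decompose')
    define V where "V = nat \<bar>t\<bar>"
    have V: "int V = \<bar>t\<bar>"
      by (simp add: V_def)
    have "t \<noteq> 0"
      using t(2) by auto
    have "int V dvd x - 1"
      using t(1) V by (metis abs_dvd_iff dvd_triv_right)
    moreover have "\<not> p dvd V"
      using t(2) V by (metis dvd_abs_iff int_dvd_int_iff)
    then have "coprime p V"
      using p(1) prime_imp_coprime by blast
    moreover have "V > 0"
      using \<open>t \<noteq> 0\<close> by (simp add: V_def)
    moreover have "q dvd p * V" if q: "Factorial_Ring.prime q" "q dvd N" for q
    proof -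
      have "int q dvd int p ^ multiplicity (int p) (x - 1) * t"
        using N(2) [OF q] t(1) by simp
      moreover have "Factorial_Ring.prime (int q)"
        using q(1) by simp
      ultimately have "int q dvd int p \<or> int q dvd t"
        using prime_dvd_multD prime_dvd_power by blast
      then show ?thesis
        using V by (metis dvd_abs_iff dvd_mult dvd_mult2 int_dvd_int_iff)
    qed
    then have "\<exists>k. N dvd (p * V) ^ k"
      using dvd_power_of_prime_dvd [OF N(1)] by blast
    ultimately show ?thesis
      by blast
  qed
  \<comment> \<open>The square of \<open>ord a\<close> is treated because the order of c divides it,
    so one cofactor serves both a and c.\<close>
  have "int q dvd \<alpha> - 1" if "Factorial_Ring.prime q" "q dvd ord a * ord a" for q
    using that sw.prime_dvd_ord_b [OF ne(2,1)] prime_dvd_multD by blast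
  then obtain V\<^sub>a k\<^sub>a where Va: "int V\<^sub>a dvd \<alpha> - 1" "coprime p V\<^sub>a" "V\<^sub>a > 0" "ord a * ord a dvd (p * V\<^sub>a) ^ k\<^sub>a"
    using part [OF ne(1) p(2), of "ord a * ord a"] ord_a by auto
  obtain V\<^sub>b k\<^sub>b where Vb: "int V\<^sub>b dvd \<beta> - 1" "coprime p V\<^sub>b" "V\<^sub>b > 0" "ord b dvd (p * V\<^sub>b) ^ k\<^sub>b"
    using part [OF ne(2) p(3) ord_b prime_dvd_ord_b [OF ne]] by auto
  define k where "k = k\<^sub>a + k\<^sub>b + 1"
  have ka: "ord a * ord a dvd (p * V\<^sub>a) ^ k"
    using Va(4) by (rule dvd_trans) (simp add: k_def le_imp_power_dvd)
  have ord_a_dvd: "ord a dvd p ^ k * V\<^sub>a ^ k"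
    using dvd_mult_left [OF ka] by (simp add: power_mult_distrib)
  have "ord b dvd (p * V\<^sub>b) ^ k"
    using Vb(4) by (rule dvd_trans) (simp add: k_def le_imp_power_dvd)
  then have ord_b_dvd: "ord b dvd p ^ k * V\<^sub>b ^ k"
    by (simp add: power_mult_distrib)
  have "c [^] (int (ord a) * int (ord a)) = \<one>"
    using cpow_trivial [OF ord_a] by (simp add: int_pow_int)
  then have "int (ord c) dvd int (ord a * ord a)"
    by (simp add: int_pow_eq_id)
  then have "ord c dvd ord a * ord a"
    by (simp only: int_dvd_int_iff)
  then have ord_c_dvd: "ord c dvd p ^ k * V\<^sub>a ^ k"
    using dvd_trans [OF _ ka] by (simp add: power_mult_distrib)
  define R where "R = V\<^sub>a ^ k * V\<^sub>b ^ k"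
  have "R > 0"
    using Va Vb by (simp add: R_def)
  have cop: "coprime p R"
    using Va(2) Vb(2) by (simp add: R_def)
  then have cop': "coprime (p ^ k) R"
    by simp
  obtain r\<^sub>0 where r0: "[r\<^sub>0 = 1] (mod p ^ k)" "[r\<^sub>0 = 0] (mod R)"
    using binary_chinese_remainder_nat [OF cop'] by blast
  obtain s\<^sub>0 where s0: "[s\<^sub>0 = 0] (mod p ^ k)" "[s\<^sub>0 = 1] (mod R)"
    using binary_chinese_remainder_nat [OF cop'] by blast
  \<comment> \<open>Adding \<open>p^k * R\<close> keeps both residues and makes the exponents
    positive, as \<open>splitting_defect\<close> requires.\<close>
  define r where "r = r\<^sub>0 + p ^ k * R"
  define s where "s = s\<^sub>0 + p ^ k * R"
  have pos: "r > 0" "s > 0"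
    using \<open>R > 0\<close> prime_gt_0_nat [OF p(1)] by (simp_all add: r_def s_def)
  have r: "[r = 1] (mod p ^ k)" "R dvd r"
    using r0 by (simp_all add: r_def cong_def cong_0_iff [symmetric])
  have s: "p ^ k dvd s" "[s = 1] (mod R)"
    using s0 by (simp_all add: s_def cong_def cong_0_iff [symmetric])
  have VR: "V\<^sub>a ^ k dvd R" "V\<^sub>b ^ k dvd R"
    by (simp_all add: R_def)
  have rV: "V\<^sub>a ^ k dvd r" "V\<^sub>b ^ k dvd r"
    using VR r(2) dvd_trans by blast+
  have sV: "[s = 1] (mod V\<^sub>a ^ k)"
    using s(2) VR(1) cong_dvd_modulus_nat by blast
  have intcong: "[int i = 1] (mod int q ^ k)" if "[i = 1] (mod q ^ k)" for i q
    using cong_int_iff [of i 1 "q ^ k"] that by simp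
  have rs1: "int (p ^ k * R) dvd int r + int s - 1"
  proof -
    have "int (p ^ k) dvd (int r - 1) + int s"
    proof (rule dvd_add)
      show "int (p ^ k) dvd int r - 1"
        using intcong [OF r(1)] by (simp add: cong_iff_dvd_diff)
      show "int (p ^ k) dvd int s"
        using s(1) by (simp only: int_dvd_int_iff)
    qed
    moreover have "int R dvd int r + (int s - 1)"
    proof (rule dvd_add)
      show "int R dvd int r"
        using r(2) by simp
      show "int R dvd int s - 1"
        using s(2) cong_int_iff [of s 1 R] by (simp add: cong_iff_dvd_diff)
    qed
    moreover have "coprime (int (p ^ k)) (int R)"
      using cop' by (simp only: coprime_int_iff)
    ultimately have "int (p ^ k) * int R dvd int r + int s - 1"
      by (intro divides_mult) (simp_all add: algebra_simps)
    then show ?thesis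
      by (simp only: of_nat_mult)
  qed
  have ord_dvd: "ord x dvd p ^ k * R" if "x \<in> {a, b, c}" for x
  proof -
    have "p ^ k * V\<^sub>a ^ k dvd p ^ k * R" "p ^ k * V\<^sub>b ^ k dvd p ^ k * R"
      using VR by (auto intro: mult_dvd_mono)
    then show ?thesis
      using that ord_a_dvd ord_b_dvd ord_c_dvd dvd_trans by blast
  qed
  have closed: "x \<in> carrier G" if "x \<in> {a, b, c}" for x
    using that by auto
  have split: "x = x [^] int r \<otimes> x [^] int s" if "x \<in> {a, b, c}" for x
  proof (rule power_split [OF closed [OF that]])
    have "int (ord x) dvd int (p ^ k * R)"
      using ord_dvd [OF that] by (simp only: int_dvd_int_iff)
    then show "int (ord x) dvd int r + int s - 1"
      using rs1 by (rule dvd_trans)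
  qed
  have split': "x = x [^] int s \<otimes> x [^] int r" if "x \<in> {a, b, c}" for x
    using split [OF that] closed [OF that] by (simp add: int_pow_mult [symmetric] add.commute)
  have rs: "int (ord c) dvd int r * int s" "int (ord c) dvd int s * int r"
  proof -
    have "p ^ k * V\<^sub>a ^ k dvd s * r"
      using s(1) rV(1) by (rule mult_dvd_mono)
    then have "ord c dvd s * r"
      using ord_c_dvd dvd_trans by blast
    then have "int (ord c) dvd int (s * r)"
      by (simp only: int_dvd_int_iff)
    then show "int (ord c) dvd int r * int s" "int (ord c) dvd int s * int r"
      by (simp_all add: mult.commute)
  qed
  have oa: "int (ord a) dvd int p ^ k * int V\<^sub>a ^ k" "int (ord a) dvd int V\<^sub>a ^ k * int p ^ k"
    using ord_a_dvd int_dvd_int_iff [of "ord a" "p ^ k * V\<^sub>a ^ k"] by (simp_all add: mult.commute)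
  have ob: "int (ord b) dvd int p ^ k * int V\<^sub>b ^ k" "int (ord b) dvd int V\<^sub>b ^ k * int p ^ k"
    using ord_b_dvd int_dvd_int_iff [of "ord b" "p ^ k * V\<^sub>b ^ k"] by (simp_all add: mult.commute)
  have cops: "coprime V\<^sub>a p" "coprime V\<^sub>b p"
    using Va(2) Vb(2) by (simp_all add: coprime_commute)
  have bc: "b \<in> {a, b, c}" "c \<in> {a, b, c}"
    by auto
  note P = split_part [OF p(2) Va(1,2) oa(1) p(3) Vb(1,2) ob(1) intcong [OF r(1)] rV pos(1) s(1) s(1) rs(1)
      split [OF bc(1)] split [OF bc(2)]]
  note Q = split_part [OF Va(1) p(2) cops(1) oa(2) Vb(1) p(3) cops(2) ob(2) intcong [OF sV] s(1) s(1) pos(2) rV rs(2)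
      split' [OF bc(1)] split' [OF bc(2)]]
  have comm: "x [^] int r \<otimes> y [^] int s = y [^] int s \<otimes> x [^] int r"
    if "x \<in> {a, b, c}" "y \<in> {a, b, c}" for x y
  proof -
    have same: "z [^] int r \<otimes> z [^] int s = z [^] int s \<otimes> z [^] int r" if "z \<in> carrier G" for z
      using that by (simp add: int_pow_mult [symmetric] add.commute)
    show ?thesis
      using that P(2-4) Q(2-4) same by auto
  qed
  have orders: "(x [^] int r) [^] (p ^ k) = \<one>" "(x [^] int s) [^] R = \<one>" if x: "x \<in> {a, b, c}" for x
  proof -
    have x1: "x [^] i = \<one>" if "p ^ k * R dvd i" for i
      using closed [OF x] ord_dvd [OF x] that pow_eq_id dvd_trans by blast
    show "(x [^] int r) [^] (p ^ k) = \<one>"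
      using closed [OF x] x1 [of "r * p ^ k"] r(2) by (simp add: int_pow_int nat_pow_pow mult.commute mult_dvd_mono)
    show "(x [^] int s) [^] R = \<one>"
      using closed [OF x] x1 [of "s * R"] s(1) by (simp add: int_pow_int nat_pow_pow mult_dvd_mono)
  qed
  have "\<not> p dvd r"
  proof
    assume "p dvd r"
    have "[r = 1] (mod p)"
      using r(1) by (rule cong_dvd_modulus_nat) (simp add: k_def)
    with \<open>p dvd r\<close> have "p dvd 1"
      by (simp add: cong_dvd_iff)
    then show False
      using p(1) by simp
  qed
  show thesis
  proof (rule that [OF cop P(1) Q(1) \<open>R > 0\<close> \<open>\<not> p dvd r\<close>])
    show "\<forall>x\<in>{a, b, c}. x = x [^] int r \<otimes> x [^] int s"
      using split by (rule ballI)
    show "\<forall>x\<in>{a, b, c}. (x [^] int r) [^] (p ^ k) = \<one>"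
      using orders(1) by (rule ballI)
    show "\<forall>x\<in>{a, b, c}. (x [^] int s) [^] R = \<one>"
      using orders(2) by (rule ballI)
    show "\<forall>x\<in>{a, b, c}. \<forall>y\<in>{a, b, c}. x [^] int r \<otimes> y [^] int s = y [^] int s \<otimes> x [^] int r"
      by (intro ballI comm)
  qed
qed

end

section \<open>Lower bounds\<close>

text \<open>For \<open>h = False\<close> this is the right regular action, in the coordinates \<open>a\<^sup>w b\<^sup>x c\<^sup>y\<close>, of the
  quotient in which \<open>b\<close> and \<open>c\<close> commute and \<open>[a, c] = a\<^sup>e\<close> is central; for \<open>h = True\<close> the roles of the
  generators are exchanged. On triples of integers it satisfies the relators only modulo \<open>act_cong\<close>.\<close>

fun letter_act :: "int \<Rightarrow> bool \<Rightarrow> letter \<Rightarrow> int \<times> int \<times> int \<Rightarrow> int \<times> int \<times> int" where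
  "letter_act e h (g, i) (w, x, y) =
    (if g = h then (if i then (w - 1 + e * (y + x), x, y + x) else (w + 1 - e * y, x, y - x))
     else (w, if i then x - 1 else x + 1, y))"

definition word_act :: "int \<Rightarrow> bool \<Rightarrow> word \<Rightarrow> int \<times> int \<times> int \<Rightarrow> int \<times> int \<times> int" where
  "word_act e h u s = fold (letter_act e h) u s"

text \<open>The first coordinate is finer by the factor e: x and y enter it only through multiples
  of e, so errors modulo q in them become errors modulo \<open>e * q\<close> in w.\<close>

fun act_cong :: "int \<Rightarrow> int \<Rightarrow> int \<times> int \<times> int \<Rightarrow> int \<times> int \<times> int \<Rightarrow> bool" where
  "act_cong e q (w, x, y) (w', x', y') \<longleftrightarrow> e * q dvd w - w' \<and> q dvd x - x' \<and> q dvd y - y'"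

lemma act_cong_refl: "act_cong e q s s"
  by (cases s) simp

lemma act_cong_sym: "act_cong e q s t \<Longrightarrow> act_cong e q t s"
  by (cases s; cases t) (auto simp: dvd_diff_commute)

lemma act_cong_trans:
  assumes "act_cong e q s t" "act_cong e q t u"
  shows "act_cong e q s u"
proof -
  obtain w x y w' x' y' w'' x'' y'' where "s = (w, x, y)" "t = (w', x', y')" "u = (w'', x'', y'')"
    by (metis prod_cases3)
  moreover have "d dvd i - j \<Longrightarrow> d dvd j - k \<Longrightarrow> d dvd i - k" for d i j k :: int
    using dvd_add [of d "i - j" "j - k"] by simp
  ultimately show ?thesis
    using assms by auto
qed

lemma letter_act_cong:
  assumes "act_cong e q s t"
  shows "act_cong e q (letter_act e h l s) (letter_act e h l t)"
proof -
  obtain w x y w' x' y' g i where eqs: "s = (w, x, y)" "t = (w', x', y')" "l = (g, i)"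
    by (metis prod_cases3 surj_pair)
  have d: "e * q dvd w - w'" "q dvd x - x'" "q dvd y - y'"
    using assms by (simp_all add: eqs)
  have e: "e * q dvd e * (y - y')" "e * q dvd e * ((y - y') + (x - x'))"
    using d(3) dvd_add [OF d(3,2)] by simp_all
  show ?thesis
    using d dvd_diff [OF d(1) e(1)] dvd_diff [OF d(3,2)] dvd_add [OF d(1) e(2)] dvd_add [OF d(3,2)]
    by (auto simp: eqs algebra_simps)
qed

lemma word_act_append: "word_act e h (u @ v) s = word_act e h v (word_act e h u s)"
  by (simp add: word_act_def)

lemma word_act_Nil [simp]: "word_act e h [] s = s"
  by (simp add: word_act_def)

lemma word_act_Cons [simp]: "word_act e h (l # u) s = word_act e h u (letter_act e h l s)"
  by (simp add: word_act_def)

lemma word_act_cong: "act_cong e q s t \<Longrightarrow> act_cong e q (word_act e h u s) (word_act e h u t)"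
proof (induction u arbitrary: s t)
  case (Cons l u)
  show ?case
    unfolding word_act_Cons by (rule Cons.IH) (rule letter_act_cong [OF Cons.prems])
qed simp

lemma letter_act_flip: "letter_act e h (flip_letter l) (letter_act e h l s) = s"
  by (cases l; cases s) (simp add: flip_letter_def)

lemma word_act_winv: "word_act e h (winv u) (word_act e h u s) = s"
proof (induction u arbitrary: s)
  case Nil
  show ?case by (simp add: winv_def)
next
  case (Cons l u)
  have "winv (l # u) = winv u @ [flip_letter l]"
    by (simp add: winv_def)
  then show ?case
    using Cons by (simp add: word_act_append letter_act_flip)
qed

text \<open>The binomial coefficient of k over 2 in a form valid for negative k, since generators
  are raised to integer powers.\<close>

definition triangle :: "int \<Rightarrow> int" where
  "triangle k = k * (k - 1) div 2"

lemma two_triangle: "2 * triangle k = k * (k - 1)"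
proof -
  have "even (k * (k - 1))"
    by simp
  then show ?thesis
    unfolding triangle_def by (rule dvd_mult_div_cancel)
qed

lemma triangle_add_one: "triangle (k + 1) = triangle k + k"
  using two_triangle [of k] two_triangle [of "k + 1"] by (simp add: algebra_simps)

text \<open>The k-th power of the action of the generator h. Each application lowers y by x, so the
  values of y met on the way sum to \<open>k * y - triangle k * x\<close>.\<close>

definition unipotent_pow :: "int \<Rightarrow> int \<Rightarrow> int \<times> int \<times> int \<Rightarrow> int \<times> int \<times> int" where
  "unipotent_pow e k s = (case s of (w, x, y) \<Rightarrow> (w + k - e * (k * y - triangle k * x), x, y - k * x))"

lemma replicate_concat_Suc: "concat (replicate (Suc n) w) = concat (replicate n w) @ w"
  by (induction n) simp_all

lemma word_act_wpow:
  assumes step: "\<And>k s. f (k + 1) s = word_act e h u (f k s)" and f0: "\<And>s. f 0 s = s"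
  shows "word_act e h (wpow u k) s = f (k::int) s"
proof -
  have pos: "word_act e h (concat (replicate n u)) s = f (int n) s" for n
  proof (induction n)
    case (Suc n)
    then show ?case
      using step [of "int n"] by (simp only: replicate_concat_Suc word_act_append) (simp add: add.commute)
  qed (simp add: f0)
  have step': "f (k - 1) s = word_act e h (winv u) (f k s)" for k s
    using step [of "k - 1" s] word_act_winv [of e h u "f (k - 1) s"] by simp
  have neg: "word_act e h (concat (replicate n (winv u))) s = f (- int n) s" for n
  proof (induction n)
    case (Suc n)
    have "- int (Suc n) = - int n - 1"
      by simp
    then show ?case
      using Suc step' [of "- int n" s] by (simp only: replicate_concat_Suc word_act_append)
  qed (simp add: f0)
  show ?thesis
    unfolding wpow_def using pos [of "nat k"] neg [of "nat (- k)"] by simp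
qed

abbreviation gen :: "bool \<Rightarrow> word" where "gen g \<equiv> [(g, False)]"

lemma word_act_wpow_unipotent: "word_act e h (wpow (gen h) k) s = unipotent_pow e k s"
proof (rule word_act_wpow)
  fix k s
  show "unipotent_pow e (k + 1) s = word_act e h (gen h) (unipotent_pow e k s)"
    by (cases s) (simp add: unipotent_pow_def triangle_add_one, simp add: algebra_simps)
  show "unipotent_pow e 0 s = s"
    by (cases s) (simp add: unipotent_pow_def triangle_def)
qed

lemma word_act_wpow_shift: "word_act e h (wpow (gen (\<not> h)) k) (w, x, y) = (w, x + k, y)"
proof -
  have "word_act e h (wpow (gen (\<not> h)) k) s = (case s of (w, x, y) \<Rightarrow> (w, x + k, y))" for s
    by (rule word_act_wpow) (auto split: prod.splits)
  then show ?thesis by simp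
qed

lemma word_act_comm:
  "word_act e h (wcomm (gen h) (gen (\<not> h))) (w, x, y) = (w, x, y + 1)"
  "word_act e h (wcomm (gen (\<not> h)) (gen h)) (w, x, y) = (w, x, y - 1)"
  by (simp_all add: wcomm_def winv_def flip_letter_def algebra_simps)

lemma word_act_winv_comm:
  "word_act e h (winv (wcomm (gen h) (gen (\<not> h)))) (w, x, y) = (w, x, y - 1)"
  "word_act e h (winv (wcomm (gen (\<not> h)) (gen h))) (w, x, y) = (w, x, y + 1)"
  using word_act_winv [of e h "wcomm (gen h) (gen (\<not> h))" "(w, x, y - 1)"]
    word_act_winv [of e h "wcomm (gen (\<not> h)) (gen h)" "(w, x, y + 1)"]
  by (simp_all only: word_act_comm) simp_all

lemma word_act_wpow_comm:
  "word_act e h (wpow (wcomm (gen h) (gen (\<not> h))) k) (w, x, y) = (w, x, y + k)"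
  "word_act e h (wpow (wcomm (gen (\<not> h)) (gen h)) k) (w, x, y) = (w, x, y - k)"
proof -
  have "word_act e h (wpow (wcomm (gen h) (gen (\<not> h))) k) s = (case s of (w, x, y) \<Rightarrow> (w, x, y + k))" for s
    by (rule word_act_wpow) (auto split: prod.splits simp: word_act_comm)
  then show "word_act e h (wpow (wcomm (gen h) (gen (\<not> h))) k) (w, x, y) = (w, x, y + k)"
    by simp
  have "word_act e h (wpow (wcomm (gen (\<not> h)) (gen h)) k) s = (case s of (w, x, y) \<Rightarrow> (w, x, y - k))" for s
    by (rule word_act_wpow) (auto split: prod.splits simp: word_act_comm)
  then show "word_act e h (wpow (wcomm (gen (\<not> h)) (gen h)) k) (w, x, y) = (w, x, y - k)"
    by simp
qed

definition relator_word :: "bool \<Rightarrow> int \<Rightarrow> word" where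
  "relator_word g k = wconj (gen g) (wcomm (gen g) (gen (\<not> g))) @ winv (wpow (gen g) k)"

lemma relators_eq: "relators \<alpha> \<beta> = {relator_word False \<alpha>, relator_word True \<beta>}"
  by (simp add: relators_def relator_word_def wA_def wB_def)

text \<open>The two sides of the relation differ in w by
  \<open>e * (e * y - triangle (1 + e) * x)\<close>. Twice \<open>triangle (1 + e)\<close> is
  \<open>(1 + e) * e\<close>, so q divides the triangle because q is odd and divides e.\<close>

lemma word_act_relator_unipotent:
  assumes "q dvd e" "odd q"
  shows "act_cong e q (word_act e h (relator_word h (1 + e)) s) s"
proof -
  obtain w x y where s: "s = (w, x, y)"
    by (metis prod_cases3)
  have conj: "word_act e h (wconj (gen h) (wcomm (gen h) (gen (\<not> h)))) s = (w + 1 - e * (y - 1), x, y - x)"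
    by (simp add: s wconj_def word_act_append word_act_winv_comm word_act_comm)
  have pow: "word_act e h (wpow (gen h) (1 + e)) s
      = (w + (1 + e) - e * ((1 + e) * y - triangle (1 + e) * x), x, y - (1 + e) * x)"
    by (simp add: word_act_wpow_unipotent unipotent_pow_def s)
  have "q dvd 2 * triangle (1 + e)"
    unfolding two_triangle using assms(1) by simp
  moreover have "coprime q 2"
    using assms(2) by (simp add: coprime_right_2_iff_odd)
  ultimately have "q dvd triangle (1 + e)"
    by (simp add: coprime_dvd_mult_right_iff)
  then have "q dvd e * y - triangle (1 + e) * x"
    using assms(1) by simp
  then have "e * q dvd e * (e * y - triangle (1 + e) * x)"
    by simp
  then have "act_cong e q (word_act e h (wconj (gen h) (wcomm (gen h) (gen (\<not> h)))) s)
      (word_act e h (wpow (gen h) (1 + e)) s)"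
    unfolding conj pow using assms(1) by (simp add: algebra_simps)
  then have "act_cong e q (word_act e h (relator_word h (1 + e)) s)
      (word_act e h (winv (wpow (gen h) (1 + e))) (word_act e h (wpow (gen h) (1 + e)) s))"
    unfolding relator_word_def word_act_append by (rule word_act_cong)
  then show ?thesis
    by (simp only: word_act_winv)
qed

lemma word_act_relator_shift:
  assumes "q dvd k - 1"
  shows "act_cong e q (word_act e h (relator_word (\<not> h) k) s) s"
proof -
  obtain w x y where s: "s = (w, x, y)"
    by (metis prod_cases3)
  have conj: "word_act e h (wconj (gen (\<not> h)) (wcomm (gen (\<not> h)) (gen h))) s = (w, x + 1, y)"
    by (simp add: s wconj_def word_act_append word_act_winv_comm word_act_comm)
  have pow: "word_act e h (wpow (gen (\<not> h)) k) s = (w, x + k, y)"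
    by (simp add: word_act_wpow_shift s)
  have "act_cong e q (word_act e h (wconj (gen (\<not> h)) (wcomm (gen (\<not> h)) (gen h))) s)
      (word_act e h (wpow (gen (\<not> h)) k) s)"
    unfolding conj pow using assms by (simp add: dvd_diff_commute)
  then have "act_cong e q (word_act e h (relator_word (\<not> h) k) s)
      (word_act e h (winv (wpow (gen (\<not> h)) k)) (word_act e h (wpow (gen (\<not> h)) k) s))"
    unfolding relator_word_def word_act_append not_not by (rule word_act_cong)
  then show ?thesis
    by (simp only: word_act_winv)
qed

lemma weq_word_act:
  assumes "weq \<alpha> \<beta> u v" "q dvd \<alpha> - 1" "q dvd \<beta> - 1" "odd q" "e = (if h then \<beta> - 1 else \<alpha> - 1)"
  shows "act_cong e q (word_act e h u s) (word_act e h v s)"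
  using assms(1)
proof (induction arbitrary: s rule: weq.induct)
  case (refl w)
  show ?case by (rule act_cong_refl)
next
  case (sym u v)
  show ?case by (rule act_cong_sym) (rule sym.IH)
next
  case (trans u v w)
  show ?case by (rule act_cong_trans) (rule trans.IH)+
next
  case (cancel u l v)
  show ?case by (simp add: word_act_append letter_act_flip act_cong_refl)
next
  case (relator r u v)
  have "q dvd e"
    using assms by simp
  have "act_cong e q (word_act e h r t) t" for t
  proof (cases h)
    case True
    then have "r = relator_word h (1 + e) \<or> r = relator_word (\<not> h) \<alpha>"
      using relator assms(5) by (auto simp: relators_eq)
    then show ?thesis
      using word_act_relator_unipotent [OF \<open>q dvd e\<close> assms(4)] word_act_relator_shift [OF assms(2)] by blast
  next
    case False
    then have "r = relator_word h (1 + e) \<or> r = relator_word (\<not> h) \<beta>"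
      using relator assms(5) by (auto simp: relators_eq)
    then show ?thesis
      using word_act_relator_unipotent [OF \<open>q dvd e\<close> assms(4)] word_act_relator_shift [OF assms(3)] by blast
  qed
  then show ?case
    unfolding word_act_append by (intro word_act_cong)
qed

text \<open>Both actions are applied to the origin. The first reads off i modulo
  \<open>(\<alpha> - 1) * q\<close>, and j and k modulo q. The second then refines j: its mixed
  terms carry the factor \<beta> - 1 and already agree modulo q.\<close>

lemma normal_form_words_distinct:
  assumes "weq \<alpha> \<beta> (wpow wA i @ wpow (wcomm wA wB) k @ wpow wB j) (wpow wA i' @ wpow (wcomm wA wB) k' @ wpow wB j')"
    and q: "q dvd \<alpha> - 1" "q dvd \<beta> - 1" "odd q"
  shows "(\<alpha> - 1) * q dvd i - i'" "q dvd k - k'" "(\<beta> - 1) * q dvd j - j'"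
proof -
  have A: "word_act (\<alpha> - 1) False (wpow wA i @ wpow (wcomm wA wB) k @ wpow wB j) (0, 0, 0) = (i, j, k)" for i k j
    using word_act_wpow_unipotent [of "\<alpha> - 1" False i] word_act_wpow_comm(1) [of "\<alpha> - 1" False k]
      word_act_wpow_shift [of "\<alpha> - 1" False j]
    by (simp add: word_act_append wA_def wB_def unipotent_pow_def)
  have B: "word_act (\<beta> - 1) True (wpow wA i @ wpow (wcomm wA wB) k @ wpow wB j) (0, 0, 0)
      = (j + (\<beta> - 1) * (j * k + triangle j * i), i, - k - j * i)" for i k j
    using word_act_wpow_unipotent [of "\<beta> - 1" True j] word_act_wpow_comm(2) [of "\<beta> - 1" True k]
      word_act_wpow_shift [of "\<beta> - 1" True i]
    by (simp add: word_act_append wA_def wB_def unipotent_pow_def algebra_simps)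
  have "act_cong (\<alpha> - 1) q (i, j, k) (i', j', k')"
    using weq_word_act [OF assms(1) q, of "\<alpha> - 1" False "(0, 0, 0)"] unfolding A by simp
  then show i: "(\<alpha> - 1) * q dvd i - i'" and k: "q dvd k - k'"
    by simp_all
  have j: "q dvd j - j'"
    using \<open>act_cong (\<alpha> - 1) q (i, j, k) (i', j', k')\<close> by simp
  have "(\<beta> - 1) * q dvd (j + (\<beta> - 1) * (j * k + triangle j * i)) - (j' + (\<beta> - 1) * (j' * k' + triangle j' * i'))"
    using weq_word_act [OF assms(1) q, of "\<beta> - 1" True "(0, 0, 0)"] unfolding B by simp
  moreover have "(\<beta> - 1) * q dvd (\<beta> - 1) * ((j * k + triangle j * i) - (j' * k' + triangle j' * i'))"
  proof (rule mult_dvd_mono [OF dvd_refl])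
    have i: "q dvd i - i'"
      using i by (rule dvd_trans [rotated]) simp
    have "2 * (triangle j - triangle j') = (j - j') * (j + j' - 1)"
      using two_triangle [of j] two_triangle [of j'] by (simp add: algebra_simps)
    then have "q dvd 2 * (triangle j - triangle j')"
      using j by simp
    moreover have "coprime q 2"
      using q(3) by (simp add: coprime_right_2_iff_odd)
    ultimately have t: "q dvd triangle j - triangle j'"
      by (simp only: coprime_dvd_mult_right_iff)
    have "(j * k + triangle j * i) - (j' * k' + triangle j' * i')
        = (j - j') * k + j' * (k - k') + (triangle j - triangle j') * i + triangle j' * (i - i')"
      by (simp add: algebra_simps)
    also have "q dvd \<dots>"
      using i j k t by (intro dvd_add) simp_all
    finally show "q dvd (j * k + triangle j * i) - (j' * k' + triangle j' * i')" .
  qed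
  ultimately have "(\<beta> - 1) * q dvd
      ((j + (\<beta> - 1) * (j * k + triangle j * i)) - (j' + (\<beta> - 1) * (j' * k' + triangle j' * i')))
      - (\<beta> - 1) * ((j * k + triangle j * i) - (j' * k' + triangle j' * i'))"
    by (rule dvd_diff)
  then show "(\<beta> - 1) * q dvd j - j'"
    by (simp add: algebra_simps)
qed

section \<open>Nilpotency class\<close>

definition commutator :: "('a, 'b) monoid_scheme \<Rightarrow> 'a \<Rightarrow> 'a \<Rightarrow> 'a" where
  "commutator G x y = monoid.mult G (monoid.mult G (monoid.mult G (m_inv G x) (m_inv G y)) x) y"

lemma comm_subgroup_altdef: "comm_subgroup G S T = generate G {commutator G x y | x y. x \<in> S \<and> y \<in> T}"
  by (simp add: comm_subgroup_def commutator_def)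

lemma commutator_in_comm_subgroup:
  "x \<in> S \<Longrightarrow> y \<in> T \<Longrightarrow> commutator G x y \<in> comm_subgroup G S T"
  unfolding comm_subgroup_altdef by (rule generate.incl) blast

context group
begin

lemma commutator_closed [simp]:
  "x \<in> carrier G \<Longrightarrow> y \<in> carrier G \<Longrightarrow> commutator G x y \<in> carrier G"
  by (simp add: commutator_def)

lemma mult_commutator:
  "x \<in> carrier G \<Longrightarrow> y \<in> carrier G \<Longrightarrow> y \<otimes> x \<otimes> commutator G x y = x \<otimes> y"
proof -
  assume G: "x \<in> carrier G" "y \<in> carrier G"
  have "y \<otimes> x \<otimes> commutator G x y = y \<otimes> (x \<otimes> inv x) \<otimes> inv y \<otimes> x \<otimes> y"
    using G by (simp only: commutator_def m_assoc m_closed inv_closed)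
  then show ?thesis
    using G by simp
qed

lemma commutator_unique:
  assumes "x \<in> carrier G" "y \<in> carrier G" "w \<in> carrier G" "x \<otimes> y = y \<otimes> x \<otimes> w"
  shows "commutator G x y = w"
proof -
  have "y \<otimes> x \<otimes> commutator G x y = y \<otimes> x \<otimes> w"
    using mult_commutator assms by simp
  then show ?thesis
    using assms by (simp add: m_assoc)
qed

lemma comm_subgroup_subset:
  assumes "subgroup N G" "\<And>x y. \<lbrakk>x \<in> S; y \<in> T\<rbrakk> \<Longrightarrow> commutator G x y \<in> N"
  shows "comm_subgroup G S T \<subseteq> N"
  unfolding comm_subgroup_altdef using assms by (intro generate_subgroup_incl) auto

lemma lcs_trivial_Suc:
  assumes "lcs G i = {\<one>}"
  shows "lcs G (Suc i) = {\<one>}"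
proof -
  have "lcs G (Suc i) \<subseteq> {\<one>}"
    using assms by (simp, intro comm_subgroup_subset) (auto simp: triv_subgroup commutator_def)
  moreover have "\<one> \<in> lcs G (Suc i)"
    by (simp add: comm_subgroup_def generate.one)
  ultimately show ?thesis
    by blast
qed

definition centre :: "'a set" where
  "centre = {z \<in> carrier G. \<forall>g\<in>carrier G. z \<otimes> g = g \<otimes> z}"

lemma mem_centreI:
  "\<lbrakk>z \<in> carrier G; \<And>g. g \<in> carrier G \<Longrightarrow> z \<otimes> g = g \<otimes> z\<rbrakk> \<Longrightarrow> z \<in> centre"
  unfolding centre_def by blast

lemma centre_closed: "z \<in> centre \<Longrightarrow> z \<in> carrier G"
  unfolding centre_def by blast

lemma centre_commute: "\<lbrakk>z \<in> centre; g \<in> carrier G\<rbrakk> \<Longrightarrow> z \<otimes> g = g \<otimes> z"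
  unfolding centre_def by blast

lemma centre_subgroup: "subgroup centre G"
proof (rule subgroupI)
  show "centre \<subseteq> carrier G"
    using centre_closed by blast
  show "inv z \<in> centre" if z: "z \<in> centre" for z
  proof (rule mem_centreI)
    fix g assume "g \<in> carrier G"
    then show "inv z \<otimes> g = g \<otimes> inv z"
      using centre_commute [OF z] centre_closed [OF z] by (intro commute_inv [symmetric]) simp_all
  qed (simp add: centre_closed [OF z])
  show "y \<otimes> z \<in> centre" if y: "y \<in> centre" and z: "z \<in> centre" for y z
  proof (rule mem_centreI)
    fix g assume "g \<in> carrier G"
    then show "(y \<otimes> z) \<otimes> g = g \<otimes> (y \<otimes> z)"
      by (intro commute_mult centre_closed [OF y] centre_closed [OF z] centre_commute [OF y] centre_commute [OF z])
  qed (simp add: centre_closed [OF y] centre_closed [OF z])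
  have "\<one> \<in> centre"
    by (rule mem_centreI) simp_all
  then show "centre \<noteq> {}"
    by blast
qed

lemma centre_normal: "centre \<lhd> G"
  unfolding normal_inv_iff
proof (intro conjI ballI)
  fix x h assume x: "x \<in> carrier G" and h: "h \<in> centre"
  then have "x \<otimes> h \<otimes> inv x = h"
    using centre_commute [OF h x, symmetric] centre_closed [OF h] by (simp add: m_assoc)
  with h show "x \<otimes> h \<otimes> inv x \<in> centre"
    by simp
qed (rule centre_subgroup)

end

context macdonald
begin

lemma hom_image:
  assumes "group_hom G K h"
  shows "macdonald K (h a) (h b) (h c) \<alpha> \<beta>"
proof -
  interpret h: group_hom G K h
    by (rule assms)
  show ?thesis
  proof
    show "h a \<otimes>\<^bsub>K\<^esub> h b = h b \<otimes>\<^bsub>K\<^esub> h a \<otimes>\<^bsub>K\<^esub> h c"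
      using arg_cong [OF ab, of h] by simp
    show "h a \<otimes>\<^bsub>K\<^esub> h c = h c \<otimes>\<^bsub>K\<^esub> h a [^]\<^bsub>K\<^esub> \<alpha>"
      using arg_cong [OF ac, of h] by (simp add: h.hom_int_pow)
    show "h c \<otimes>\<^bsub>K\<^esub> h b = h b [^]\<^bsub>K\<^esub> \<beta> \<otimes>\<^bsub>K\<^esub> h c"
      using arg_cong [OF cb, of h] by (simp add: h.hom_int_pow)
  qed simp_all
qed

text \<open>Here c commutes with both generators, and exchanging powers of b and a costs a power of
  c bilinear in the exponents, as in a Heisenberg group.\<close>

lemma class_two_commute:
  assumes "a [^] (\<alpha> - 1) = \<one>" "b [^] (\<beta> - 1) = \<one>"
  shows "a \<otimes> c = c \<otimes> a" "b \<otimes> c = c \<otimes> b"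
    and "b [^] (j::int) \<otimes> a [^] (i::int) = a [^] i \<otimes> b [^] j \<otimes> c [^] (- (i * j))"
proof -
  have "a [^] \<alpha> = a" "b [^] \<beta> = b"
    using int_pow_mult [of a "\<alpha> - 1" 1] int_pow_mult [of b "\<beta> - 1" 1] assms by simp_all
  then show ca: "a \<otimes> c = c \<otimes> a" and cb': "b \<otimes> c = c \<otimes> b"
    using ac cb by simp_all
  have 1: "b \<otimes> a = a \<otimes> (b \<otimes> inv c)"
    using macdonald.ab [OF swapped] by (simp add: m_assoc)
  have "b [^] j \<otimes> a = a \<otimes> (b \<otimes> inv c) [^] j"
    by (rule intertwine_int_pow [OF _ _ _ 1]) simp_all
  also have "(b \<otimes> inv c) [^] j = b [^] j \<otimes> c [^] (- j)"
    using commute_inv [OF b_closed c_closed cb'] int_pow_mult_distrib [of b "inv c" j]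
    by (simp add: int_pow_inv int_pow_neg)
  finally have 2: "b [^] j \<otimes> a = a \<otimes> b [^] j \<otimes> c [^] (- j)"
    by (simp add: m_assoc)
  have "inv (b [^] j) \<otimes> a \<otimes> b [^] j = a \<otimes> c [^] j"
  proof -
    have "a \<otimes> b [^] j = b [^] j \<otimes> (a \<otimes> c [^] j)"
    proof -
      have "a \<otimes> b [^] j = a \<otimes> b [^] j \<otimes> (c [^] (- j) \<otimes> c [^] j)"
        by (simp add: int_pow_mult [symmetric])
      also have "\<dots> = (b [^] j \<otimes> a) \<otimes> c [^] j"
        unfolding 2 by (simp add: m_assoc)
      finally show ?thesis
        by (simp add: m_assoc)
    qed
    then show ?thesis
      by (simp add: m_assoc) (simp add: m_assoc [symmetric])
  qed
  then have 3: "a \<otimes> b [^] j = b [^] j \<otimes> (a \<otimes> c [^] j)"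
    by (metis a_closed b_closed c_closed int_pow_closed inv_closed inv_inv inv_solve_left m_assoc m_closed)
  have "a [^] i \<otimes> b [^] j = b [^] j \<otimes> (a \<otimes> c [^] j) [^] i"
    by (rule intertwine_int_pow [OF _ _ _ 3]) simp_all
  also have "(a \<otimes> c [^] j) [^] i = a [^] i \<otimes> c [^] (i * j)"
    using commute_int_pow [of c a j] ca int_pow_mult_distrib [of a "c [^] j" i]
    by (simp add: int_pow_pow mult.commute)
  finally have "a [^] i \<otimes> b [^] j \<otimes> c [^] (- (i * j)) = b [^] j \<otimes> a [^] i \<otimes> (c [^] (i * j) \<otimes> c [^] (- (i * j)))"
    by (simp add: m_assoc)
  then show "b [^] j \<otimes> a [^] i = a [^] i \<otimes> b [^] j \<otimes> c [^] (- (i * j))"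
    by (simp add: int_pow_mult [symmetric])
qed

text \<open>Collecting exponents gives the commutator as c raised to the determinant of the
  exponents of a and b in the two normal forms.\<close>

lemma class_two_commutator:
  assumes triv: "a [^] (\<alpha> - 1) = \<one>" "b [^] (\<beta> - 1) = \<one>"
    and x: "x \<in> normal_forms" and y: "y \<in> normal_forms"
  shows "\<exists>l::int. commutator G x y = c [^] l" "x \<otimes> c = c \<otimes> x"
proof -
  note comm = class_two_commute [OF triv]
  obtain i k j :: int where x: "x = a [^] i \<otimes> c [^] k \<otimes> b [^] j"
    using x unfolding normal_forms_def by blast
  obtain i' k' j' :: int where y: "y = a [^] i' \<otimes> c [^] k' \<otimes> b [^] j'"
    using y unfolding normal_forms_def by blast
  have ca: "c [^] l \<otimes> (a [^] (i::int) \<otimes> u) = a [^] i \<otimes> (c [^] l \<otimes> u)"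
    and cb: "c [^] l \<otimes> (b [^] (i::int) \<otimes> u) = b [^] i \<otimes> (c [^] l \<otimes> u)" if "u \<in> carrier G" for l i :: int and u
    using commute_int_pow2 [OF a_closed c_closed comm(1), of i l] commute_int_pow2 [OF b_closed c_closed comm(2), of i l] that
    by (simp_all add: m_assoc [symmetric])
  have cb0: "c [^] l \<otimes> b [^] (i::int) = b [^] i \<otimes> c [^] l" for l i :: int
    using commute_int_pow2 [OF b_closed c_closed comm(2), of i l] by simp
  have ba: "b [^] (j::int) \<otimes> (a [^] (i::int) \<otimes> u) = a [^] i \<otimes> (b [^] j \<otimes> (c [^] (- (i * j)) \<otimes> u))"
    if "u \<in> carrier G" for i j u
    using comm(3) [of j i] that by (simp add: m_assoc [symmetric])
  have prod: "a [^] i \<otimes> c [^] k \<otimes> b [^] j \<otimes> (a [^] i' \<otimes> c [^] k' \<otimes> b [^] j')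
      = a [^] (i + i') \<otimes> (b [^] (j + j') \<otimes> c [^] (k + k' - i' * j))" for i k j i' k' j' :: int
    by (simp add: m_assoc ba ca cb cb0 int_pow_add_left int_pow_mult [symmetric] algebra_simps)
  have "x \<otimes> y = y \<otimes> x \<otimes> c [^] (i * j' - i' * j)"
    unfolding x y prod by (simp add: m_assoc int_pow_mult [symmetric] algebra_simps)
  then have "commutator G x y = c [^] (i * j' - i' * j)"
    by (intro commutator_unique) (simp_all add: x y)
  then show "\<exists>l::int. commutator G x y = c [^] l"
    by blast
  show "x \<otimes> c = c \<otimes> x"
    unfolding x using comm(1,2) by (intro commute_mult commute_int_pow) simp_all
qed

lemma centreI:
  assumes "carrier G \<subseteq> normal_forms" "z \<in> carrier G" "z \<otimes> a = a \<otimes> z" "z \<otimes> b = b \<otimes> z"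
  shows "z \<in> centre"
proof -
  have zc: "z \<otimes> c = c \<otimes> z"
    using assms by (intro commutes_c)
  have "z \<otimes> g = g \<otimes> z" if g: "g \<in> carrier G" for g
  proof -
    obtain i k j :: int where x: "g = a [^] i \<otimes> c [^] k \<otimes> b [^] j"
      using g assms(1) unfolding normal_forms_def by blast
    have "g \<otimes> z = z \<otimes> g"
      unfolding x using assms(2-4) zc by (intro commute_mult commute_int_pow) simp_all
    then show ?thesis
      by (rule HOL.sym)
  qed
  then show ?thesis
    using assms(2) by (intro mem_centreI)
qed

text \<open>The quotient by the centre enters as a homomorphism with that kernel, so that
  \<open>class_two_commutator\<close> applies to the image without computing with cosets. W, the
  preimage of the powers of c, contains the commutator subgroup, and commutators with elements of W
  are central. Indices of \<open>lcs\<close> start at 0, so class 3 means that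
  \<open>lcs G 3\<close> is trivial and \<open>lcs G 2\<close> is not.\<close>

lemma nilpotency_class_three_quotient:
  assumes nf: "carrier G \<subseteq> normal_forms"
    and za: "a [^] (\<alpha> - 1) \<otimes> b = b \<otimes> a [^] (\<alpha> - 1)" "a [^] (\<alpha> - 1) \<noteq> \<one>"
    and zb: "b [^] (\<beta> - 1) \<otimes> a = a \<otimes> b [^] (\<beta> - 1)"
    and hom: "group_hom G K \<pi>"
    and kernel: "\<And>x. x \<in> carrier G \<Longrightarrow> \<pi> x = \<one>\<^bsub>K\<^esub> \<longleftrightarrow> x \<in> centre"
  shows "nilpotency_class_eq G 3"
proof -
  interpret Q: macdonald K "\<pi> a" "\<pi> b" "\<pi> c" \<alpha> \<beta>
    by (rule hom_image [OF hom])
  interpret \<pi>: group_hom G K \<pi>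
    by (rule hom)
  have "a [^] (\<alpha> - 1) \<in> centre" "b [^] (\<beta> - 1) \<in> centre"
    using za(1) zb by (auto intro!: centreI [OF nf] commute_int_pow)
  then have triv: "\<pi> a [^]\<^bsub>K\<^esub> (\<alpha> - 1) = \<one>\<^bsub>K\<^esub>"
      "\<pi> b [^]\<^bsub>K\<^esub> (\<beta> - 1) = \<one>\<^bsub>K\<^esub>"
    by (simp_all add: \<pi>.hom_int_pow [symmetric] kernel)
  have nfQ: "\<pi> x \<in> Q.normal_forms" if x: "x \<in> carrier G" for x
  proof -
    obtain i k j :: int where "x = a [^] i \<otimes> c [^] k \<otimes> b [^] j"
      using x nf unfolding normal_forms_def by blast
    then show ?thesis
      by (simp add: \<pi>.hom_int_pow Q.normal_formsI)
  qed
  have hom_comm: "\<pi> (commutator G x y) = commutator K (\<pi> x) (\<pi> y)"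
    if "x \<in> carrier G" "y \<in> carrier G" for x y
    using that by (simp add: commutator_def)
  define W where "W = {w \<in> carrier G. \<exists>l::int. \<pi> w = \<pi> c [^]\<^bsub>K\<^esub> l}"
  have "subgroup W G"
  proof (rule subgroupI)
    have "\<pi> \<one> = \<pi> c [^]\<^bsub>K\<^esub> (0::int)"
      by simp
    then have "\<one> \<in> W"
      unfolding W_def by blast
    then show "W \<noteq> {}"
      by blast
    show "inv w \<in> W" if w: "w \<in> W" for w
    proof -
      obtain l :: int where "w \<in> carrier G" "\<pi> w = \<pi> c [^]\<^bsub>K\<^esub> l"
        using w unfolding W_def by blast
      then have "\<pi> (inv w) = \<pi> c [^]\<^bsub>K\<^esub> (- l)"
        by (simp add: Q.int_pow_neg)
      with \<open>w \<in> carrier G\<close> show ?thesis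
        unfolding W_def by blast
    qed
    show "v \<otimes> w \<in> W" if vw: "v \<in> W" "w \<in> W" for v w
    proof -
      obtain k l :: int where "v \<in> carrier G" "w \<in> carrier G"
          "\<pi> v = \<pi> c [^]\<^bsub>K\<^esub> k" "\<pi> w = \<pi> c [^]\<^bsub>K\<^esub> l"
        using vw unfolding W_def by blast
      then have "\<pi> (v \<otimes> w) = \<pi> c [^]\<^bsub>K\<^esub> (k + l)"
        by (simp add: Q.int_pow_mult)
      with \<open>v \<in> carrier G\<close> \<open>w \<in> carrier G\<close> show ?thesis
        unfolding W_def by blast
    qed
  qed (auto simp: W_def)
  have 1: "lcs G 1 \<subseteq> W"
  proof -
    have "commutator G x y \<in> W" if "x \<in> carrier G" "y \<in> carrier G" for x y
      using that Q.class_two_commutator(1) [OF triv nfQ nfQ] hom_comm unfolding W_def by auto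
    then show ?thesis
      using \<open>subgroup W G\<close> by (simp, intro comm_subgroup_subset) auto
  qed
  have 2: "lcs G 2 \<subseteq> centre"
  proof -
    have "commutator G w y \<in> centre" if w: "w \<in> W" and y: "y \<in> carrier G" for w y
    proof -
      obtain l :: int where l: "w \<in> carrier G" "\<pi> w = \<pi> c [^]\<^bsub>K\<^esub> l"
        using w unfolding W_def by blast
      have "\<pi> y \<otimes>\<^bsub>K\<^esub> \<pi> c = \<pi> c \<otimes>\<^bsub>K\<^esub> \<pi> y"
        by (rule Q.class_two_commutator(2) [OF triv nfQ [OF y] nfQ [OF y]])
      then have "\<pi> w \<otimes>\<^bsub>K\<^esub> \<pi> y = \<pi> y \<otimes>\<^bsub>K\<^esub> \<pi> w"
        unfolding l(2) using y by (intro Q.commute_int_pow) simp_all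
      then have "commutator K (\<pi> w) (\<pi> y) = \<one>\<^bsub>K\<^esub>"
        using l(1) y by (intro Q.commutator_unique) simp_all
      then show ?thesis
        using l(1) y kernel [of "commutator G w y"] hom_comm [of w y] by simp
    qed
    then show ?thesis
      using 1 centre_subgroup by (simp add: numeral_2_eq_2, intro comm_subgroup_subset) auto
  qed
  have "lcs G 3 = {\<one>}"
  proof -
    have "commutator G z y = \<one>" if "z \<in> centre" "y \<in> carrier G" for z y
      using that centre_closed centre_commute by (intro commutator_unique) simp_all
    then have "lcs G 3 \<subseteq> {\<one>}"
      using 2 triv_subgroup by (simp add: numeral_3_eq_3 numeral_2_eq_2, intro comm_subgroup_subset) auto
    moreover have "\<one> \<in> lcs G 3"
      by (simp add: numeral_3_eq_3 comm_subgroup_def generate.one)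
    ultimately show ?thesis
      by blast
  qed
  \<comment> \<open>The commutator of c and a lies in this term; if it were trivial, c would commute
    with a and \<open>a^\<alpha>\<close> would equal a.\<close>
  moreover have ne2: "lcs G 2 \<noteq> {\<one>}"
  proof
    assume "lcs G 2 = {\<one>}"
    have "commutator G a b = c"
      by (rule commutator_unique) (simp_all add: ab)
    then have "c \<in> lcs G 1"
      using commutator_in_comm_subgroup [of a "carrier G" b "carrier G" G] by simp
    then have "commutator G c a \<in> lcs G 2"
      by (simp add: numeral_2_eq_2 commutator_in_comm_subgroup)
    then have "commutator G c a = \<one>"
      using \<open>lcs G 2 = {\<one>}\<close> by blast
    then have "c \<otimes> a = a \<otimes> c"
      using mult_commutator [of c a] by simp
    then have "c \<otimes> a [^] \<alpha> = c \<otimes> a"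
      using ac by simp
    then have "a [^] \<alpha> = a"
      by simp
    then show False
      using za(2) by (simp add: int_pow_diff)
  qed
  \<comment> \<open>A trivial term makes all later ones trivial, in particular the one with index
    2.\<close>
  moreover have "lcs G i \<noteq> {\<one>}" if "i < 3" for i
  proof
    assume triv: "lcs G i = {\<one>}"
    have "lcs G (i + j) = {\<one>}" for j
      by (induction j) (use triv lcs_trivial_Suc in simp_all)
    from this [of "2 - i"] show False
      using ne2 that by simp
  qed
  ultimately show ?thesis
    unfolding nilpotency_class_eq_def by blast
qed

lemma nilpotency_class_three:
  assumes "carrier G \<subseteq> normal_forms"
    and "a [^] (\<alpha> - 1) \<otimes> b = b \<otimes> a [^] (\<alpha> - 1)" "a [^] (\<alpha> - 1) \<noteq> \<one>"
    and "b [^] (\<beta> - 1) \<otimes> a = a \<otimes> b [^] (\<beta> - 1)"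
  shows "nilpotency_class_eq G 3"
proof (rule nilpotency_class_three_quotient [OF assms])
  interpret Z: normal centre G
    by (rule centre_normal)
  show "group_hom G (G Mod centre) (\<lambda>x. centre #> x)"
    unfolding group_hom_def group_hom_axioms_def
    using Z.r_coset_hom_Mod Z.factorgroup_is_group is_group by blast
  show "centre #> x = \<one>\<^bsub>G Mod centre\<^esub> \<longleftrightarrow> x \<in> centre" if "x \<in> carrier G" for x
    using coset_join1 [OF _ that centre_subgroup] coset_join2 [OF that centre_subgroup]
    by (auto simp: FactGroup_def)
qed

end

section \<open>The finitely presented group\<close>

lemma flip_flip_letter [simp]: "flip_letter (flip_letter l) = l"
  by (simp add: flip_letter_def)

lemma weq_append_left: "weq \<alpha> \<beta> u v \<Longrightarrow> weq \<alpha> \<beta> (w @ u) (w @ v)"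
proof (induction rule: weq.induct)
  case (cancel u l v)
  then show ?case using weq.cancel [of \<alpha> \<beta> "w @ u" l v] by simp
next
  case (relator r u v)
  then show ?case using weq.relator [of r \<alpha> \<beta> "w @ u" v] by simp
qed (auto intro: weq.intros)

lemma weq_append_right: "weq \<alpha> \<beta> u v \<Longrightarrow> weq \<alpha> \<beta> (u @ w) (v @ w)"
proof (induction rule: weq.induct)
  case (cancel u l v)
  then show ?case using weq.cancel [of \<alpha> \<beta> u l "v @ w"] by simp
next
  case (relator r u v)
  then show ?case using weq.relator [of r \<alpha> \<beta> u "v @ w"] by simp
qed (auto intro: weq.intros)

lemma weq_append: "weq \<alpha> \<beta> u u' \<Longrightarrow> weq \<alpha> \<beta> v v' \<Longrightarrow> weq \<alpha> \<beta> (u @ v) (u' @ v')"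
  using weq_append_left weq_append_right weq.trans by blast

lemma weq_winv_left: "weq \<alpha> \<beta> (winv u @ u) []"
proof (induction u)
  case Nil
  show ?case by (simp add: winv_def weq.refl)
next
  case (Cons l u)
  have "winv (l # u) @ l # u = winv u @ [flip_letter l, flip_letter (flip_letter l)] @ u"
    by (simp add: winv_def)
  then have "weq \<alpha> \<beta> (winv (l # u) @ l # u) (winv u @ u)"
    using weq.cancel [of \<alpha> \<beta> "winv u" "flip_letter l" u] by simp
  then show ?case
    using Cons weq.trans by blast
qed

lemma wclass_eq_iff: "wclass \<alpha> \<beta> u = wclass \<alpha> \<beta> v \<longleftrightarrow> weq \<alpha> \<beta> u v"
  unfolding wclass_def using weq.refl weq.sym weq.trans by blast

lemma wmult_wclass: "wmult \<alpha> \<beta> (wclass \<alpha> \<beta> u) (wclass \<alpha> \<beta> v) = wclass \<alpha> \<beta> (u @ v)"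
proof -
  have "weq \<alpha> \<beta> w (u @ v)" if "weq \<alpha> \<beta> x u" "weq \<alpha> \<beta> y v" "weq \<alpha> \<beta> w (x @ y)" for w x y
    using that weq_append weq.trans by blast
  moreover have "\<exists>x y. weq \<alpha> \<beta> x u \<and> weq \<alpha> \<beta> y v \<and> weq \<alpha> \<beta> w (x @ y)" if "weq \<alpha> \<beta> w (u @ v)" for w
    using that weq.refl by blast
  ultimately show ?thesis
    unfolding wmult_def wclass_def by blast
qed

lemma group_Gab: "group (Gab \<alpha> \<beta>)"
proof (rule groupI)
  fix x assume "x \<in> carrier (Gab \<alpha> \<beta>)"
  then obtain u where u: "x = wclass \<alpha> \<beta> u"
    by (auto simp: Gab_def)
  have "wclass \<alpha> \<beta> (winv u) \<in> carrier (Gab \<alpha> \<beta>)"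
    by (simp add: Gab_def)
  moreover have "wclass \<alpha> \<beta> (winv u) \<otimes>\<^bsub>Gab \<alpha> \<beta>\<^esub> x = \<one>\<^bsub>Gab \<alpha> \<beta>\<^esub>"
    by (simp add: Gab_def u wmult_wclass wclass_eq_iff weq_winv_left)
  ultimately show "\<exists>y\<in>carrier (Gab \<alpha> \<beta>). y \<otimes>\<^bsub>Gab \<alpha> \<beta>\<^esub> x = \<one>\<^bsub>Gab \<alpha> \<beta>\<^esub>"
    by blast
qed (auto simp: Gab_def wmult_wclass)

interpretation Gab: group "Gab \<alpha> \<beta>" for \<alpha> \<beta>
  by (rule group_Gab)

lemma carrier_Gab: "carrier (Gab \<alpha> \<beta>) = range (wclass \<alpha> \<beta>)"
  by (simp add: Gab_def)

lemma mult_Gab: "wclass \<alpha> \<beta> u \<otimes>\<^bsub>Gab \<alpha> \<beta>\<^esub> wclass \<alpha> \<beta> v = wclass \<alpha> \<beta> (u @ v)"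
  by (simp add: Gab_def wmult_wclass)

lemma one_Gab: "\<one>\<^bsub>Gab \<alpha> \<beta>\<^esub> = wclass \<alpha> \<beta> []"
  by (simp add: Gab_def)

lemma wclass_closed [simp]: "wclass \<alpha> \<beta> u \<in> carrier (Gab \<alpha> \<beta>)"
  by (simp add: carrier_Gab)

lemma inv_Gab: "inv\<^bsub>Gab \<alpha> \<beta>\<^esub> (wclass \<alpha> \<beta> u) = wclass \<alpha> \<beta> (winv u)"
  by (rule Gab.inv_equality) (simp_all add: mult_Gab one_Gab wclass_eq_iff weq_winv_left)

lemma nat_pow_Gab: "wclass \<alpha> \<beta> u [^]\<^bsub>Gab \<alpha> \<beta>\<^esub> (n::nat) = wclass \<alpha> \<beta> (concat (replicate n u))"
proof (induction n)
  case (Suc n)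
  then show ?case
    by (simp only: Gab.nat_pow_Suc mult_Gab replicate_concat_Suc)
qed (simp add: one_Gab)

lemma int_pow_Gab: "wclass \<alpha> \<beta> u [^]\<^bsub>Gab \<alpha> \<beta>\<^esub> (k::int) = wclass \<alpha> \<beta> (wpow u k)"
proof (cases "0 \<le> k")
  case True
  then have "wclass \<alpha> \<beta> u [^]\<^bsub>Gab \<alpha> \<beta>\<^esub> k = wclass \<alpha> \<beta> u [^]\<^bsub>Gab \<alpha> \<beta>\<^esub> nat k"
    using int_pow_int [of "Gab \<alpha> \<beta>" "wclass \<alpha> \<beta> u" "nat k"] by simp
  then show ?thesis
    using True by (simp add: nat_pow_Gab wpow_def)
next
  case False
  define n where "n = nat (- k)"
  have k: "k = - int n"
    using False by (simp add: n_def)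
  have "wclass \<alpha> \<beta> u [^]\<^bsub>Gab \<alpha> \<beta>\<^esub> k = (inv\<^bsub>Gab \<alpha> \<beta>\<^esub> (wclass \<alpha> \<beta> u)) [^]\<^bsub>Gab \<alpha> \<beta>\<^esub> n"
    by (simp only: k Gab.int_pow_neg_int Gab.nat_pow_inv wclass_closed)
  also have "\<dots> = wclass \<alpha> \<beta> (concat (replicate n (winv u)))"
    by (simp only: inv_Gab nat_pow_Gab)
  finally show ?thesis
    using False by (simp add: wpow_def n_def)
qed

lemma (in group) macdonald_of_relators:
  assumes G: "a \<in> carrier G" "b \<in> carrier G"
    and c: "c = inv a \<otimes> (inv b \<otimes> (a \<otimes> b))"
    and rel_a: "inv c \<otimes> (a \<otimes> c) \<otimes> inv (a [^] \<alpha>) = \<one>"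
    and rel_b: "c \<otimes> (b \<otimes> inv c) \<otimes> inv (b [^] \<beta>) = \<one>"
  shows "macdonald G a b c \<alpha> \<beta>"
proof
  show cG: "c \<in> carrier G"
    using G by (simp add: c)
  have "inv (inv (a [^] \<alpha>)) = inv c \<otimes> (a \<otimes> c)"
    using rel_a by (rule inv_equality) (use G cG in simp_all)
  then have "c \<otimes> a [^] \<alpha> = c \<otimes> (inv c \<otimes> (a \<otimes> c))"
    using G by simp
  then show "a \<otimes> c = c \<otimes> a [^] \<alpha>"
    using G cG by (simp add: m_assoc [symmetric])
  have "inv (inv (b [^] \<beta>)) = c \<otimes> (b \<otimes> inv c)"
    using rel_b by (rule inv_equality) (use G cG in simp_all)
  then have "b [^] \<beta> \<otimes> c = c \<otimes> (b \<otimes> inv c) \<otimes> c"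
    using G by simp
  then show "c \<otimes> b = b [^] \<beta> \<otimes> c"
    using G cG by (simp add: m_assoc)
  have "b \<otimes> a \<otimes> c = b \<otimes> (a \<otimes> inv a) \<otimes> inv b \<otimes> (a \<otimes> b)"
    unfolding c using G by (simp only: m_assoc m_closed inv_closed)
  then show "a \<otimes> b = b \<otimes> a \<otimes> c"
    using G by simp
qed (rule G)+

lemma macdonald_Gab: "macdonald (Gab \<alpha> \<beta>) (genA \<alpha> \<beta>) (genB \<alpha> \<beta>) (genC \<alpha> \<beta>) \<alpha> \<beta>"
proof (rule Gab.macdonald_of_relators)
  have rel: "wclass \<alpha> \<beta> r = wclass \<alpha> \<beta> []" if "r \<in> relators \<alpha> \<beta>" for r
    using weq.relator [OF that, of "[]" "[]"] by (simp add: wclass_eq_iff)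
  have winv: "winv (wcomm wA wB) = wcomm wB wA" "winv (wcomm wB wA) = wcomm wA wB"
    by (simp_all add: wcomm_def winv_def wA_def wB_def flip_letter_def)
  have "wconj wA (wcomm wA wB) @ winv (wpow wA \<alpha>) \<in> relators \<alpha> \<beta>"
    "wconj wB (wcomm wB wA) @ winv (wpow wB \<beta>) \<in> relators \<alpha> \<beta>"
    by (simp_all add: relators_def)
  note rels = this [THEN rel, unfolded wconj_def winv]
  let ?G = "Gab \<alpha> \<beta>" and ?a = "genA \<alpha> \<beta>" and ?b = "genB \<alpha> \<beta>" and ?c = "genC \<alpha> \<beta>"
  show "inv\<^bsub>?G\<^esub> ?c \<otimes>\<^bsub>?G\<^esub> (?a \<otimes>\<^bsub>?G\<^esub> ?c) \<otimes>\<^bsub>?G\<^esub> inv\<^bsub>?G\<^esub> (?a [^]\<^bsub>?G\<^esub> \<alpha>) = \<one>\<^bsub>?G\<^esub>"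
    "?c \<otimes>\<^bsub>?G\<^esub> (?b \<otimes>\<^bsub>?G\<^esub> inv\<^bsub>?G\<^esub> ?c) \<otimes>\<^bsub>?G\<^esub> inv\<^bsub>?G\<^esub> (?b [^]\<^bsub>?G\<^esub> \<beta>) = \<one>\<^bsub>?G\<^esub>"
    using rels by (simp_all add: genA_def genB_def genC_def int_pow_Gab inv_Gab mult_Gab one_Gab winv)
qed (simp_all add: genA_def genB_def genC_def inv_Gab mult_Gab wcomm_def)

lemma (in macdonald) finite_macdonald:
  assumes "\<alpha> \<noteq> 1" "\<beta> \<noteq> 1"
  shows "finite_macdonald G a b c \<alpha> \<beta>"
proof -
  have a: "ord a > 0"
    using macdonald.ord_b_pos [OF swapped] assms by blast
  have "c [^] (int (ord a) * int (ord a)) = \<one>"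
    using cpow_trivial [OF a] by (simp add: int_pow_int)
  then have "int (ord c) dvd int (ord a) * int (ord a)"
    by (simp add: int_pow_eq_id)
  then have "ord c > 0"
    using a by (cases "ord c = 0") auto
  then show ?thesis
    using a ord_b_pos assms by unfold_locales simp_all
qed

text \<open>Normal forms contain the identity and are stable under right multiplication by letters,
  so induction on the last letter reaches the class of every word.\<close>

lemma carrier_Gab_normal_forms:
  assumes "\<alpha> \<noteq> 1" "\<beta> \<noteq> 1"
  shows "carrier (Gab \<alpha> \<beta>) = macdonald.normal_forms (Gab \<alpha> \<beta>) (genA \<alpha> \<beta>) (genB \<alpha> \<beta>) (genC \<alpha> \<beta>)"
proof -
  interpret M: finite_macdonald "Gab \<alpha> \<beta>" "genA \<alpha> \<beta>" "genB \<alpha> \<beta>" "genC \<alpha> \<beta>" \<alpha> \<beta>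
    by (rule macdonald.finite_macdonald [OF macdonald_Gab assms])
  have "wclass \<alpha> \<beta> u \<in> M.normal_forms" for u
  proof (induction u rule: rev_induct)
    case Nil
    then show ?case
      using M.normal_forms_one by (simp add: one_Gab)
  next
    case (snoc l u)
    have neg1: "wpow [x] (- 1) = [flip_letter x]" "wpow [x] 1 = [x]" for x
      by (simp_all add: wpow_def winv_def)
    obtain g i where l: "l = (g, i)"
      by fastforce
    define e :: int where "e = (if i then - 1 else 1)"
    have "wclass \<alpha> \<beta> [l] = (if g then genB \<alpha> \<beta> else genA \<alpha> \<beta>) [^]\<^bsub>Gab \<alpha> \<beta>\<^esub> e"
      by (simp add: l e_def genA_def genB_def int_pow_Gab wA_def wB_def neg1 flip_letter_def)
    then have "wclass \<alpha> \<beta> (u @ [l]) = wclass \<alpha> \<beta> u \<otimes>\<^bsub>Gab \<alpha> \<beta>\<^esub> (if g then genB \<alpha> \<beta> else genA \<alpha> \<beta>) [^]\<^bsub>Gab \<alpha> \<beta>\<^esub> e"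
      by (simp add: mult_Gab [symmetric])
    then show ?case
      using M.normal_forms_mult_a [OF snoc, of e] M.normal_forms_mult_b [OF snoc, of e] by simp
  qed
  then show ?thesis
    using M.normal_forms_subset by (auto simp: carrier_Gab)
qed

lemma Gab_normal_forms_distinct:
  assumes "genA \<alpha> \<beta> [^]\<^bsub>Gab \<alpha> \<beta>\<^esub> (i::int) \<otimes>\<^bsub>Gab \<alpha> \<beta>\<^esub> genC \<alpha> \<beta> [^]\<^bsub>Gab \<alpha> \<beta>\<^esub> (k::int) \<otimes>\<^bsub>Gab \<alpha> \<beta>\<^esub> genB \<alpha> \<beta> [^]\<^bsub>Gab \<alpha> \<beta>\<^esub> (j::int)
      = genA \<alpha> \<beta> [^]\<^bsub>Gab \<alpha> \<beta>\<^esub> (i'::int) \<otimes>\<^bsub>Gab \<alpha> \<beta>\<^esub> genC \<alpha> \<beta> [^]\<^bsub>Gab \<alpha> \<beta>\<^esub> (k'::int) \<otimes>\<^bsub>Gab \<alpha> \<beta>\<^esub> genB \<alpha> \<beta> [^]\<^bsub>Gab \<alpha> \<beta>\<^esub> (j'::int)"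
    and "q dvd \<alpha> - 1" "q dvd \<beta> - 1" "odd q"
  shows "(\<alpha> - 1) * q dvd i - i'" "q dvd k - k'" "(\<beta> - 1) * q dvd j - j'"
proof -
  have "weq \<alpha> \<beta> (wpow wA i @ wpow (wcomm wA wB) k @ wpow wB j) (wpow wA i' @ wpow (wcomm wA wB) k' @ wpow wB j')"
    using assms(1) by (simp add: genA_def genB_def genC_def int_pow_Gab mult_Gab wclass_eq_iff)
  from normal_form_words_distinct [OF this assms(2-4)]
  show "(\<alpha> - 1) * q dvd i - i'" "q dvd k - k'" "(\<beta> - 1) * q dvd j - j'" .
qed

section \<open>The p-elements, their number and their class\<close>

context group
begin

lemma ord_eqI:
  assumes "x \<in> carrier G" "x [^] int N = \<one>" "\<And>i::nat. x [^] int i = \<one> \<Longrightarrow> N dvd i"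
  shows "ord x = N"
proof (rule dvd_antisym)
  show "ord x dvd N"
    using assms(1,2) by (simp add: int_pow_eq_id)
  show "N dvd ord x"
    using assms(1) by (intro assms(3)) (simp add: int_pow_eq_id)
qed

text \<open>If x = hk is a p-element, then k is killed by a p-power, because x and h are and the
  factors commute, and also by R; hence k is trivial.\<close>

lemma p_elements_of_splitting:
  assumes H: "subgroup H G" and K: "subgroup K G"
    and H_pow: "\<And>h. h \<in> H \<Longrightarrow> h [^] (p ^ e) = \<one>" and K_pow: "\<And>h. h \<in> K \<Longrightarrow> h [^] R = \<one>"
    and comm: "\<And>h k. \<lbrakk>h \<in> H; k \<in> K\<rbrakk> \<Longrightarrow> h \<otimes> k = k \<otimes> h"
    and prod: "\<And>x. x \<in> carrier G \<Longrightarrow> \<exists>h\<in>H. \<exists>k\<in>K. x = h \<otimes> k"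
    and p: "Factorial_Ring.prime p" "coprime p R"
  shows "p_elements G p = H"
proof (intro equalityI subsetI)
  fix x assume x: "x \<in> H"
  have xG: "x \<in> carrier G"
    by (rule subgroup.mem_carrier [OF H x])
  show "x \<in> p_elements G p"
    using ord_prime_power [OF xG H_pow [OF x] p(1)] xG by (simp add: p_elements_def)
next
  fix x assume "x \<in> p_elements G p"
  then obtain i where x: "x \<in> carrier G" "ord x = p ^ i"
    unfolding p_elements_def by blast
  obtain h k where hk: "h \<in> H" "k \<in> K" "x = h \<otimes> k"
    using prod [OF x(1)] by blast
  have G: "h \<in> carrier G" "k \<in> carrier G"
    by (rule subgroup.mem_carrier [OF H hk(1)], rule subgroup.mem_carrier [OF K hk(2)])
  have "x [^] (p ^ i * p ^ e) = \<one>"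
    using x by (simp add: pow_eq_id)
  moreover have "x [^] (p ^ i * p ^ e) = h [^] (p ^ i * p ^ e) \<otimes> k [^] (p ^ i * p ^ e)"
    unfolding hk(3) using comm [OF hk(1,2)] G by (rule pow_mult_distrib)
  moreover have "h [^] (p ^ i * p ^ e) = \<one>"
    using H_pow [OF hk(1)] G by (simp add: pow_eq_id)
  ultimately have "k [^] (p ^ i * p ^ e) = \<one>"
    using G by simp
  moreover have "coprime (p ^ i * p ^ e) R"
    using p(2) by simp
  ultimately have "k = \<one>"
    using eq_one_of_coprime_pows [OF G(2) _ K_pow [OF hk(2)]] by blast
  then show "x \<in> H"
    using hk G by simp
qed

end

context macdonald
begin

text \<open>In \<open>apow_b\<close> with exponent \<open>p^m\<close> the power of c is trivial
  since n <= m. The exponent of a there differs from \<open>p^m\<close> by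
  \<open>p^m * (\<alpha>^(p^m) - 1)\<close> minus a defect; both terms are divisible by
  \<open>p^(2m)\<close>, hence by \<open>p^(m + n)\<close>.\<close>

lemma apow_commutes_b:
  assumes p: "Factorial_Ring.prime p" "p > 2" and m: "m > 0" "int p ^ m dvd \<alpha> - 1" and "n \<le> m"
    and "a [^] (int p ^ (m + n)) = \<one>" "c [^] (int p ^ n) = \<one>"
  shows "a [^] (int p ^ m) \<otimes> b = b \<otimes> a [^] (int p ^ m)"
proof -
  have le: "int p ^ (m + n) dvd int p ^ (m + m)"
    using assms(5) by (intro le_imp_power_dvd) simp
  have "int p ^ (m + m) dvd defect \<alpha> (p ^ m)"
    by (rule prime_power_dvd_defect [OF p m]) simp
  moreover have "int p ^ (m + m) dvd int p ^ m * (\<alpha> ^ (p ^ m) - 1)"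
  proof -
    have "int p ^ m dvd \<alpha> ^ (p ^ m) - 1"
      using prime_power_dvd_power_minus_one [OF p m, of 0 "p ^ m"] by simp
    then show ?thesis
      unfolding power_add by (intro mult_dvd_mono) simp_all
  qed
  ultimately have "int p ^ (m + m) dvd int p ^ m * (\<alpha> ^ (p ^ m) - 1) - defect \<alpha> (p ^ m)"
    by (simp add: dvd_diff)
  also have "int p ^ m * (\<alpha> ^ (p ^ m) - 1) - defect \<alpha> (p ^ m) = geosum \<alpha> (p ^ m) - int p ^ m"
    by (simp add: defect_def algebra_simps)
  finally have "a [^] (geosum \<alpha> (p ^ m) - int p ^ m) = \<one>"
    using le by (intro int_pow_eq_one_of_dvd [OF a_closed assms(6)]) (rule dvd_trans)
  then have "a [^] geosum \<alpha> (p ^ m) = a [^] (int p ^ m)"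
    using int_pow_mult [of a "geosum \<alpha> (p ^ m) - int p ^ m" "int p ^ m"] by simp
  moreover have "c [^] (int p ^ m) = \<one>"
    using assms(5) by (intro int_pow_eq_one_of_dvd [OF c_closed assms(7)] le_imp_power_dvd)
  ultimately show ?thesis
    using apow_b [of "p ^ m"] by simp
qed

lemma restrict_carrier:
  assumes "subgroup H G" "a \<in> H" "b \<in> H" "c \<in> H"
  shows "macdonald (G\<lparr>carrier := H\<rparr>) a b c \<alpha> \<beta>"
    and "macdonald.normal_forms (G\<lparr>carrier := H\<rparr>) a b c = normal_forms"
proof -
  interpret S: group "G\<lparr>carrier := H\<rparr>"
    using assms(1) by (rule subgroup.subgroup_is_group [OF _ is_group])
  note pow = int_pow_consistent [OF assms(1)]
  show M: "macdonald (G\<lparr>carrier := H\<rparr>) a b c \<alpha> \<beta>"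
    by unfold_locales
      (use assms ab ac cb pow [OF assms(2)] pow [OF assms(3)] in simp_all)
  show "macdonald.normal_forms (G\<lparr>carrier := H\<rparr>) a b c = normal_forms"
    unfolding macdonald.normal_forms_def [OF M] normal_forms_def
    using pow [OF assms(2)] pow [OF assms(3)] pow [OF assms(4)] by simp
qed

lemma normal_forms_class_three:
  assumes p: "Factorial_Ring.prime p" "p > 2"
    and t1: "\<alpha> - 1 = int p ^ m * t\<^sub>1" "\<not> int p dvd t\<^sub>1" and t2: "\<beta> - 1 = int p ^ n * t\<^sub>2"
    and nm: "n \<le> m" "0 < n"
    and bounds: "a [^] (int p ^ (m + n)) = \<one>" "b [^] (int p ^ (2 * n)) = \<one>" "c [^] (int p ^ n) = \<one>"
    and ord_a: "ord a = p ^ (m + n)" and sub: "subgroup normal_forms G"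
  shows "nilpotency_class_eq (G\<lparr>carrier := normal_forms\<rparr>) 3"
proof -
  have mem: "a \<in> normal_forms" "b \<in> normal_forms" "c \<in> normal_forms"
    using normal_formsI [of 1 0 0] normal_formsI [of 0 0 1] normal_formsI [of 0 1 0]
    by simp_all
  interpret S: macdonald "G\<lparr>carrier := normal_forms\<rparr>" a b c \<alpha> \<beta>
    by (rule restrict_carrier(1) [OF sub mem])
  interpret sw: macdonald G b a "inv c" \<beta> \<alpha>
    by (rule swapped)
  have "a [^] (int p ^ m) \<otimes> b = b \<otimes> a [^] (int p ^ m)"
    by (rule apow_commutes_b [OF p _ _ nm(1) bounds(1,3)]) (use nm t1 in simp_all)
  from commute_int_pow [OF _ _ this, of t\<^sub>1]
  have za: "a [^] (\<alpha> - 1) \<otimes> b = b \<otimes> a [^] (\<alpha> - 1)"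
    by (simp add: int_pow_pow t1(1))
  \<comment> \<open>With the roles exchanged, both exponents of \<open>apow_commutes_b\<close> are
    taken to be n, matching the bound 2n for b.\<close>
  have "b [^] (int p ^ n) \<otimes> a = a \<otimes> b [^] (int p ^ n)"
    by (rule sw.apow_commutes_b [OF p nm(2) _ order_refl])
      (use t2 bounds in \<open>simp_all add: mult_2 int_pow_inv\<close>)
  from commute_int_pow [OF _ _ this, of t\<^sub>2]
  have zb: "b [^] (\<beta> - 1) \<otimes> a = a \<otimes> b [^] (\<beta> - 1)"
    by (simp add: int_pow_pow t2)
  \<comment> \<open>The valuation m of \<alpha> - 1 is smaller than m + n, as n is positive.\<close>
  have ne: "a [^] (\<alpha> - 1) \<noteq> \<one>"
  proof
    assume "a [^] (\<alpha> - 1) = \<one>"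
    then have "int (p ^ (m + n)) dvd \<alpha> - 1"
      by (simp only: int_pow_eq_id a_closed ord_a)
    then have "int p ^ m * int p ^ n dvd int p ^ m * t\<^sub>1"
      by (simp add: t1(1) power_add)
    then have "int p ^ n dvd t\<^sub>1"
      using prime_gt_0_nat [OF p(1)] by simp
    then show False
      using t1(2) nm(2) by (meson dvd_power dvd_trans)
  qed
  note pow = int_pow_consistent [OF sub mem(1)] int_pow_consistent [OF sub mem(2)]
  show ?thesis
  proof (rule S.nilpotency_class_three)
    show "carrier (G\<lparr>carrier := normal_forms\<rparr>) \<subseteq> S.normal_forms"
      using restrict_carrier(2) [OF sub mem] by simp
  qed (use za zb ne in \<open>simp_all add: pow [symmetric]\<close>)
qed

lemma normal_forms_eq_image:
  fixes d\<^sub>a d\<^sub>c d\<^sub>b :: nat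
  assumes "a [^] int d\<^sub>a = \<one>" "c [^] int d\<^sub>c = \<one>" "b [^] int d\<^sub>b = \<one>" "d\<^sub>a > 0" "d\<^sub>c > 0" "d\<^sub>b > 0"
  shows "normal_forms = (\<lambda>(i, k, j). a [^] int i \<otimes> c [^] int k \<otimes> b [^] int j) ` ({..<d\<^sub>a} \<times> {..<d\<^sub>c} \<times> {..<d\<^sub>b})"
proof -
  have reduce: "\<exists>j<n. x [^] i = x [^] int j" if x: "x \<in> carrier G" "x [^] int n = \<one>" "n > 0" for x n and i :: int
  proof -
    have "x [^] (int n * (i div int n)) = \<one>"
      by (rule int_pow_eq_one_of_dvd [OF x(1,2)]) simp
    then have "x [^] i = x [^] (i mod int n)"
      using int_pow_mult [OF x(1), of "int n * (i div int n)" "i mod int n"] x(1) by simp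
    then show ?thesis
      using x(3) by (intro exI [of _ "nat (i mod int n)"]) (simp add: nat_less_iff)
  qed
  show ?thesis
  proof (intro equalityI subsetI)
    fix x assume "x \<in> normal_forms"
    then obtain i k j :: int where x: "x = a [^] i \<otimes> c [^] k \<otimes> b [^] j"
      unfolding normal_forms_def by blast
    obtain i' where i': "i' < d\<^sub>a" "a [^] i = a [^] int i'"
      using reduce [OF a_closed assms(1,4)] by blast
    obtain k' where k': "k' < d\<^sub>c" "c [^] k = c [^] int k'"
      using reduce [OF c_closed assms(2,5)] by blast
    obtain j' where j': "j' < d\<^sub>b" "b [^] j = b [^] int j'"
      using reduce [OF b_closed assms(3,6)] by blast
    show "x \<in> (\<lambda>(i, k, j). a [^] int i \<otimes> c [^] int k \<otimes> b [^] int j) ` ({..<d\<^sub>a} \<times> {..<d\<^sub>c} \<times> {..<d\<^sub>b})"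
      unfolding x i'(2) k'(2) j'(2) using i'(1) k'(1) j'(1)
      by (intro image_eqI [of _ _ "(i', k', j')"]) simp_all
  qed (use normal_formsI in auto)
qed

end

lemma dvd_of_dvd_unit_mult:
  assumes "Factorial_Ring.prime p" "\<not> p dvd r" "int p ^ e dvd int r * z"
  shows "int p ^ e dvd z"
proof -
  have "coprime p r"
    using assms prime_imp_coprime by blast
  then have "coprime (int p ^ e) (int r)"
    by simp
  then show ?thesis
    using assms(3) by (simp add: coprime_dvd_mult_right_iff)
qed

lemma nat_eq_of_dvd_diff:
  fixes i j N :: nat
  assumes "i < N" "j < N" "int N dvd int i - int j"
  shows "i = j"
proof -
  have "[int i = int j] (mod int N)"
    using assms(3) by (simp add: cong_iff_dvd_diff)
  then have "[i = j] (mod N)"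
    by (simp only: cong_int_iff)
  then show ?thesis
    using assms(1,2) by (simp add: cong_def)
qed

context finite_macdonald
begin

text \<open>That p does not divide r is passed on because distinctness of normal forms is known for
  exponents of a, b, c and has to be transferred to their r-th powers.\<close>

lemma p_elements_structure:
  assumes nf: "carrier G = normal_forms" and ne: "\<alpha> \<noteq> 1" "\<beta> \<noteq> 1"
    and p: "Factorial_Ring.prime p" "int p dvd \<alpha> - 1" "int p dvd \<beta> - 1"
  obtains r k :: nat where "\<not> p dvd r"
    and "macdonald G (a [^] int r) (b [^] int r) (c [^] int r) \<alpha> \<beta>"
    and "subgroup (p_elements G p) G"
    and "p_elements G p = macdonald.normal_forms G (a [^] int r) (b [^] int r) (c [^] int r)"
    and "\<forall>x\<in>{a, b, c}. p_part G p x = x [^] int r"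
    and "\<forall>x\<in>{a, b, c}. (x [^] int r) [^] (p ^ k) = \<one>"
proof -
  obtain r s k R :: nat where cop: "coprime p R"
    and mr: "macdonald G (a [^] int r) (b [^] int r) (c [^] int r) \<alpha> \<beta>"
    and ms: "macdonald G (a [^] int s) (b [^] int s) (c [^] int s) \<alpha> \<beta>"
    and "R > 0" "\<not> p dvd r"
    and split_all: "\<forall>x\<in>{a, b, c}. x = x [^] int r \<otimes> x [^] int s"
    and ordr_all: "\<forall>x\<in>{a, b, c}. (x [^] int r) [^] (p ^ k) = \<one>"
    and ords_all: "\<forall>x\<in>{a, b, c}. (x [^] int s) [^] R = \<one>"
    and comm_all: "\<forall>x\<in>{a, b, c}. \<forall>y\<in>{a, b, c}. x [^] int r \<otimes> y [^] int s = y [^] int s \<otimes> x [^] int r"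
    by (rule p_splitting [OF ne p])
  note split = bspec [OF split_all] and ordr = bspec [OF ordr_all] and ords = bspec [OF ords_all]
    and comm = bspec [OF bspec [OF comm_all]]
  define a\<^sub>r where "a\<^sub>r = a [^] int r"
  define b\<^sub>r where "b\<^sub>r = b [^] int r"
  define c\<^sub>r where "c\<^sub>r = c [^] int r"
  define a\<^sub>s where "a\<^sub>s = a [^] int s"
  define b\<^sub>s where "b\<^sub>s = b [^] int s"
  define c\<^sub>s where "c\<^sub>s = c [^] int s"
  have r_pow: "a\<^sub>r [^] (p ^ k) = \<one>" "b\<^sub>r [^] (p ^ k) = \<one>" "c\<^sub>r [^] (p ^ k) = \<one>"
    using ordr by (simp_all add: a\<^sub>r_def b\<^sub>r_def c\<^sub>r_def)
  have s_pow: "a\<^sub>s [^] R = \<one>" "b\<^sub>s [^] R = \<one>" "c\<^sub>s [^] R = \<one>"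
    using ords by (simp_all add: a\<^sub>s_def b\<^sub>s_def c\<^sub>s_def)
  interpret P0: macdonald G a\<^sub>r b\<^sub>r c\<^sub>r \<alpha> \<beta>
    unfolding a\<^sub>r_def b\<^sub>r_def c\<^sub>r_def by (rule mr)
  interpret Q0: macdonald G a\<^sub>s b\<^sub>s c\<^sub>s \<alpha> \<beta>
    unfolding a\<^sub>s_def b\<^sub>s_def c\<^sub>s_def by (rule ms)
  have ord_dvd: "ord a\<^sub>r dvd p ^ k" "ord b\<^sub>r dvd p ^ k" "ord c\<^sub>r dvd p ^ k"
      "ord a\<^sub>s dvd R" "ord b\<^sub>s dvd R" "ord c\<^sub>s dvd R"
    using r_pow s_pow by (simp_all add: pow_eq_id)
  have pk: "p ^ k > 0"
    using prime_gt_0_nat [OF p(1)] by simp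
  interpret P: finite_macdonald G a\<^sub>r b\<^sub>r c\<^sub>r \<alpha> \<beta>
    by unfold_locales (use ord_dvd pk dvd_pos_nat in blast)+
  interpret Q: finite_macdonald G a\<^sub>s b\<^sub>s c\<^sub>s \<alpha> \<beta>
    by unfold_locales (use ord_dvd \<open>R > 0\<close> dvd_pos_nat in blast)+
  define H where "H = P0.normal_forms"
  define K where "K = Q0.normal_forms"
  have H: "subgroup H G" and K: "subgroup K G"
    unfolding H_def K_def by (rule P.normal_forms_subgroup, rule Q.normal_forms_subgroup)

  \<comment> \<open>A crude exponent is enough here: orders of elements divide the cardinality of H,
    hence the product of the orders of the three generators, which is a power of p.\<close>
  have H_pow: "h [^] (p ^ (k + k + k)) = \<one>" if "h \<in> H" for h
  proof -
    have "card H dvd p ^ k * p ^ k * p ^ k"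
      unfolding H_def using P.card_normal_forms(2) ord_dvd(1-3) by (meson dvd_trans mult_dvd_mono)
    moreover have hG: "h \<in> carrier G"
      by (rule subgroup.mem_carrier [OF H that])
    moreover have "ord h dvd card H"
      using pow_card_subgroup [OF H that] pow_eq_id [OF hG] by blast
    ultimately have "ord h dvd p ^ k * p ^ k * p ^ k"
      using dvd_trans by blast
    then show ?thesis
      unfolding power_add using pow_eq_id [OF hG] by blast
  qed
  have K_pow: "h [^] (R * R * R) = \<one>" if "h \<in> K" for h
  proof -
    have "card K dvd R * R * R"
      unfolding K_def using Q.card_normal_forms(2) ord_dvd(4-6) by (meson dvd_trans mult_dvd_mono)
    moreover have hG: "h \<in> carrier G"
      by (rule subgroup.mem_carrier [OF K that])
    moreover have "ord h dvd card K"
      using pow_card_subgroup [OF K that] pow_eq_id [OF hG] by blast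
    ultimately have "ord h dvd R * R * R"
      using dvd_trans by blast
    then show ?thesis
      using pow_eq_id [OF hG] by blast
  qed

  have gens: "x \<otimes> y = y \<otimes> x" if "x \<in> {a\<^sub>r, b\<^sub>r, c\<^sub>r}" "y \<in> {a\<^sub>s, b\<^sub>s, c\<^sub>s}" for x y
    using that comm by (auto simp: a\<^sub>r_def b\<^sub>r_def c\<^sub>r_def a\<^sub>s_def b\<^sub>s_def c\<^sub>s_def)
  have HK: "h \<otimes> g = g \<otimes> h" if hg: "h \<in> H" "g \<in> K" for h g
  proof -
    obtain i l j :: int where h: "h = a\<^sub>r [^] i \<otimes> c\<^sub>r [^] l \<otimes> b\<^sub>r [^] j"
      using hg unfolding H_def P0.normal_forms_def by blast
    obtain i' l' j' :: int where g: "g = a\<^sub>s [^] i' \<otimes> c\<^sub>s [^] l' \<otimes> b\<^sub>s [^] j'"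
      using hg unfolding K_def Q0.normal_forms_def by blast
    have gx: "g \<otimes> x = x \<otimes> g" if x: "x \<in> {a\<^sub>r, b\<^sub>r, c\<^sub>r}" for x
    proof -
      have "x \<in> carrier G"
        using x by auto
      moreover have "a\<^sub>s \<otimes> x = x \<otimes> a\<^sub>s" "b\<^sub>s \<otimes> x = x \<otimes> b\<^sub>s" "c\<^sub>s \<otimes> x = x \<otimes> c\<^sub>s"
        using gens [OF x] by simp_all
      ultimately show ?thesis
        unfolding g by (intro commute_mult commute_int_pow int_pow_closed m_closed
            Q0.a_closed Q0.b_closed Q0.c_closed)
    qed
    have gG: "g \<in> carrier G"
      by (rule subgroup.mem_carrier [OF K hg(2)])
    have "a\<^sub>r \<otimes> g = g \<otimes> a\<^sub>r" "b\<^sub>r \<otimes> g = g \<otimes> b\<^sub>r" "c\<^sub>r \<otimes> g = g \<otimes> c\<^sub>r"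
      using gx by simp_all
    then show ?thesis
      unfolding h using gG by (intro commute_mult commute_int_pow int_pow_closed m_closed
          P0.a_closed P0.b_closed P0.c_closed)
  qed
  have prod: "\<exists>h\<in>H. \<exists>g\<in>K. x = h \<otimes> g" if x: "x \<in> carrier G" for x
  proof -
    have "x \<in> normal_forms"
      using x nf by simp
    then obtain i l j :: int where x: "x = a [^] i \<otimes> c [^] l \<otimes> b [^] j"
      unfolding normal_forms_def by blast
    have sp: "y [^] i = (y [^] int r) [^] i \<otimes> (y [^] int s) [^] i"
      if y: "y \<in> {a, b, c}" for y and i :: int
    proof -
      have "y \<in> carrier G" using y by auto
      then have "(y [^] int r \<otimes> y [^] int s) [^] i
          = (y [^] int r) [^] i \<otimes> (y [^] int s) [^] i"
        using comm [OF y y] by (intro int_pow_mult_distrib) simp_all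
      then show ?thesis
        using split [OF y] by simp
    qed
    have A: "a [^] i = a\<^sub>r [^] i \<otimes> a\<^sub>s [^] i"
      and B: "b [^] j = b\<^sub>r [^] j \<otimes> b\<^sub>s [^] j"
      and C: "c [^] l = c\<^sub>r [^] l \<otimes> c\<^sub>s [^] l"
      unfolding a\<^sub>r_def b\<^sub>r_def c\<^sub>r_def a\<^sub>s_def b\<^sub>s_def c\<^sub>s_def by (rule sp, simp)+
    have ca: "a\<^sub>s [^] i \<otimes> c\<^sub>r [^] l = c\<^sub>r [^] l \<otimes> a\<^sub>s [^] i"
      using commute_int_pow2 [of c\<^sub>r a\<^sub>s l i] gens [of c\<^sub>r a\<^sub>s] by simp
    have cb: "(a\<^sub>s [^] i \<otimes> c\<^sub>s [^] l) \<otimes> b\<^sub>r [^] j = b\<^sub>r [^] j \<otimes> (a\<^sub>s [^] i \<otimes> c\<^sub>s [^] l)"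
      using commute_int_pow2 [of b\<^sub>r a\<^sub>s j i] commute_int_pow2 [of b\<^sub>r c\<^sub>s j l] gens [of b\<^sub>r a\<^sub>s] gens [of b\<^sub>r c\<^sub>s]
      by (intro commute_mult) simp_all
    have "x = a\<^sub>r [^] i \<otimes> (a\<^sub>s [^] i \<otimes> c\<^sub>r [^] l) \<otimes> c\<^sub>s [^] l \<otimes> b\<^sub>r [^] j \<otimes> b\<^sub>s [^] j"
      unfolding x A B C by (simp add: m_assoc)
    also have "\<dots> = a\<^sub>r [^] i \<otimes> c\<^sub>r [^] l \<otimes> ((a\<^sub>s [^] i \<otimes> c\<^sub>s [^] l) \<otimes> b\<^sub>r [^] j) \<otimes> b\<^sub>s [^] j"
      unfolding ca by (simp add: m_assoc)
    also have "\<dots> = (a\<^sub>r [^] i \<otimes> c\<^sub>r [^] l \<otimes> b\<^sub>r [^] j) \<otimes> (a\<^sub>s [^] i \<otimes> c\<^sub>s [^] l \<otimes> b\<^sub>s [^] j)"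
      unfolding cb by (simp add: m_assoc)
    finally show ?thesis
      unfolding H_def K_def using P0.normal_formsI Q0.normal_formsI by blast
  qed
  have cop3: "coprime p (R * R * R)"
    using cop by simp
  have pel: "p_elements G p = H"
    by (rule p_elements_of_splitting [OF H K H_pow K_pow HK prod p(1) cop3])
  have part: "p_part G p x = x [^] int r" if x: "x \<in> {a, b, c}" for x
  proof -
    have "x \<in> carrier G" using x by auto
    then show ?thesis
      by (intro p_part_eqI [OF _ _ split [OF x] comm [OF x x] ordr [OF x] ords [OF x] cop p(1)]) simp_all
  qed
  show thesis
  proof (rule that [OF \<open>\<not> p dvd r\<close> mr _ _ _ ordr_all])
    show "subgroup (p_elements G p) G"
      unfolding pel by (rule H)
    show "p_elements G p = macdonald.normal_forms G (a [^] int r) (b [^] int r) (c [^] int r)"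
      unfolding pel H_def a\<^sub>r_def b\<^sub>r_def c\<^sub>r_def ..
    show "\<forall>x\<in>{a, b, c}. p_part G p x = x [^] int r"
      using part by (rule ballI)
  qed
qed

end

theorem theorem5p1:
  fixes p :: nat and \<alpha> \<beta> :: int
  assumes "Factorial_Ring.prime p"
    and "\<alpha> \<noteq> 1" and "\<beta> \<noteq> 1"
    and "p > 3 \<or> (p = 3 \<and> \<alpha> mod 9 \<noteq> 7 \<and> \<beta> mod 9 \<noteq> 7)"
    and "multiplicity (int p) (\<alpha> - 1) \<ge> multiplicity (int p) (\<beta> - 1)"
    and "multiplicity (int p) (\<beta> - 1) = multiplicity (int p) (\<alpha> - \<beta>)"
    and "multiplicity (int p) (\<alpha> - \<beta>) > 0"
  shows "let G = Gab \<alpha> \<beta>; P = p_elements G p; Gp = G\<lparr>carrier := P\<rparr>;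
             m = multiplicity (int p) (\<alpha> - 1); n = multiplicity (int p) (\<beta> - 1)
         in card P = p ^ (4 * n + m)
          \<and> nilpotency_class_eq Gp 3
          \<and> group.ord G (p_part G p (genA \<alpha> \<beta>)) = p ^ (m + n)
          \<and> group.ord G (p_part G p (genB \<alpha> \<beta>)) = p ^ (2 * n)
          \<and> group.ord G (p_part G p (genC \<alpha> \<beta>)) = p ^ n"
proof -
  define G where "G = Gab \<alpha> \<beta>"
  define a where "a = genA \<alpha> \<beta>"
  define b where "b = genB \<alpha> \<beta>"
  define c where "c = genC \<alpha> \<beta>"
  define m where "m = multiplicity (int p) (\<alpha> - 1)"
  define n where "n = multiplicity (int p) (\<beta> - 1)"
  have nm: "n \<le> m" "0 < n"
    using assms(5-7) by (simp_all add: m_def n_def)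
  have p2: "p > 2" and p0: "p > 0"
    using assms(4) by auto
  have "odd p"
    using prime_odd_nat [OF assms(1) p2] .
  have "\<not> is_unit (int p)" "\<alpha> - 1 \<noteq> 0" "\<beta> - 1 \<noteq> 0"
    using assms(1-3) by auto
  have "\<alpha> - \<beta> \<noteq> 0"
    using assms(7) by auto
  obtain t\<^sub>1 where t1: "\<alpha> - 1 = int p ^ m * t\<^sub>1" "\<not> int p dvd t\<^sub>1"
    unfolding m_def using multiplicity_decompose' [OF \<open>\<alpha> - 1 \<noteq> 0\<close> \<open>\<not> is_unit (int p)\<close>] by metis
  obtain t\<^sub>2 where t2: "\<beta> - 1 = int p ^ n * t\<^sub>2" "\<not> int p dvd t\<^sub>2"
    unfolding n_def using multiplicity_decompose' [OF \<open>\<beta> - 1 \<noteq> 0\<close> \<open>\<not> is_unit (int p)\<close>] by metis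
  obtain t\<^sub>3 where t3: "\<alpha> - \<beta> = int p ^ n * t\<^sub>3" "\<not> int p dvd t\<^sub>3"
    unfolding n_def assms(6) using multiplicity_decompose' [OF \<open>\<alpha> - \<beta> \<noteq> 0\<close> \<open>\<not> is_unit (int p)\<close>] by metis
  \<comment> \<open>This q divides both \<alpha> - 1 and \<beta> - 1 since n <= m, and it turns the
    moduli \<open>(\<alpha> - 1) * q\<close> and \<open>(\<beta> - 1) * q\<close> into multiples of
    \<open>p^(m + n)\<close> and \<open>p^(2n)\<close>.\<close>
  define q where "q = int p ^ n"
  have q: "q dvd \<alpha> - 1" "q dvd \<beta> - 1" "odd q"
    using t1(1) t2(1) \<open>odd p\<close> nm by (auto simp: q_def le_imp_power_dvd)
  have p_dvd: "int p dvd \<alpha> - 1" "int p dvd \<beta> - 1"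
    using t1(1) t2(1) nm by simp_all

  interpret M: finite_macdonald G a b c \<alpha> \<beta>
    unfolding G_def a_def b_def c_def by (rule macdonald.finite_macdonald [OF macdonald_Gab assms(2,3)])
  have nf: "carrier G = M.normal_forms"
    unfolding G_def a_def b_def c_def by (rule carrier_Gab_normal_forms [OF assms(2,3)])
  obtain r k :: nat where "\<not> p dvd r"
    and mr: "macdonald G (a [^]\<^bsub>G\<^esub> int r) (b [^]\<^bsub>G\<^esub> int r) (c [^]\<^bsub>G\<^esub> int r) \<alpha> \<beta>"
    and sub: "subgroup (p_elements G p) G"
    and pel_nf: "p_elements G p
      = macdonald.normal_forms G (a [^]\<^bsub>G\<^esub> int r) (b [^]\<^bsub>G\<^esub> int r) (c [^]\<^bsub>G\<^esub> int r)"
    and part: "\<forall>x\<in>{a, b, c}. p_part G p x = x [^]\<^bsub>G\<^esub> int r"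
    and ordr: "\<forall>x\<in>{a, b, c}. (x [^]\<^bsub>G\<^esub> int r) [^]\<^bsub>G\<^esub> (p ^ k) = \<one>\<^bsub>G\<^esub>"
    by (rule M.p_elements_structure [OF nf assms(2,3,1) p_dvd])
  define a\<^sub>r where "a\<^sub>r = a [^]\<^bsub>G\<^esub> int r"
  define b\<^sub>r where "b\<^sub>r = b [^]\<^bsub>G\<^esub> int r"
  define c\<^sub>r where "c\<^sub>r = c [^]\<^bsub>G\<^esub> int r"
  have r_pow: "a\<^sub>r [^]\<^bsub>G\<^esub> (p ^ k) = \<one>\<^bsub>G\<^esub>" "b\<^sub>r [^]\<^bsub>G\<^esub> (p ^ k) = \<one>\<^bsub>G\<^esub>" "c\<^sub>r [^]\<^bsub>G\<^esub> (p ^ k) = \<one>\<^bsub>G\<^esub>"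
    using ordr by (simp_all add: a\<^sub>r_def b\<^sub>r_def c\<^sub>r_def)
  interpret P0: macdonald G a\<^sub>r b\<^sub>r c\<^sub>r \<alpha> \<beta>
    unfolding a\<^sub>r_def b\<^sub>r_def c\<^sub>r_def by (rule mr)
  define H where "H = P0.normal_forms"
  have pel: "p_elements G p = H"
    unfolding H_def a\<^sub>r_def b\<^sub>r_def c\<^sub>r_def by (rule pel_nf)
  have H: "subgroup H G"
    using sub unfolding pel .

  have r_pow': "a\<^sub>r [^]\<^bsub>G\<^esub> (int p ^ k) = \<one>\<^bsub>G\<^esub>" "b\<^sub>r [^]\<^bsub>G\<^esub> (int p ^ k) = \<one>\<^bsub>G\<^esub>" "c\<^sub>r [^]\<^bsub>G\<^esub> (int p ^ k) = \<one>\<^bsub>G\<^esub>"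
    using r_pow by (simp_all add: int_pow_int [symmetric])
  have p3: "p > 3 \<or> p = 3 \<and> \<beta> mod 9 \<noteq> 7"
    using assms(4) by blast
  note bounds = P0.p_part_bounds [OF assms(1) p3 t1 t2 t3 nm r_pow']
  \<comment> \<open>Normal forms in the r-th powers are normal forms in a, b, c with all exponents
    multiplied by r; being prime to p, r cancels from the divisibilities.\<close>
  have distinct: "int p ^ (m + n) dvd int i - int i'" "int p ^ n dvd int l - int l'" "int p ^ (2 * n) dvd int j - int j'"
    if eq: "a\<^sub>r [^]\<^bsub>G\<^esub> int i \<otimes>\<^bsub>G\<^esub> c\<^sub>r [^]\<^bsub>G\<^esub> int l \<otimes>\<^bsub>G\<^esub> b\<^sub>r [^]\<^bsub>G\<^esub> int j
      = a\<^sub>r [^]\<^bsub>G\<^esub> int i' \<otimes>\<^bsub>G\<^esub> c\<^sub>r [^]\<^bsub>G\<^esub> int l' \<otimes>\<^bsub>G\<^esub> b\<^sub>r [^]\<^bsub>G\<^esub> int j'" for i l j i' l' j' :: nat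
  proof -
    have eq': "a [^]\<^bsub>G\<^esub> (int r * int i) \<otimes>\<^bsub>G\<^esub> c [^]\<^bsub>G\<^esub> (int r * int l) \<otimes>\<^bsub>G\<^esub> b [^]\<^bsub>G\<^esub> (int r * int j)
      = a [^]\<^bsub>G\<^esub> (int r * int i') \<otimes>\<^bsub>G\<^esub> c [^]\<^bsub>G\<^esub> (int r * int l') \<otimes>\<^bsub>G\<^esub> b [^]\<^bsub>G\<^esub> (int r * int j')"
      using eq by (simp only: a\<^sub>r_def b\<^sub>r_def c\<^sub>r_def M.int_pow_pow M.a_closed M.b_closed M.c_closed)
    note d = Gab_normal_forms_distinct [OF eq' [unfolded G_def a_def b_def c_def] q]
    have "int p ^ (m + n) dvd (\<alpha> - 1) * q" "int p ^ (2 * n) dvd (\<beta> - 1) * q"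
      by (simp_all add: q_def t1(1) t2(1) mult_2 power_add mult.assoc)
    note d' = dvd_trans [OF this(1) d(1)] dvd_trans [OF this(2) d(3)]
    have "int p ^ (m + n) dvd int r * (int i - int i')"
      using d'(1) by (simp only: right_diff_distrib)
    moreover have "int p ^ n dvd int r * (int l - int l')"
      using d(2) by (simp add: q_def right_diff_distrib)
    moreover have "int p ^ (2 * n) dvd int r * (int j - int j')"
      using d'(2) by (simp only: right_diff_distrib)
    ultimately show "int p ^ (m + n) dvd int i - int i'" "int p ^ n dvd int l - int l'" "int p ^ (2 * n) dvd int j - int j'"
      using dvd_of_dvd_unit_mult [OF assms(1) \<open>\<not> p dvd r\<close>] by blast+
  qed
  have dvd_nat: "p ^ e dvd i" if "int p ^ e dvd int i - int 0" for e i
    using that int_dvd_int_iff [of "p ^ e" i] by simp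
  have ord_a: "M.ord a\<^sub>r = p ^ (m + n)"
  proof (rule M.ord_eqI)
    show "p ^ (m + n) dvd i" if "a\<^sub>r [^]\<^bsub>G\<^esub> int i = \<one>\<^bsub>G\<^esub>" for i
      using distinct(1) [of i 0 0 0 0 0] that dvd_nat by simp
  qed (use bounds in simp_all)
  have ord_b: "M.ord b\<^sub>r = p ^ (2 * n)"
  proof (rule M.ord_eqI)
    show "p ^ (2 * n) dvd i" if "b\<^sub>r [^]\<^bsub>G\<^esub> int i = \<one>\<^bsub>G\<^esub>" for i
      using distinct(3) [of 0 0 i 0 0 0] that dvd_nat by simp
  qed (use bounds in simp_all)
  have ord_c: "M.ord c\<^sub>r = p ^ n"
  proof (rule M.ord_eqI)
    show "p ^ n dvd i" if "c\<^sub>r [^]\<^bsub>G\<^esub> int i = \<one>\<^bsub>G\<^esub>" for i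
      using distinct(2) [of 0 i 0 0 0 0] that dvd_nat by simp
  qed (use bounds in simp_all)

  have "card H = p ^ (4 * n + m)"
  proof -
    let ?f = "\<lambda>(i, l, j). a\<^sub>r [^]\<^bsub>G\<^esub> int i \<otimes>\<^bsub>G\<^esub> c\<^sub>r [^]\<^bsub>G\<^esub> int l \<otimes>\<^bsub>G\<^esub> b\<^sub>r [^]\<^bsub>G\<^esub> int j"
    let ?D = "{..<p ^ (m + n)} \<times> {..<p ^ n} \<times> {..<p ^ (2 * n)}"
    have "H = ?f ` ?D"
      unfolding H_def using bounds p0 by (intro P0.normal_forms_eq_image) simp_all
    moreover have "inj_on ?f ?D"
    proof (rule inj_onI)
      fix x y assume xy: "x \<in> ?D" "y \<in> ?D" "?f x = ?f y"
      obtain i l j i' l' j' where e: "x = (i, l, j)" "y = (i', l', j')"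
        by (metis prod_cases3)
      note d = distinct [of i l j i' l' j']
      have "int (p ^ (m + n)) dvd int i - int i'" "int (p ^ n) dvd int l - int l'" "int (p ^ (2 * n)) dvd int j - int j'"
        using d xy(3) unfolding e of_nat_power by simp_all
      then have "i = i'" "l = l'" "j = j'"
        using xy(1,2) unfolding e by (auto intro: nat_eq_of_dvd_diff)
      then show "x = y"
        by (simp add: e)
    qed
    ultimately have "card H = card ?D"
      by (simp add: card_image)
    also have "\<dots> = p ^ (m + n) * (p ^ n * p ^ (2 * n))"
      by (simp add: card_cartesian_product)
    also have "\<dots> = p ^ (4 * n + m)"
      by (simp add: power_add [symmetric])
    finally show ?thesis .
  qed
  moreover have "nilpotency_class_eq (G\<lparr>carrier := H\<rparr>) 3"
    unfolding H_def
    by (rule P0.normal_forms_class_three [OF assms(1) p2 t1 t2(1) nm bounds ord_a H [unfolded H_def]])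
  moreover have "p_part G p a = a\<^sub>r" "p_part G p b = b\<^sub>r" "p_part G p c = c\<^sub>r"
    using part by (simp_all add: a\<^sub>r_def b\<^sub>r_def c\<^sub>r_def)
  ultimately show ?thesis
    using pel ord_a ord_b ord_c
    unfolding Let_def G_def [symmetric] a_def [symmetric] b_def [symmetric] c_def [symmetric]
      m_def [symmetric] n_def [symmetric]
    by simp
qed

end
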